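(* Let $s\ge2$ and let $(Y_i)_{i=1}^s$ be i.i.d. from $P_0$. For any $c_1>0$, $\delta>0$ and $\lambda$ with $\frac{32c_1\kappa}s\log\frac3\delta\le\lambda\le\|\Sigma_0\|_{\mathcal L^\infty(\mathscr H)}$, $$P_0^s\left\{(Y_i)_{i=1}^s:\ \hat{\mathcal N}_2(\lambda)\le\|\mathcal M\|^2_{\mathcal L^\infty(\mathscr H)}\left(\mathcal N_2(\lambda)+\Big(\frac{\sqrt2}{c_1}+\frac1{\sqrt{2c_1}}\Big)\sqrt{\mathcal N_1(\lambda)}\right)\right\}\ge1-2\delta,$$ where $\mathcal M=\hat\Sigma_{0,\lambda}^{-1/2}\Sigma_{0,\lambda}^{1/2}$. Furthermore, if $C:=\sup_i\|\phi_i\|_\infty<\infty$, the same bound holds when $32c_1C^2\mathcal N_1(\lambda)\log\frac3\delta\le s$ and $\lambda\le\|\Sigma_0\|_{\mathcal L^\infty(\mathscr H)}$.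
   Context: $(\mathcal X,\mathcal B)$ is a second countable space with its Borel $\sigma$-algebra; $\mathscr H$ is an RKHS of real functions on $\mathcal X$ with continuous reproducing kernel $K$, $\sup_xK(x,x)\le\kappa$. $P_0$ is a probability measure on $\mathcal X$, $\mu_0=\int K(\cdot,x)\,dP_0(x)$; $\lambda>0$ throughout. $\mathfrak I:\mathscr H\to L^2(P_0)$, $f\mapsto[f-\mathbb E_{P_0}f]_\sim$, with adjoint $\mathfrak I^*$; $\mathcal T=\mathfrak I\mathfrak I^*=\sum_i\lambda_i\,\tilde\phi_i\otimes\tilde\phi_i$ on $L^2(P_0)$ (infinitely many positive decreasing eigenvalues $\lambda_i$, orthonormal $\tilde\phi_i$); $\phi_i=\lambda_i^{-1}\mathfrak I^*\tilde\phi_i\in\mathscr H$, $\|\phi_i\|_\infty=\sup_x|\phi_i(x)|$. $\Sigma_0=\mathfrak I^*\mathfrak I=\int(K(\cdot,x)-\mu_0)\otimes_{\mathscr H}(K(\cdot,x)-\mu_0)\,dP_0(x)$, $\Sigma_{0,\lambda}=\Sigma_0+\lambda I$, $\mathcal N_1(\lambda)=\mathrm{Tr}(\Sigma_{0,\lambda}^{-1/2}\Sigma_0\Sigma_{0,\lambda}^{-1/2})$, $\mathcal N_2(\lambda)=\|\Sigma_{0,\lambda}^{-1/2}\Sigma_0\Sigma_{0,\lambda}^{-1/2}\|_{\mathcal L^2(\mathscr H)}$. $\hat\Sigma_0=\frac1{2s(s-1)}\sum_{i\ne j}(K(\cdot,Y_i)-K(\cdot,Y_j))\otimes_{\mathscr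 H}(K(\cdot,Y_i)-K(\cdot,Y_j))$, $\hat\Sigma_{0,\lambda}=\hat\Sigma_0+\lambda I$, $\hat{\mathcal N}_2(\lambda)=\|\hat\Sigma_{0,\lambda}^{-1/2}\hat\Sigma_0\hat\Sigma_{0,\lambda}^{-1/2}\|_{\mathcal L^2(\mathscr H)}$. $\|\cdot\|_{\mathcal L^\infty}$ and $\|\cdot\|_{\mathcal L^2}$ are operator and Hilbert–Schmidt norms. *)

theory Defs
  imports "HOL-Probability.Probability"
begin

section \<open>Operators on a real Hilbert space\<close>

definition positive_op :: "('h::{real_inner,banach} \<Rightarrow>\<^sub>L 'h) \<Rightarrow> bool" where
  "positive_op A \<longleftrightarrow>
     (\<forall>f g. inner (blinfun_apply A f) g = inner f (blinfun_apply A g)) \<and>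
     (\<forall>f. 0 \<le> inner (blinfun_apply A f) f)"

definition sqrt_op :: "('h::{real_inner,banach} \<Rightarrow>\<^sub>L 'h) \<Rightarrow> ('h \<Rightarrow>\<^sub>L 'h)" where
  "sqrt_op A = (THE B. positive_op B \<and> B o\<^sub>L B = A)"

definition inverse_op :: "('h::{real_inner,banach} \<Rightarrow>\<^sub>L 'h) \<Rightarrow> ('h \<Rightarrow>\<^sub>L 'h)" where
  "inverse_op A = (THE B. A o\<^sub>L B = id_blinfun \<and> B o\<^sub>L A = id_blinfun)"

definition tensor_op :: "'h::{real_inner,banach} \<Rightarrow> 'h \<Rightarrow> ('h \<Rightarrow>\<^sub>L 'h)" where
  "tensor_op a b = Blinfun (\<lambda>f. inner b f *\<^sub>R a)"

lemma tensor_op_apply [simp]: "blinfun_apply (tensor_op a b) f = inner b f *\<^sub>R a"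
  unfolding tensor_op_def
  by (subst bounded_linear_Blinfun_apply)
    (auto intro: bounded_linear_compose[OF bounded_linear_scaleR_left bounded_linear_inner_right])

definition orthonormal_basis :: "'h::{real_inner,banach} set \<Rightarrow> bool" where
  "orthonormal_basis B \<longleftrightarrow>
     (\<forall>e\<in>B. norm e = 1) \<and> pairwise orthogonal B \<and> closure (span B) = UNIV"

definition onb :: "'h::{real_inner,banach} set" where
  "onb = (SOME B. orthonormal_basis B)"

text \<open>Both sums are independent of the chosen basis for trace class, respectively
  Hilbert-Schmidt, operators. Outside these classes the values carry no meaning, since
  \<^const>\<open>infsum\<close> is 0 for families that are not summable.\<close>

definition trace_op :: "('h::{real_inner,banach} \<Rightarrow>\<^sub>L 'h) \<Rightarrow> real" where
  "trace_op A = (\<Sum>\<^sub>\<infinity>e\<in>onb. inner (blinfun_apply A e) e)"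

definition hs_norm :: "('h::{real_inner,banach} \<Rightarrow>\<^sub>L 'h) \<Rightarrow> real" where
  "hs_norm A = sqrt (\<Sum>\<^sub>\<infinity>e\<in>onb. (norm (blinfun_apply A e))\<^sup>2)"

definition regularize :: "('h::{real_inner,banach} \<Rightarrow>\<^sub>L 'h) \<Rightarrow> real \<Rightarrow> ('h \<Rightarrow>\<^sub>L 'h)" where
  "regularize A l = A + l *\<^sub>R id_blinfun"

definition inv_sqrt_reg :: "('h::{real_inner,banach} \<Rightarrow>\<^sub>L 'h) \<Rightarrow> real \<Rightarrow> ('h \<Rightarrow>\<^sub>L 'h)" where
  "inv_sqrt_reg A l = inverse_op (sqrt_op (regularize A l))"

definition N1 :: "('h::{real_inner,banach} \<Rightarrow>\<^sub>L 'h) \<Rightarrow> real \<Rightarrow> real" where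
  "N1 A l = trace_op (inv_sqrt_reg A l o\<^sub>L A o\<^sub>L inv_sqrt_reg A l)"

definition N2 :: "('h::{real_inner,banach} \<Rightarrow>\<^sub>L 'h) \<Rightarrow> real \<Rightarrow> real" where
  "N2 A l = hs_norm (inv_sqrt_reg A l o\<^sub>L A o\<^sub>L inv_sqrt_reg A l)"


section \<open>Square integrable functions\<close>

text \<open>Elements of $L^2(P)$ are handled through representatives; equality in $L^2(P)$ is
  equality almost everywhere, i.e. vanishing of \<open>L2_norm\<close> of the difference.\<close>

definition L2_set :: "'x measure \<Rightarrow> ('x \<Rightarrow> real) set" where
  "L2_set P = {g \<in> borel_measurable P. integrable P (\<lambda>x. (g x)\<^sup>2)}"

definition L2_inner :: "'x measure \<Rightarrow> ('x \<Rightarrow> real) \<Rightarrow> ('x \<Rightarrow> real) \<Rightarrow> real" where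
  "L2_inner P g h = (\<integral>x. g x * h x \<partial>P)"

definition L2_norm :: "'x measure \<Rightarrow> ('x \<Rightarrow> real) \<Rightarrow> real" where
  "L2_norm P g = sqrt (L2_inner P g g)"

definition L2_adjoint ::
    "'x measure \<Rightarrow> ('h::{real_inner,banach} \<Rightarrow> 'x \<Rightarrow> real) \<Rightarrow> ('x \<Rightarrow> real) \<Rightarrow> 'h" where
  "L2_adjoint P J g = (THE h. \<forall>f. inner f h = L2_inner P (J f) g)"


section \<open>Reproducing kernel Hilbert spaces\<close>

text \<open>The Hilbert space of functions is the type \<open>'h\<close>, identified with a space of functions on
  \<open>'x\<close> through the injective linear map \<open>evl\<close>, where \<open>evl f x\<close> is the value $f(x)$.\<close>

locale rkhs =
  fixes evl :: "'h::{real_inner,banach} \<Rightarrow> 'x \<Rightarrow> real"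
    and K :: "'x \<Rightarrow> 'x \<Rightarrow> real"
  assumes evl_add: "evl (f + g) x = evl f x + evl g x"
    and evl_scaleR: "evl (c *\<^sub>R f) x = c * evl f x"
    and evl_inj: "inj evl"
    and kernel_in_range: "(\<lambda>y. K y x) \<in> range evl"
    and reproducing: "evl k = (\<lambda>y. K y x) \<Longrightarrow> inner f k = evl f x"

text \<open>\<open>ksec evl K x\<close> is $K(\cdot,x)$ as an element of the Hilbert space.\<close>

definition ksec ::
    "('h::{real_inner,banach} \<Rightarrow> 'x \<Rightarrow> real) \<Rightarrow> ('x \<Rightarrow> 'x \<Rightarrow> real) \<Rightarrow> 'x \<Rightarrow> 'h" where
  "ksec evl K x = inv evl (\<lambda>y. K y x)"

lemma (in rkhs) evl_ksec: "evl (ksec evl K x) = (\<lambda>y. K y x)"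
  unfolding ksec_def by (rule f_inv_into_f[OF kernel_in_range])

lemma (in rkhs) inner_ksec: "inner f (ksec evl K x) = evl f x"
  by (rule reproducing[OF evl_ksec])

definition centered :: "'x measure \<Rightarrow> ('h::{real_inner,banach} \<Rightarrow> 'x \<Rightarrow> real) \<Rightarrow> 'h \<Rightarrow> 'x \<Rightarrow> real" where
  "centered P evl f = (\<lambda>x. evl f x - (\<integral>y. evl f y \<partial>P))"

definition centered_adj ::
    "'x measure \<Rightarrow> ('h::{real_inner,banach} \<Rightarrow> 'x \<Rightarrow> real) \<Rightarrow> ('x \<Rightarrow> real) \<Rightarrow> 'h" where
  "centered_adj P evl = L2_adjoint P (centered P evl)"

definition integral_op ::
    "'x measure \<Rightarrow> ('h::{real_inner,banach} \<Rightarrow> 'x \<Rightarrow> real) \<Rightarrow> ('x \<Rightarrow> real) \<Rightarrow> 'x \<Rightarrow> real" where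
  "integral_op P evl g = centered P evl (centered_adj P evl g)"

definition covariance_op ::
    "'x measure \<Rightarrow> ('h::{real_inner,banach} \<Rightarrow> 'x \<Rightarrow> real) \<Rightarrow> ('h \<Rightarrow>\<^sub>L 'h)" where
  "covariance_op P evl = Blinfun (\<lambda>f. centered_adj P evl (centered P evl f))"

definition empirical_covariance ::
    "('h::{real_inner,banach} \<Rightarrow> 'x \<Rightarrow> real) \<Rightarrow> ('x \<Rightarrow> 'x \<Rightarrow> real) \<Rightarrow> nat \<Rightarrow> (nat \<Rightarrow> 'x) \<Rightarrow> ('h \<Rightarrow>\<^sub>L 'h)" where
  "empirical_covariance evl K s Y =
     (1 / (2 * real s * (real s - 1))) *\<^sub>R
     (\<Sum>(i, j) \<in> {(i, j). i \<in> {1..s} \<and> j \<in> {1..s} \<and> i \<noteq> j}.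
        tensor_op (ksec evl K (Y i) - ksec evl K (Y j)) (ksec evl K (Y i) - ksec evl K (Y j)))"

definition eigenfun ::
    "'x measure \<Rightarrow> ('h::{real_inner,banach} \<Rightarrow> 'x \<Rightarrow> real) \<Rightarrow> (nat \<Rightarrow> real) \<Rightarrow> (nat \<Rightarrow> 'x \<Rightarrow> real) \<Rightarrow> nat \<Rightarrow> 'h" where
  "eigenfun P evl ews efs i = (1 / ews i) *\<^sub>R centered_adj P evl (efs i)"

definition sup_norm :: "('x \<Rightarrow> real) \<Rightarrow> real" where
  "sup_norm g = (SUP x. \<bar>g x\<bar>)"

text \<open>\<open>ews\<close> and \<open>efs\<close> are the eigenvalues $\lambda_i$ and eigenfunctions $\tilde\phi_i$. The
  series $\sum_i \lambda_i \tilde\phi_i\otimes\tilde\phi_i$ is read in the strong sense, applied to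
  each element of $L^2(P)$. Multiple eigenvalues are repeated.\<close>

locale centered_kernel_setting = rkhs evl K + prob_space P
  for evl :: "'h::{real_inner,banach} \<Rightarrow> 'x::second_countable_topology \<Rightarrow> real"
    and K :: "'x \<Rightarrow> 'x \<Rightarrow> real"
    and P :: "'x measure"
    and \<kappa> :: real
    and ews :: "nat \<Rightarrow> real"
    and efs :: "nat \<Rightarrow> 'x \<Rightarrow> real" +
  assumes sets_P: "sets P = sets borel"
    and K_continuous: "continuous_on UNIV (\<lambda>(x, y). K x y)"
    and K_bounded: "K x x \<le> \<kappa>"
    and ews_pos: "0 < ews i"
    and ews_decreasing: "decseq ews"
    and efs_L2: "efs i \<in> L2_set P"
    and efs_orthonormal: "L2_inner P (efs i) (efs j) = (if i = j then 1 else 0)"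
    and spectral_decomposition: "g \<in> L2_set P \<Longrightarrow>
      (\<lambda>n. L2_norm P (\<lambda>x. integral_op P evl g x -
              (\<Sum>i<n. ews i * L2_inner P (efs i) g * efs i x))) \<longlonglongrightarrow> 0"

end

theory Submission
  imports Defs "HOL-Combinatorics.Permutations"
begin

text \<open>Write $W = \Sigma_{0,\lambda}^{-1/2}$. Since
  $\hat\Sigma_{0,\lambda}^{-1/2}\hat\Sigma_0\hat\Sigma_{0,\lambda}^{-1/2} = \mathcal M (W\hat\Sigma_0 W)\mathcal M^*$,
  it suffices that $W(\hat\Sigma_0 - \Sigma_0)W$ has small Hilbert--Schmidt norm. The operator $W\hat\Sigma_0W$
  is a U-statistic with kernel $\frac12 V\otimes V$, $V = W(K(\cdot,x)-K(\cdot,y))$, whose mean is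
  $W\Sigma_0W$, whose Hilbert--Schmidt norm is bounded by some $R$, and whose expected norm is
  $\mathcal N_1(\lambda)$. Hence its variance is at most $R\,\mathcal N_1(\lambda)$, and a Bernstein
  inequality applies. Here $R = 2\kappa/\lambda$ in general, and $R = 2C^2\mathcal N_1(\lambda)$ when the
  eigenfunctions are bounded by $C$, by expanding $V$ in the eigenbasis of $\Sigma_0$.

  The Bernstein inequality follows Pinelis: for a centred vector $\xi$, convexity of $u\mapsto\cosh\sqrt u$ gives
  $E\cosh\|x+\xi\| \le \cosh\|x\|\, E(e^{\|\xi\|}-\|\xi\|)$, which is iterated over independent blocks of
  two observations; Jensen's inequality over all orderings of the sample passes from the blocks to the
  U-statistic. It is proved for finitely many matrix entries with respect to an orthonormal
  basis and transferred to the Hilbert--Schmidt norm by monotone continuity of the measure.\<close>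

section \<open>Orthonormal bases of a real Hilbert space\<close>

text \<open>With L = ln(3/\<delta>), Bernstein bounds the deviation by terms of order sqrt(R N1 L/s)
  and R L/s. Both sample-size conditions say that q = R L/s is at most 1/(16 c), which makes the
  first term a multiple of sqrt(N1/c) and the second a multiple of 1/c. To fit the second under
  sqrt(N1)/c, N1 must be bounded below: \<lambda> does not exceed the norm of \<Sigma>_0, so N1 is
  at least 1/2. There are at least s/3 blocks of two observations, whence the factor 3 in
  \<open>exponent_choice\<close>. Two facts shape the formal proof. A sum over the basis has the
  value 0 when it diverges, so Hilbert-Schmidt bounds are carried as bounds over all finite sets of
  basis vectors and become norms only at the end. And the basis is countable, because the kernel is
  continuous on a second countable space: suprema over finite sets become monotone limits, and null
  sets attached to basis vectors can be united.\<close>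

definition orthonormal :: "'h::real_inner set \<Rightarrow> bool" where
  "orthonormal B \<longleftrightarrow> (\<forall>e\<in>B. norm e = 1) \<and> pairwise orthogonal B"

lemma orthonormal_inner:
  assumes "orthonormal B" "e \<in> B" "e' \<in> B"
  shows "inner e e' = (if e = e' then 1 else 0)"
  using assms
  by (auto simp: orthonormal_def pairwise_def orthogonal_def dot_square_norm)

lemma orthonormal_subset: "orthonormal B \<Longrightarrow> A \<subseteq> B \<Longrightarrow> orthonormal A"
  unfolding orthonormal_def using pairwise_subset by blast

lemma norm_sum_orthonormal:
  assumes "orthonormal F" "finite F"
  shows "(norm (\<Sum>e\<in>F. c e *\<^sub>R e))\<^sup>2 = (\<Sum>e\<in>F. (c e)\<^sup>2)"
proof -
  have "(norm (\<Sum>e\<in>F. c e *\<^sub>R e))\<^sup>2 = (\<Sum>e\<in>F. \<Sum>e'\<in>F. c e * c e' * inner e e')"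
    by (simp add: power2_norm_eq_inner inner_sum_left inner_sum_right sum_distrib_left mult.assoc)
      (simp add: mult_ac inner_commute)
  also have "\<dots> = (\<Sum>e\<in>F. \<Sum>e'\<in>F. if e = e' then c e * c e' else 0)"
    by (intro sum.cong refl) (simp add: orthonormal_inner[OF assms(1)])
  also have "\<dots> = (\<Sum>e\<in>F. (c e)\<^sup>2)"
    using assms(2) by (simp add: power2_eq_square)
  finally show ?thesis .
qed

lemma bessel_finite:
  assumes "orthonormal F" "finite F"
  shows "(\<Sum>e\<in>F. (inner x e)\<^sup>2) \<le> (norm x)\<^sup>2"
proof -
  define p where "p = (\<Sum>e\<in>F. inner x e *\<^sub>R e)"
  have pp: "inner p p = (\<Sum>e\<in>F. (inner x e)\<^sup>2)"
    unfolding p_def using norm_sum_orthonormal[OF assms, of "inner x"]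
    by (simp add: power2_norm_eq_inner)
  have xp: "inner x p = (\<Sum>e\<in>F. (inner x e)\<^sup>2)"
    by (simp add: p_def inner_sum_right power2_eq_square)
  have "0 \<le> inner (x - p) (x - p)" by simp
  also have "\<dots> = inner x x - inner p p"
    using pp xp by (simp add: inner_diff_left inner_diff_right inner_commute)
  finally show ?thesis using pp by (simp add: power2_norm_eq_inner)
qed

text \<open>Orthogonality turns the distance between nested partial sums into the gap between their
  sums of squares, so convergence of the squares makes the vector sums Cauchy. \<open>B\<close> may
  be uncountable, hence the Cauchy property along the filter of finite subsets.\<close>

lemma fourier_summable:
  fixes B :: "'h::{real_inner,banach} set"
  assumes B: "orthonormal B"
    and bound: "\<And>F. finite F \<Longrightarrow> F \<subseteq> B \<Longrightarrow> (\<Sum>e\<in>F. (c e)\<^sup>2) \<le> C"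
  shows "(\<lambda>e. c e *\<^sub>R e) summable_on B"
proof -
  have "(\<lambda>e. (c e)\<^sup>2) summable_on B"
    by (rule nonneg_bdd_above_summable_on) (auto intro!: bdd_aboveI[of _ C] bound)
  then obtain L where L: "((\<lambda>e. (c e)\<^sup>2) has_sum L) B"
    using summable_on_def by blast
  have diff: "dist (\<Sum>e\<in>F. c e *\<^sub>R e) (\<Sum>e\<in>G. c e *\<^sub>R e) < r"
    if r: "r > 0" and GF: "G \<subseteq> F" "F \<subseteq> B" "finite F" and G: "L - r\<^sup>2 < (\<Sum>e\<in>G. (c e)\<^sup>2)" for r F G
  proof -
    have fin: "finite G" using GF finite_subset by blast
    have "(dist (\<Sum>e\<in>F. c e *\<^sub>R e) (\<Sum>e\<in>G. c e *\<^sub>R e))\<^sup>2 = (norm (\<Sum>e\<in>F - G. c e *\<^sub>R e))\<^sup>2"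
      using GF fin by (simp add: dist_norm sum_diff)
    also have "\<dots> = (\<Sum>e\<in>F - G. (c e)\<^sup>2)"
      by (rule norm_sum_orthonormal) (use GF B orthonormal_subset in \<open>auto, blast\<close>)
    also have "\<dots> = (\<Sum>e\<in>F. (c e)\<^sup>2) - (\<Sum>e\<in>G. (c e)\<^sup>2)"
      using GF fin by (simp add: sum_diff)
    also have "\<dots> < r\<^sup>2"
      using finite_sum_le_has_sum[OF L \<open>finite F\<close> \<open>F \<subseteq> B\<close>] G by simp
    finally show ?thesis by (rule power2_less_imp_less) (use r in simp)
  qed
  have "\<exists>P. eventually P (finite_subsets_at_top B) \<and>
      (\<forall>F F'. P F \<and> P F' \<longrightarrow> dist (\<Sum>e\<in>F. c e *\<^sub>R e) (\<Sum>e\<in>F'. c e *\<^sub>R e) < r)" if r: "r > 0" for r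
  proof -
    define Q where "Q F \<longleftrightarrow> finite F \<and> F \<subseteq> B \<and> L - (r/2)\<^sup>2 < (\<Sum>e\<in>F. (c e)\<^sup>2)" for F
    have "eventually (\<lambda>F. L - (r/2)\<^sup>2 < (\<Sum>e\<in>F. (c e)\<^sup>2)) (finite_subsets_at_top B)"
      using L r unfolding has_sum_def by (intro order_tendstoD(1)) auto
    then have ev: "eventually Q (finite_subsets_at_top B)"
      unfolding Q_def by (intro eventually_conj) (auto intro: eventually_finite_subsets_at_top_weakI)
    moreover have "dist (\<Sum>e\<in>F. c e *\<^sub>R e) (\<Sum>e\<in>F'. c e *\<^sub>R e) < r" if "Q F" "Q F'" for F F'
    proof -
      \<comment> \<open>The estimate needs nested sets, so both sums are compared with the sum over
        the union.\<close>
      have "dist (\<Sum>e\<in>F \<union> F'. c e *\<^sub>R e) (\<Sum>e\<in>F. c e *\<^sub>R e) < r/2"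
        by (rule diff) (use that r in \<open>auto simp: Q_def\<close>)
      moreover have "dist (\<Sum>e\<in>F \<union> F'. c e *\<^sub>R e) (\<Sum>e\<in>F'. c e *\<^sub>R e) < r/2"
        by (rule diff) (use that r in \<open>auto simp: Q_def\<close>)
      ultimately show ?thesis
        using dist_triangle3[of "\<Sum>e\<in>F. c e *\<^sub>R e" "\<Sum>e\<in>F'. c e *\<^sub>R e" "\<Sum>e\<in>F \<union> F'. c e *\<^sub>R e"]
        by linarith
    qed
    ultimately show ?thesis by blast
  qed
  then have "cauchy_filter (filtermap (sum (\<lambda>e. c e *\<^sub>R e)) (finite_subsets_at_top B))"
    by (simp add: cauchy_filter_metric_filtermap)
  then obtain L' where "(sum (\<lambda>e. c e *\<^sub>R e) \<longlongrightarrow> L') (finite_subsets_at_top B)"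
    using complete_uniform[where S="UNIV::'h set"] complete_UNIV[where 'a='h] by (force simp add: filterlim_def)
  then show ?thesis
    using summable_on_def has_sum_def by blast
qed

text \<open>With \<open>c = inner x\<close> this doubles as the projection theorem for the closed
  span of \<open>B\<close>; with prescribed coefficients it yields the Riesz representer.\<close>

lemma fourier_vector:
  fixes B :: "'h::{real_inner,banach} set"
  assumes B: "orthonormal B"
    and bound: "\<And>F. finite F \<Longrightarrow> F \<subseteq> B \<Longrightarrow> (\<Sum>e\<in>F. (c e)\<^sup>2) \<le> C"
  obtains h where "((\<lambda>e. c e *\<^sub>R e) has_sum h) B" "\<And>e. e \<in> B \<Longrightarrow> inner h e = c e"
    "h \<in> closure (span B)"
proof -
  obtain h where h: "((\<lambda>e. c e *\<^sub>R e) has_sum h) B"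
    using fourier_summable[OF assms] summable_on_def by blast
  have "inner h e = c e" if "e \<in> B" for e
  proof -
    have "((\<lambda>e'. inner (c e' *\<^sub>R e') e) has_sum inner h e) B"
      by (rule has_sum_bounded_linear[OF bounded_linear_inner_left h])
    moreover have "((\<lambda>e'. inner (c e' *\<^sub>R e') e) has_sum c e) B"
      by (rule has_sum_finite_neutralI[of "{e}"]) (use that orthonormal_inner[OF B] in auto)
    ultimately show ?thesis by (rule has_sum_unique)
  qed
  moreover have "h \<in> closure (span B)"
  proof -
    have "eventually (\<lambda>F. (\<Sum>e\<in>F. c e *\<^sub>R e) \<in> span B) (finite_subsets_at_top B)"
      by (rule eventually_finite_subsets_at_top_weakI) (auto intro!: span_sum span_scale intro: span_base)
    then have "eventually (\<lambda>F. (\<Sum>e\<in>F. c e *\<^sub>R e) \<in> closure (span B)) (finite_subsets_at_top B)"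
      by (rule eventually_mono) (use closure_subset in auto)
    then show ?thesis
      using h unfolding has_sum_def
      by (intro Lim_in_closed_set) (auto simp: closed_closure)
  qed
  ultimately show ?thesis using h that by blast
qed

lemma orthogonal_closure_span:
  assumes "x \<in> closure (span B)" "\<And>e. e \<in> B \<Longrightarrow> inner u e = 0"
  shows "inner u x = 0"
proof -
  have "span B \<subseteq> {x. inner u x = 0}"
    by (rule span_minimal) (use assms(2) in \<open>auto simp: subspace_def inner_add_right\<close>)
  moreover have "closed {x. inner u x = 0}"
    by (intro closed_Collect_eq continuous_intros)
  ultimately have "closure (span B) \<subseteq> {x. inner u x = 0}"
    by (rule closure_minimal)
  then show ?thesis using assms(1) by auto
qed

text \<open>The hypothesis places \<open>x\<close> in the double orthogonal complement of
  \<open>B\<close>. This form serves a complete basis and also vectors known only to lie in the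
  closed span of the eigenvectors. The remainder \<open>x - h\<close> is orthogonal to
  \<open>B\<close>, hence to \<open>x\<close> and to \<open>h\<close>.\<close>

lemma parseval:
  fixes B :: "'h::{real_inner,banach} set"
  assumes B: "orthonormal B"
    and x: "\<And>u. (\<And>e. e \<in> B \<Longrightarrow> inner u e = 0) \<Longrightarrow> inner u x = 0"
  shows "((\<lambda>e. (inner x e)\<^sup>2) has_sum (norm x)\<^sup>2) B"
proof -
  obtain h where h: "((\<lambda>e. inner x e *\<^sub>R e) has_sum h) B" "\<And>e. e \<in> B \<Longrightarrow> inner h e = inner x e"
      "h \<in> closure (span B)"
    by (rule fourier_vector[OF B, of "inner x" "(norm x)\<^sup>2"])
      (use bessel_finite orthonormal_subset[OF B] in blast, blast)
  have orth: "inner (x - h) e = 0" if "e \<in> B" for e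
    using h(2)[OF that] by (simp add: inner_diff_left)
  have "inner (x - h) (x - h) = inner (x - h) x - inner (x - h) h"
    by (simp add: inner_diff_right)
  also have "\<dots> = 0"
    using x[OF orth] orthogonal_closure_span[OF h(3) orth] by simp
  finally have "x = h" by simp
  then have "((\<lambda>e. inner (inner x e *\<^sub>R e) x) has_sum inner x x) B"
    using has_sum_bounded_linear[OF bounded_linear_inner_left h(1), of x] by simp
  then show ?thesis
    by (simp add: power2_norm_eq_inner) (simp add: power2_eq_square inner_commute)
qed

text \<open>A maximal orthonormal set has dense span: otherwise the normalised remainder of a
  projection would enlarge it. This gives the choice in \<open>onb\<close> its meaning.\<close>

lemma orthonormal_basis_exists: "\<exists>B::'h::{real_inner,banach} set. orthonormal_basis B"
proof -
  have "\<exists>M\<in>{B::'h set. orthonormal B}. \<forall>X\<in>{B. orthonormal B}. M \<subseteq> X \<longrightarrow> X = M"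
  proof (rule subset_Zorn')
    fix C :: "'h set set" assume C: "subset.chain {B. orthonormal B} C"
    have "orthonormal (\<Union>C)"
      unfolding orthonormal_def pairwise_def
    proof (intro conjI ballI impI)
      fix e assume "e \<in> \<Union>C"
      then show "norm e = 1" using C by (auto simp: subset.chain_def orthonormal_def)
    next
      fix e e' assume "e \<in> \<Union>C" "e' \<in> \<Union>C" and ne: "e \<noteq> e'"
      then obtain X Y where XY: "X \<in> C" "Y \<in> C" "e \<in> X" "e' \<in> Y" by blast
      then have "X \<subseteq> Y \<or> Y \<subseteq> X" using C by (auto simp: subset.chain_def)
      then obtain Z where "Z \<in> C" "e \<in> Z" "e' \<in> Z" using XY by blast
      then show "orthogonal e e'"
        using C ne by (auto simp: subset.chain_def orthonormal_def pairwise_def)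
    qed
    then show "\<Union>C \<in> {B. orthonormal B}" by simp
  qed
  then obtain M :: "'h set" where M: "orthonormal M" "\<And>X. orthonormal X \<Longrightarrow> M \<subseteq> X \<Longrightarrow> X = M"
    by blast
  have "closure (span M) = UNIV"
  proof (rule ccontr)
    assume "closure (span M) \<noteq> UNIV"
    then obtain x where x: "x \<notin> closure (span M)" by blast
    obtain h where h: "((\<lambda>e. inner x e *\<^sub>R e) has_sum h) M" "\<And>e. e \<in> M \<Longrightarrow> inner h e = inner x e"
        "h \<in> closure (span M)"
      by (rule fourier_vector[OF M(1), of "inner x" "(norm x)\<^sup>2"])
        (use bessel_finite orthonormal_subset[OF M(1)] in blast, blast)
    define u where "u = (1 / norm (x - h)) *\<^sub>R (x - h)"
    have "x - h \<noteq> 0" using x h(3) by auto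
    then have u: "norm u = 1" by (simp add: u_def)
    have orth: "inner u e = 0" if "e \<in> M" for e
      using h(2)[OF that] by (simp add: u_def inner_diff_left)
    have "orthonormal (insert u M)"
      using M(1) u orth
      by (auto simp: orthonormal_def pairwise_insert orthogonal_def inner_commute)
    then have "u \<in> M" using M(2)[of "insert u M"] by auto
    then have "inner u u = 0" by (rule orth)
    then show False using u by auto
  qed
  then show ?thesis
    using M(1) by (auto simp: orthonormal_basis_def orthonormal_def)
qed

lemma onb_basis: "orthonormal_basis (onb :: 'h::{real_inner,banach} set)"
  unfolding onb_def by (rule someI_ex[OF orthonormal_basis_exists])

lemma orthonormal_onb: "orthonormal (onb :: 'h::{real_inner,banach} set)"
  using onb_basis by (auto simp: orthonormal_basis_def orthonormal_def)

lemma onb_complete: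
  fixes u :: "'h::{real_inner,banach}"
  assumes "\<And>e. e \<in> onb \<Longrightarrow> inner u e = 0"
  shows "u = 0"
proof -
  have "u \<in> closure (span onb)"
    using onb_basis by (auto simp: orthonormal_basis_def)
  then have "inner u u = 0"
    using assms by (rule orthogonal_closure_span)
  then show ?thesis by simp
qed

lemma parseval_onb:
  fixes x :: "'h::{real_inner,banach}"
  shows "((\<lambda>e. (inner x e)\<^sup>2) has_sum (norm x)\<^sup>2) onb"
proof (rule parseval[OF orthonormal_onb])
  fix u :: 'h assume "\<And>e. e \<in> onb \<Longrightarrow> inner u e = 0"
  then have "u = 0" by (rule onb_complete)
  then show "inner u x = 0" by simp
qed

text \<open>Evaluating \<phi> at the finite sum of the vectors \<open>e\<close> weighted by
  \<open>\<phi> e\<close> gives \<open>q \<le> C * sqrt q\<close> for the sum \<open>q\<close> of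
  squares, so the coefficients are square summable. Uniqueness justifies the definite description in
  \<open>L2_adjoint\<close>.\<close>

lemma riesz_representation:
  fixes \<phi> :: "'h::{real_inner,banach} \<Rightarrow> real"
  assumes "bounded_linear \<phi>"
  shows "\<exists>!h. \<forall>f. inner f h = \<phi> f"
proof -
  interpret bounded_linear \<phi> by fact
  obtain C where C: "\<And>x. \<bar>\<phi> x\<bar> \<le> norm x * C" "C \<ge> 0"
    using nonneg_bounded by auto
  have bound: "(\<Sum>e\<in>F. (\<phi> e)\<^sup>2) \<le> C\<^sup>2" if F: "finite F" "F \<subseteq> onb" for F
  proof -
    define x where "x = (\<Sum>e\<in>F. \<phi> e *\<^sub>R e)"
    define q where "q = (\<Sum>e\<in>F. (\<phi> e)\<^sup>2)"
    have q0: "q \<ge> 0" by (auto simp: q_def intro: sum_nonneg)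
    have nx: "(norm x)\<^sup>2 = q"
      unfolding x_def q_def
      by (rule norm_sum_orthonormal) (use F orthonormal_subset[OF orthonormal_onb] in auto)
    have "q = \<phi> x" by (simp add: x_def q_def sum scaleR power2_eq_square)
    also have "\<dots> \<le> norm x * C" using C(1)[of x] by linarith
    finally have "q\<^sup>2 \<le> (norm x * C)\<^sup>2" using q0 by (intro power_mono) auto
    then have "q * q \<le> q * C\<^sup>2" by (simp add: power_mult_distrib nx power2_eq_square[of q])
    then show ?thesis
      unfolding q_def[symmetric] using q0 by (cases "q = 0") auto
  qed
  obtain h where h: "\<And>e. e \<in> onb \<Longrightarrow> inner h e = \<phi> e"
    using fourier_vector[OF orthonormal_onb bound] by metis
  have "inner f h = \<phi> f" for f
  proof -
    have "span onb \<subseteq> {f. inner f h = \<phi> f}"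
      by (rule span_minimal)
        (use h in \<open>auto simp: subspace_def inner_add_left add scaleR inner_commute[of _ h] inner_add_right\<close>)
    moreover have "closed {f. inner f h = \<phi> f}"
      by (intro closed_Collect_eq continuous_intros linear_continuous_on assms)
    ultimately have "closure (span onb) \<subseteq> {f. inner f h = \<phi> f}"
      by (rule closure_minimal)
    then show ?thesis using onb_basis by (auto simp: orthonormal_basis_def)
  qed
  then show ?thesis
    by (intro ex1I[of _ h]) (auto intro: vector_eq_ldot[THEN iffD1])
qed

section \<open>Square roots and inverses of coercive operators\<close>

lemma blinfun_compose_assoc: "(A o\<^sub>L B) o\<^sub>L C = A o\<^sub>L (B o\<^sub>L C)"
  by (rule blinfun_eqI) simp

lemma blinfun_compose_id [simp]: "id_blinfun o\<^sub>L A = A" "A o\<^sub>L id_blinfun = A"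
  by (rule blinfun_eqI, simp)+

definition selfadjoint :: "('h::{real_inner,banach} \<Rightarrow>\<^sub>L 'h) \<Rightarrow> bool" where
  "selfadjoint A \<longleftrightarrow> (\<forall>f g. inner (blinfun_apply A f) g = inner f (blinfun_apply A g))"

text \<open>The explicit lower bound stands in for spectral arguments: it makes
  \<open>1 - A/c\<close> a contraction for suitable \<open>c\<close>, bounds the inverse by
  \<open>1/\<mu>\<close>, and passes to the square root with another constant.\<close>

definition coercive :: "('h::{real_inner,banach} \<Rightarrow>\<^sub>L 'h) \<Rightarrow> real \<Rightarrow> bool" where
  "coercive A \<mu> \<longleftrightarrow> selfadjoint A \<and> 0 < \<mu> \<and> (\<forall>f. \<mu> * (norm f)\<^sup>2 \<le> inner (blinfun_apply A f) f)"

lemma positive_op_selfadjoint: "positive_op A \<Longrightarrow> selfadjoint A"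
  by (simp add: positive_op_def selfadjoint_def)

lemma positive_op_nonneg: "positive_op A \<Longrightarrow> 0 \<le> inner (blinfun_apply A f) f"
  unfolding positive_op_def by blast

lemma selfadjointD: "selfadjoint A \<Longrightarrow> inner (blinfun_apply A f) g = inner f (blinfun_apply A g)"
  by (simp add: selfadjoint_def)

lemma positive_opI:
  "selfadjoint A \<Longrightarrow> (\<And>f. 0 \<le> inner (blinfun_apply A f) f) \<Longrightarrow> positive_op A"
  by (simp add: positive_op_def selfadjoint_def)

lemma coercive_positive: "coercive A \<mu> \<Longrightarrow> positive_op A"
  unfolding coercive_def by (intro positive_opI) (auto intro: order_trans[rotated])

lemma coercive_selfadjoint: "coercive A \<mu> \<Longrightarrow> selfadjoint A"
  by (simp add: coercive_def)

lemma coercive_pos: "coercive A \<mu> \<Longrightarrow> 0 < \<mu>"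
  by (simp add: coercive_def)

lemma coerciveD: "coercive A \<mu> \<Longrightarrow> \<mu> * (norm f)\<^sup>2 \<le> inner (blinfun_apply A f) f"
  by (simp add: coercive_def)

lemma selfadjoint_id: "selfadjoint id_blinfun"
  by (simp add: selfadjoint_def)

lemma selfadjoint_add: "selfadjoint A \<Longrightarrow> selfadjoint B \<Longrightarrow> selfadjoint (A + B)"
  by (simp add: selfadjoint_def blinfun.add_left inner_add_left inner_add_right)

lemma selfadjoint_diff: "selfadjoint A \<Longrightarrow> selfadjoint B \<Longrightarrow> selfadjoint (A - B)"
  by (simp add: selfadjoint_def blinfun.diff_left inner_diff_left inner_diff_right)

lemma selfadjoint_scaleR: "selfadjoint A \<Longrightarrow> selfadjoint (c *\<^sub>R A)"
  by (simp add: selfadjoint_def blinfun.scaleR_left)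

lemma selfadjoint_square: "selfadjoint A \<Longrightarrow> selfadjoint (A o\<^sub>L A)"
  by (simp add: selfadjoint_def)

lemma selfadjoint_conj: "selfadjoint W \<Longrightarrow> selfadjoint A \<Longrightarrow> selfadjoint (W o\<^sub>L A o\<^sub>L W)"
  by (simp add: selfadjoint_def)

lemma regularize_apply [simp]:
  "blinfun_apply (regularize A l) f = blinfun_apply A f + l *\<^sub>R f"
  by (simp add: regularize_def blinfun.add_left blinfun.scaleR_left)

lemma regularize_coercive:
  assumes "positive_op A" "0 < l"
  shows "coercive (regularize A l) l"
  using assms positive_op_nonneg[OF assms(1)] selfadjointD[OF positive_op_selfadjoint[OF assms(1)]]
  by (auto simp: coercive_def selfadjoint_def inner_add_left inner_add_right power2_norm_eq_inner)

lemma positive_op_Cauchy_Schwarz: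
  assumes "positive_op A"
  shows "(inner (blinfun_apply A f) g)\<^sup>2 \<le> inner (blinfun_apply A f) f * inner (blinfun_apply A g) g"
proof -
  define a b c where "a = inner (blinfun_apply A g) g" and "b = inner (blinfun_apply A f) g"
    and "c = inner (blinfun_apply A f) f"
  have sym: "inner (blinfun_apply A g) f = b"
    using selfadjointD[OF positive_op_selfadjoint[OF assms], of f g] by (simp add: b_def inner_commute)
  have ac: "a \<ge> 0" "c \<ge> 0" using positive_op_nonneg[OF assms] by (auto simp: a_def c_def)
  have q: "0 \<le> c + 2 * t * b + t\<^sup>2 * a" for t
  proof -
    have "0 \<le> inner (blinfun_apply A (f + t *\<^sub>R g)) (f + t *\<^sub>R g)"
      by (rule positive_op_nonneg[OF assms])
    also have "\<dots> = c + 2 * t * b + t\<^sup>2 * a"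
      by (simp add: blinfun.add_right blinfun.scaleR_right inner_add_left inner_add_right sym
          a_def[symmetric] b_def[symmetric] c_def[symmetric] power2_eq_square algebra_simps)
    finally show ?thesis .
  qed
  have "b\<^sup>2 \<le> c * a"
  proof (cases "a = 0")
    case True
    have "b = 0"
    proof (rule ccontr)
      assume "b \<noteq> 0"
      \<comment> \<open>This \<open>t\<close> gives the expression, now linear in \<open>t\<close>,
        the value -1.\<close>
      then show False using q[of "- (c + 1) / (2 * b)"] True by (simp add: field_simps)
    qed
    then show ?thesis using True by simp
  next
    case False
    then have "a > 0" using ac by simp
    then show ?thesis using q[of "- b / a"]
      by (simp add: power2_eq_square field_simps)
  qed
  then show ?thesis by (simp add: a_def b_def c_def)
qed

text \<open>Cauchy-Schwarz for the form of \<open>A\<close>, applied to \<open>f\<close> and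
  \<open>A f\<close>, bounds the operator norm by the quadratic form without a spectral
  theorem.\<close>

lemma positive_op_norm_le:
  assumes A: "positive_op A" and r: "0 \<le> r"
    and bound: "\<And>f. inner (blinfun_apply A f) f \<le> r * (norm f)\<^sup>2"
  shows "norm A \<le> r"
proof (rule norm_blinfun_bound[OF r])
  fix f
  let ?y = "blinfun_apply A f"
  have "(inner ?y ?y)\<^sup>2 \<le> inner ?y f * inner (blinfun_apply A ?y) ?y"
    by (rule positive_op_Cauchy_Schwarz[OF A])
  also have "\<dots> \<le> (r * (norm f)\<^sup>2) * (r * (norm ?y)\<^sup>2)"
    using r by (intro mult_mono bound) (auto intro: positive_op_nonneg[OF A])
  finally have "(norm ?y)\<^sup>2 * (norm ?y)\<^sup>2 \<le> (r * norm f)\<^sup>2 * (norm ?y)\<^sup>2"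
    by (simp add: power2_norm_eq_inner[symmetric] power2_eq_square algebra_simps)
  then have "(norm ?y)\<^sup>2 \<le> (r * norm f)\<^sup>2"
    by (cases "?y = 0") (simp, rule mult_right_le_imp_le, assumption, simp)
  then show "norm ?y \<le> r * norm f"
    by (rule power2_le_imp_le) (use r in auto)
qed

text \<open>Dividing by a number above the norm places the form of \<open>1 - A/c\<close> between 0
  and \<open>1 - \<mu>/c\<close>, so the norm bound for positive operators applies.\<close>

lemma coercive_contraction:
  assumes A: "coercive A \<mu>"
  obtains c r where "c > 0" "0 \<le> r" "r < 1" "norm (id_blinfun - (1 / c) *\<^sub>R A) \<le> r"
    "selfadjoint (id_blinfun - (1 / c) *\<^sub>R A)"
proof -
  define c where "c = norm A + 1"
  define T where "T = id_blinfun - (1 / c) *\<^sub>R A"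
  have c: "c > 0" by (simp add: c_def add_nonneg_pos)
  have T: "selfadjoint T"
    unfolding T_def by (intro selfadjoint_diff selfadjoint_id selfadjoint_scaleR coercive_selfadjoint[OF A])
  have form: "inner (blinfun_apply T f) f = (norm f)\<^sup>2 - inner (blinfun_apply A f) f / c" for f
    by (simp add: T_def blinfun.diff_left blinfun.scaleR_left inner_diff_left power2_norm_eq_inner)
  \<comment> \<open>On the zero space \<mu> may exceed \<open>c\<close>; the maximum keeps
    \<open>r\<close> nonnegative there.\<close>
  define r where "r = max 0 (1 - \<mu> / c)"
  have "inner (blinfun_apply A f) f \<le> c * (norm f)\<^sup>2" for f
  proof -
    have "inner (blinfun_apply A f) f \<le> norm (blinfun_apply A f) * norm f"
      by (rule norm_cauchy_schwarz)
    also have "\<dots> \<le> (norm A * norm f) * norm f"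
      by (intro mult_right_mono norm_blinfun) auto
    also have "\<dots> \<le> c * (norm f)\<^sup>2"
      by (auto simp: c_def power2_eq_square algebra_simps)
    finally show ?thesis .
  qed
  then have "positive_op T"
    using c by (intro positive_opI[OF T]) (simp add: form field_simps)
  moreover have "inner (blinfun_apply T f) f \<le> r * (norm f)\<^sup>2" for f
  proof -
    have "inner (blinfun_apply T f) f \<le> (1 - \<mu> / c) * (norm f)\<^sup>2"
      using coerciveD[OF A, of f] c by (simp add: form field_simps)
    also have "\<dots> \<le> r * (norm f)\<^sup>2"
      by (intro mult_right_mono) (auto simp: r_def)
    finally show ?thesis .
  qed
  ultimately have "norm T \<le> r" by (intro positive_op_norm_le) (auto simp: r_def)
  moreover have "0 \<le> r" "r < 1" using c coercive_pos[OF A] by (auto simp: r_def)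
  ultimately show ?thesis using that c T unfolding T_def by blast
qed

text \<open>Solving \<open>A x = y\<close> is the fixed point problem \<open>y/c + T x = x\<close>
  for a contraction \<open>T\<close>; coercivity bounds \<open>x\<close> by
  \<open>norm y / \<mu>\<close>, which gives injectivity and boundedness of the inverse.\<close>

lemma coercive_inverse_exists:
  fixes A :: "'h::{real_inner,banach} \<Rightarrow>\<^sub>L 'h"
  assumes A: "coercive A \<mu>"
  shows "\<exists>!B. A o\<^sub>L B = id_blinfun \<and> B o\<^sub>L A = id_blinfun"
proof -
  obtain c r where c: "c > 0" and r: "0 \<le> r" "r < 1"
    and T: "norm (id_blinfun - (1 / c) *\<^sub>R A) \<le> r"
    using coercive_contraction[OF A] by metis
  define T where "T = id_blinfun - (1 / c) *\<^sub>R A"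
  have "\<exists>x. blinfun_apply A x = y" for y
  proof -
    have "\<exists>!x. (1 / c) *\<^sub>R y + blinfun_apply T x = x"
    proof (rule banach_fix_type[OF r], intro allI)
      fix x x'
      have "dist ((1 / c) *\<^sub>R y + blinfun_apply T x) ((1 / c) *\<^sub>R y + blinfun_apply T x')
          = norm (blinfun_apply T (x - x'))"
        by (simp add: dist_norm blinfun.diff_right)
      also have "\<dots> \<le> norm T * norm (x - x')" by (rule norm_blinfun)
      also have "\<dots> \<le> r * dist x x'"
        unfolding dist_norm T_def by (intro mult_right_mono T) auto
      finally show "dist ((1 / c) *\<^sub>R y + blinfun_apply T x) ((1 / c) *\<^sub>R y + blinfun_apply T x')
          \<le> r * dist x x'" .
    qed
    then obtain x where "(1 / c) *\<^sub>R y + blinfun_apply T x = x" by blast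
    then have "(1 / c) *\<^sub>R y = (1 / c) *\<^sub>R blinfun_apply A x"
      by (simp add: T_def blinfun.diff_left blinfun.scaleR_left)
    then show ?thesis using c by (intro exI[of _ x]) simp
  qed
  then obtain b where b: "\<And>y. blinfun_apply A (b y) = y" by metis
  have bound: "\<mu> * norm x \<le> norm (blinfun_apply A x)" for x
  proof -
    have "\<mu> * norm x * norm x \<le> norm (blinfun_apply A x) * norm x"
      using coerciveD[OF A, of x] norm_cauchy_schwarz[of "blinfun_apply A x" x]
      by (simp add: power2_eq_square mult.assoc)
    then show ?thesis by (cases "x = 0") (simp_all add: mult_le_cancel_right)
  qed
  have inj: "x = y" if "blinfun_apply A x = blinfun_apply A y" for x y
    using bound[of "x - y"] that coercive_pos[OF A] by (simp add: blinfun.diff_right mult_le_0_iff)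
  have "bounded_linear b"
  proof (rule bounded_linear_intro)
    show "b (x + y) = b x + b y" for x y by (rule inj) (simp add: b blinfun.add_right)
    show "b (k *\<^sub>R x) = k *\<^sub>R b x" for k x by (rule inj) (simp add: b blinfun.scaleR_right)
    show "norm (b x) \<le> norm x * (1 / \<mu>)" for x
      using bound[of "b x"] coercive_pos[OF A] by (simp add: b field_simps)
  qed
  then have ap: "blinfun_apply (Blinfun b) = b" by (rule bounded_linear_Blinfun_apply)
  have "A o\<^sub>L Blinfun b = id_blinfun" "Blinfun b o\<^sub>L A = id_blinfun"
    by (rule blinfun_eqI, simp add: ap b, rule blinfun_eqI, simp add: ap, rule inj, simp add: b)
  moreover have "B = Blinfun b" if "A o\<^sub>L B = id_blinfun \<and> B o\<^sub>L A = id_blinfun" for B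
    by (metis that blinfun_compose_assoc blinfun_compose_id calculation)
  ultimately show ?thesis by blast
qed

lemma inverse_op_coercive:
  assumes "coercive A \<mu>"
  shows "A o\<^sub>L inverse_op A = id_blinfun" "inverse_op A o\<^sub>L A = id_blinfun"
  using theI'[OF coercive_inverse_exists[OF assms]] unfolding inverse_op_def by auto

lemma inverse_op_apply:
  assumes "coercive A \<mu>"
  shows "blinfun_apply A (blinfun_apply (inverse_op A) x) = x"
    "blinfun_apply (inverse_op A) (blinfun_apply A x) = x"
  using inverse_op_coercive[OF assms] by (metis blinfun_apply_blinfun_compose blinfun_apply_id_blinfun id_apply)+

lemma inverse_op_eqI:
  assumes "coercive A \<mu>" "A o\<^sub>L B = id_blinfun"
  shows "inverse_op A = B"
  by (metis assms blinfun_compose_assoc blinfun_compose_id inverse_op_coercive(2))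

lemma inverse_op_selfadjoint:
  assumes A: "coercive A \<mu>"
  shows "selfadjoint (inverse_op A)"
  unfolding selfadjoint_def
  by (metis A coercive_selfadjoint inverse_op_apply(1) selfadjointD)

lemma inverse_op_norm_le:
  assumes A: "coercive A \<mu>"
  shows "norm (inverse_op A) \<le> 1 / \<mu>"
proof (rule norm_blinfun_bound)
  show "0 \<le> 1 / \<mu>" using coercive_pos[OF A] by simp
  fix y
  define x where "x = blinfun_apply (inverse_op A) y"
  have y: "blinfun_apply A x = y" by (simp add: x_def inverse_op_apply[OF A])
  have "\<mu> * norm x * norm x \<le> norm y * norm x"
    using coerciveD[OF A, of x] norm_cauchy_schwarz[of "blinfun_apply A x" x]
    by (simp add: power2_eq_square mult.assoc y)
  then have "\<mu> * norm x \<le> norm y" by (cases "x = 0") (simp_all add: mult_le_cancel_right)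
  then show "norm (blinfun_apply (inverse_op A) y) \<le> 1 / \<mu> * norm y"
    using coercive_pos[OF A] by (simp add: x_def field_simps)
qed

lemma inverse_op_commute:
  assumes A: "coercive A \<mu>" and C: "C o\<^sub>L A = A o\<^sub>L C"
  shows "C o\<^sub>L inverse_op A = inverse_op A o\<^sub>L C"
proof -
  have "inverse_op A o\<^sub>L C = inverse_op A o\<^sub>L (C o\<^sub>L A) o\<^sub>L inverse_op A"
    by (metis A blinfun_compose_assoc blinfun_compose_id(2) inverse_op_coercive(1))
  also have "\<dots> = C o\<^sub>L inverse_op A"
    by (metis A C blinfun_compose_assoc blinfun_compose_id(1) inverse_op_coercive(2))
  finally show ?thesis by simp
qed

text \<open>Writing $A = c(1 - T)$ with $\|T\| < 1$, the root is $\sqrt c\,(1 - B)$ with $B$ the fixed point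
  of $B \mapsto (T + B^2)/2$. Running the iteration inside the bicommutant of $T$ gives
  uniqueness of the root.\<close>

lemma coercive_sqrt_exists:
  fixes A :: "'h::{real_inner,banach} \<Rightarrow>\<^sub>L 'h"
  assumes A: "coercive A \<mu>"
  obtains S \<nu> where "coercive S \<nu>" "S o\<^sub>L S = A" "\<And>C. C o\<^sub>L A = A o\<^sub>L C \<Longrightarrow> C o\<^sub>L S = S o\<^sub>L C"
proof -
  obtain c r where c: "c > 0" and r: "0 \<le> r" "r < 1"
    and T: "norm (id_blinfun - (1 / c) *\<^sub>R A) \<le> r" "selfadjoint (id_blinfun - (1 / c) *\<^sub>R A)"
    using coercive_contraction[OF A] by metis
  define T where "T = id_blinfun - (1 / c) *\<^sub>R A"
  have Tapp: "blinfun_apply T x = x - (1 / c) *\<^sub>R blinfun_apply A x" for x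
    by (simp add: T_def blinfun.diff_left blinfun.scaleR_left)
  define X where "X = {B. norm B \<le> r \<and> selfadjoint B \<and> (\<forall>C. C o\<^sub>L T = T o\<^sub>L C \<longrightarrow> C o\<^sub>L B = B o\<^sub>L C)}"
  have XD: "norm B \<le> r" "selfadjoint B" "C o\<^sub>L T = T o\<^sub>L C \<Longrightarrow> C o\<^sub>L B = B o\<^sub>L C" if "B \<in> X" for B C
    using that unfolding X_def by blast+
  define \<Phi> where "\<Phi> B = (1 / 2) *\<^sub>R (T + (B o\<^sub>L B))" for B :: "'h \<Rightarrow>\<^sub>L 'h"
  have "closed X"
  proof -
    have X: "X = {B. norm B \<le> r} \<inter> (\<Inter>f. \<Inter>g. {B. inner (blinfun_apply B f) g = inner f (blinfun_apply B g)}) \<inter>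
        (\<Inter>C\<in>{C. C o\<^sub>L T = T o\<^sub>L C}. {B. C o\<^sub>L B = B o\<^sub>L C})"
      by (auto simp: X_def selfadjoint_def)
    show ?thesis
      unfolding X
      by (intro closed_Int closed_INT ballI closed_Collect_eq closed_Collect_le continuous_intros
          bounded_linear.continuous_on[OF bounded_bilinear.bounded_linear_left[OF bounded_bilinear_blinfun_compose]]
          bounded_linear.continuous_on[OF bounded_bilinear.bounded_linear_right[OF bounded_bilinear_blinfun_compose]])
  qed
  note complete_eq_closed[THEN iffD2, OF this]
  moreover have "X \<noteq> {}"
  proof -
    have "T \<in> X" using T[folded T_def] unfolding X_def by blast
    then show ?thesis by blast
  qed
  moreover have "\<Phi> ` X \<subseteq> X"
  proof safe
    fix B assume B: "B \<in> X"
    have "norm (\<Phi> B) \<le> (norm T + norm (B o\<^sub>L B)) / 2"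
      by (simp add: \<Phi>_def norm_triangle_ineq)
    also have "\<dots> \<le> (r + r * r) / 2"
    proof -
      have "norm B \<le> r" by (rule XD(1)[OF B])
      then have "norm B * norm B \<le> r * r" using r by (intro mult_mono) auto
      then have "norm (B o\<^sub>L B) \<le> r * r" using norm_blinfun_compose[of B B] by linarith
      moreover have "norm T \<le> r" using T(1) by (simp add: T_def)
      ultimately show ?thesis by (intro divide_right_mono add_mono) auto
    qed
    also have "\<dots> \<le> r" using mult_left_le[of r r] r by simp
    finally have "norm (\<Phi> B) \<le> r" .
    moreover have "selfadjoint (\<Phi> B)"
      unfolding \<Phi>_def using XD(2)[OF B] T(2)[folded T_def]
      by (intro selfadjoint_add selfadjoint_scaleR selfadjoint_square)
    moreover have "C o\<^sub>L \<Phi> B = \<Phi> B o\<^sub>L C" if C: "C o\<^sub>L T = T o\<^sub>L C" for C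
    proof -
      have CB: "C o\<^sub>L B = B o\<^sub>L C" by (rule XD(3)[OF B C])
      have 1: "blinfun_apply C (blinfun_apply T x) = blinfun_apply T (blinfun_apply C x)" for x
        using C by (metis blinfun_apply_blinfun_compose)
      have 2: "blinfun_apply C (blinfun_apply B x) = blinfun_apply B (blinfun_apply C x)" for x
        using CB by (metis blinfun_apply_blinfun_compose)
      show ?thesis
        by (rule blinfun_eqI)
          (simp add: \<Phi>_def blinfun.add_left blinfun.scaleR_left blinfun.add_right blinfun.scaleR_right 1 2)
    qed
    ultimately show "\<Phi> B \<in> X" unfolding X_def by blast
  qed
  moreover have "dist (\<Phi> B) (\<Phi> C) \<le> r * dist B C" if BC: "B \<in> X" "C \<in> X" for B C
  proof -
    \<comment> \<open>This splitting of \<open>B^2 - C^2\<close> needs no commutativity; the two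
      factors of norm at most \<open>r\<close> and the half give the contraction constant
      \<open>r\<close>.\<close>
    have "\<Phi> B - \<Phi> C = (1 / 2) *\<^sub>R ((B o\<^sub>L (B - C)) + ((B - C) o\<^sub>L C))"
      by (rule blinfun_eqI)
        (simp add: \<Phi>_def blinfun.add_left blinfun.diff_left blinfun.scaleR_left blinfun.diff_right algebra_simps)
    then have "dist (\<Phi> B) (\<Phi> C) = norm ((B o\<^sub>L (B - C)) + ((B - C) o\<^sub>L C)) / 2"
      by (simp add: dist_norm)
    also have "\<dots> \<le> (norm (B o\<^sub>L (B - C)) + norm ((B - C) o\<^sub>L C)) / 2"
      by (simp add: norm_triangle_ineq)
    also have "\<dots> \<le> (norm B * norm (B - C) + norm (B - C) * norm C) / 2"
      using norm_blinfun_compose[of B "B - C"] norm_blinfun_compose[of "B - C" C] by simp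
    also have "\<dots> \<le> (r * norm (B - C) + norm (B - C) * r) / 2"
      by (intro divide_right_mono add_mono mult_right_mono mult_left_mono XD BC) auto
    also have "\<dots> = r * dist B C" by (simp add: dist_norm)
    finally show ?thesis .
  qed
  ultimately have "\<exists>!B. B \<in> X \<and> \<Phi> B = B"
    using Banach_fix[of X r \<Phi>] r by auto
  then obtain B where B: "B \<in> X" "\<Phi> B = B" by blast
  have fix_eq: "2 *\<^sub>R blinfun_apply B x = blinfun_apply T x + blinfun_apply B (blinfun_apply B x)" for x
    using arg_cong[OF B(2), of "\<lambda>D. 2 *\<^sub>R blinfun_apply D x"]
    by (simp add: \<Phi>_def blinfun.add_left blinfun.scaleR_left)
  define S where "S = sqrt c *\<^sub>R (id_blinfun - B)"
  have Sapp: "blinfun_apply S x = sqrt c *\<^sub>R (x - blinfun_apply B x)" for x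
    by (simp add: S_def blinfun.diff_left blinfun.scaleR_left)
  have "S o\<^sub>L S = A"
  proof (rule blinfun_eqI)
    fix x
    have "blinfun_apply (S o\<^sub>L S) x = c *\<^sub>R (x - 2 *\<^sub>R blinfun_apply B x + blinfun_apply B (blinfun_apply B x))"
      using c by (simp add: Sapp blinfun.diff_right blinfun.scaleR_right scaleR_2 algebra_simps)
    also have "\<dots> = c *\<^sub>R (x - blinfun_apply T x)" by (simp add: fix_eq)
    also have "\<dots> = blinfun_apply A x" using c by (simp add: Tapp)
    finally show "blinfun_apply (S o\<^sub>L S) x = blinfun_apply A x" .
  qed
  moreover have "coercive S (sqrt c * (1 - r))"
    unfolding coercive_def
  proof (intro conjI allI)
    show "selfadjoint S"
      unfolding S_def by (intro selfadjoint_scaleR selfadjoint_diff selfadjoint_id XD(2)[OF B(1)])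
    show "0 < sqrt c * (1 - r)" using c r by simp
    fix f
    have "inner (blinfun_apply B f) f \<le> norm (blinfun_apply B f) * norm f"
      by (rule norm_cauchy_schwarz)
    also have "\<dots> \<le> (norm B * norm f) * norm f"
      by (intro mult_right_mono norm_blinfun) auto
    also have "\<dots> \<le> r * (norm f)\<^sup>2"
      using XD(1)[OF B(1)] by (auto simp: power2_eq_square mult.assoc intro: mult_right_mono)
    finally have "(1 - r) * (norm f)\<^sup>2 \<le> inner f f - inner (blinfun_apply B f) f"
      by (simp add: algebra_simps power2_norm_eq_inner)
    then show "sqrt c * (1 - r) * (norm f)\<^sup>2 \<le> inner (blinfun_apply S f) f"
      using c by (simp add: Sapp inner_diff_left mult.assoc)
  qed
  moreover have "C o\<^sub>L S = S o\<^sub>L C" if C: "C o\<^sub>L A = A o\<^sub>L C" for C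
  proof -
    have CA: "blinfun_apply C (blinfun_apply A x) = blinfun_apply A (blinfun_apply C x)" for x
      using C by (metis blinfun_apply_blinfun_compose)
    have "C o\<^sub>L T = T o\<^sub>L C"
      by (rule blinfun_eqI) (simp add: Tapp blinfun.diff_right blinfun.scaleR_right CA)
    then have CB: "C o\<^sub>L B = B o\<^sub>L C" by (rule XD(3)[OF B(1)])
    have CB': "blinfun_apply C (blinfun_apply B x) = blinfun_apply B (blinfun_apply C x)" for x
      using CB by (metis blinfun_apply_blinfun_compose)
    show ?thesis
      by (rule blinfun_eqI) (simp add: Sapp blinfun.diff_right blinfun.scaleR_right CB')
  qed
  ultimately show ?thesis using that by blast
qed

text \<open>Uniqueness gives the definite description in \<open>sqrt_op\<close> its value. A second
  root \<open>C\<close> commutes with \<open>A = C^2\<close>, hence with \<open>S\<close>, so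
  \<open>(S + C)(S - C) = 0\<close>; as \<open>C\<close> is positive and \<open>S\<close> coercive,
  \<open>S + C\<close> is injective.\<close>

lemma sqrt_op_coercive:
  fixes A :: "'h::{real_inner,banach} \<Rightarrow>\<^sub>L 'h"
  assumes A: "coercive A \<mu>"
  obtains \<nu> where "coercive (sqrt_op A) \<nu>" "sqrt_op A o\<^sub>L sqrt_op A = A"
    "\<And>C. C o\<^sub>L A = A o\<^sub>L C \<Longrightarrow> C o\<^sub>L sqrt_op A = sqrt_op A o\<^sub>L C"
proof -
  obtain S \<nu> where S: "coercive S \<nu>" "S o\<^sub>L S = A" "\<And>C. C o\<^sub>L A = A o\<^sub>L C \<Longrightarrow> C o\<^sub>L S = S o\<^sub>L C"
    using coercive_sqrt_exists[OF A] by metis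
  have "sqrt_op A = S"
    unfolding sqrt_op_def
  proof (rule the_equality)
    show "positive_op S \<and> S o\<^sub>L S = A" by (intro conjI S(2) coercive_positive[OF S(1)])
    fix C assume C: "positive_op C \<and> C o\<^sub>L C = A"
    then have CS: "C o\<^sub>L S = S o\<^sub>L C" using S(3) by (metis blinfun_compose_assoc)
    show "C = S"
    proof (rule blinfun_eqI)
      fix x
      define y where "y = blinfun_apply S x - blinfun_apply C x"
      have 1: "blinfun_apply S (blinfun_apply S x) = blinfun_apply C (blinfun_apply C x)"
        using S(2) C by (metis blinfun_apply_blinfun_compose)
      have 2: "blinfun_apply C (blinfun_apply S x) = blinfun_apply S (blinfun_apply C x)"
        using CS by (metis blinfun_apply_blinfun_compose)
      have "blinfun_apply S y + blinfun_apply C y = 0"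
        by (simp add: y_def blinfun.diff_right 1 2)
      then have "inner (blinfun_apply S y) y + inner (blinfun_apply C y) y = 0"
        by (metis inner_add_left inner_zero_left)
      moreover have "0 \<le> inner (blinfun_apply C y) y" using C positive_op_nonneg by blast
      ultimately have "\<nu> * (norm y)\<^sup>2 \<le> 0" using coerciveD[OF S(1), of y] by linarith
      then have "y = 0" using coercive_pos[OF S(1)] by (simp add: mult_le_0_iff)
      then show "blinfun_apply C x = blinfun_apply S x" by (simp add: y_def)
    qed
  qed
  then show ?thesis using that S by metis
qed

section \<open>Calculus of the inverse square root of a regularised operator\<close>

context
  fixes A :: "'h::{real_inner,banach} \<Rightarrow>\<^sub>L 'h" and l :: real
  assumes A: "positive_op A" and l: "0 < l"
begin

lemma sqrt_reg_coercive: "\<exists>\<nu>. coercive (sqrt_op (regularize A l)) \<nu>"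
  using sqrt_op_coercive[OF regularize_coercive[OF A l]] by metis

lemma sqrt_reg_square: "sqrt_op (regularize A l) o\<^sub>L sqrt_op (regularize A l) = regularize A l"
  using sqrt_op_coercive[OF regularize_coercive[OF A l]] by metis

lemma sqrt_reg_selfadjoint: "selfadjoint (sqrt_op (regularize A l))"
  using sqrt_reg_coercive coercive_selfadjoint by blast

lemma inv_sqrt_reg_selfadjoint: "selfadjoint (inv_sqrt_reg A l)"
  using sqrt_reg_coercive inverse_op_selfadjoint unfolding inv_sqrt_reg_def by blast

lemma inv_sqrt_reg_apply:
  "blinfun_apply (sqrt_op (regularize A l)) (blinfun_apply (inv_sqrt_reg A l) x) = x"
  "blinfun_apply (inv_sqrt_reg A l) (blinfun_apply (sqrt_op (regularize A l)) x) = x"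
  using sqrt_reg_coercive inverse_op_apply unfolding inv_sqrt_reg_def by blast+

lemma sqrt_reg_apply2:
  "blinfun_apply (sqrt_op (regularize A l)) (blinfun_apply (sqrt_op (regularize A l)) x) =
    blinfun_apply A x + l *\<^sub>R x"
  by (metis blinfun_apply_blinfun_compose regularize_apply sqrt_reg_square)

lemma inv_sqrt_reg_square: "inv_sqrt_reg A l o\<^sub>L inv_sqrt_reg A l = inverse_op (regularize A l)"
proof (rule inverse_op_eqI[OF regularize_coercive[OF A l], symmetric], rule blinfun_eqI)
  fix x
  have "blinfun_apply (regularize A l) y = blinfun_apply (sqrt_op (regularize A l)) (blinfun_apply (sqrt_op (regularize A l)) y)" for y
    by (simp add: sqrt_reg_apply2)
  then show "blinfun_apply (regularize A l o\<^sub>L (inv_sqrt_reg A l o\<^sub>L inv_sqrt_reg A l)) x = blinfun_apply id_blinfun x"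
    unfolding blinfun_apply_blinfun_compose blinfun_apply_id_blinfun id_apply
    using inv_sqrt_reg_apply(1) by metis
qed

text \<open>\<open>A\<close> commutes with its regularisation, hence with the root and with the
  inverse of the root, which can therefore be moved past \<open>A\<close>.\<close>

lemma inv_sqrt_reg_conj:
  "inv_sqrt_reg A l o\<^sub>L A o\<^sub>L inv_sqrt_reg A l = A o\<^sub>L inverse_op (regularize A l)"
proof -
  have "A o\<^sub>L regularize A l = regularize A l o\<^sub>L A"
    by (rule blinfun_eqI) (simp add: blinfun.add_right blinfun.scaleR_right)
  then have "A o\<^sub>L sqrt_op (regularize A l) = sqrt_op (regularize A l) o\<^sub>L A"
    using sqrt_op_coercive[OF regularize_coercive[OF A l]] by metis
  then have "A o\<^sub>L inv_sqrt_reg A l = inv_sqrt_reg A l o\<^sub>L A"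
    using sqrt_reg_coercive inverse_op_commute unfolding inv_sqrt_reg_def by blast
  then show ?thesis
    by (metis blinfun_compose_assoc inv_sqrt_reg_square)
qed

lemma norm_inv_sqrt_reg_le: "(norm (blinfun_apply (inv_sqrt_reg A l) x))\<^sup>2 \<le> (norm x)\<^sup>2 / l"
proof -
  define y where "y = blinfun_apply (inv_sqrt_reg A l) x"
  have "l * (norm y)\<^sup>2 \<le> inner (blinfun_apply (regularize A l) y) y"
    by (rule coerciveD[OF regularize_coercive[OF A l]])
  also have "blinfun_apply (regularize A l) y = blinfun_apply (sqrt_op (regularize A l)) x"
    by (simp only: regularize_apply sqrt_reg_apply2[symmetric] y_def inv_sqrt_reg_apply)
  also have "inner (blinfun_apply (sqrt_op (regularize A l)) x) y = (norm x)\<^sup>2"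
    by (simp add: selfadjointD[OF sqrt_reg_selfadjoint] y_def inv_sqrt_reg_apply power2_norm_eq_inner)
  finally show ?thesis using l by (simp add: y_def field_simps)
qed

text \<open>Since \<open>S^2 - b^2 = (S + b)(S - b)\<close> and \<open>S + b\<close> is positive
  definite, an eigenvector of \<open>S^2\<close> for \<open>b^2\<close> is one of \<open>S\<close>
  for \<open>b\<close>.\<close>

lemma inv_sqrt_reg_eigenvector:
  assumes e: "blinfun_apply A e = a *\<^sub>R e" and a: "0 \<le> a"
  shows "blinfun_apply (inv_sqrt_reg A l) e = (1 / sqrt (a + l)) *\<^sub>R e"
proof -
  let ?S = "sqrt_op (regularize A l)"
  define b where "b = sqrt (a + l)"
  have b: "b > 0" "b * b = a + l" using a l by (auto simp: b_def)
  define y where "y = blinfun_apply ?S e - b *\<^sub>R e"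
  have "blinfun_apply ?S y + b *\<^sub>R y = (a *\<^sub>R e + l *\<^sub>R e) - (b * b) *\<^sub>R e"
    by (simp add: y_def blinfun.diff_right blinfun.scaleR_right sqrt_reg_apply2 e scaleR_diff_right)
  also have "\<dots> = 0" by (simp add: b scaleR_add_left)
  finally have "inner (blinfun_apply ?S y) y + b * (norm y)\<^sup>2 = 0"
    by (metis inner_add_left inner_scaleR_left inner_zero_left power2_norm_eq_inner)
  moreover have "0 \<le> inner (blinfun_apply ?S y) y"
    using sqrt_reg_coercive coercive_positive positive_op_nonneg by blast
  ultimately have "b * (norm y)\<^sup>2 \<le> 0" by linarith
  then have "y = 0" using b by (simp add: mult_le_0_iff)
  then have "blinfun_apply (inv_sqrt_reg A l) (b *\<^sub>R e) = e"
    using inv_sqrt_reg_apply(2)[of e] by (simp add: y_def)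
  then have "b *\<^sub>R blinfun_apply (inv_sqrt_reg A l) e = e" by (simp add: blinfun.scaleR_right)
  then have "(1 / b) *\<^sub>R (b *\<^sub>R blinfun_apply (inv_sqrt_reg A l) e) = (1 / b) *\<^sub>R e" by simp
  then show ?thesis using b by (simp add: b_def)
qed

end

text \<open>The squared norm of an operator is the norm of its product with its adjoint, here for
  \<open>W S\<close> with adjoint \<open>S W\<close>. The right-hand side is free of roots of the
  regularisation of \<open>A\<close>.\<close>

lemma norm_inv_sqrt_reg_compose:
  fixes A :: "'h::{real_inner,banach} \<Rightarrow>\<^sub>L 'h"
  assumes A: "positive_op A" and l: "0 < l" and S: "selfadjoint S"
  shows "(norm (inv_sqrt_reg A l o\<^sub>L S))\<^sup>2 = norm (S o\<^sub>L inverse_op (regularize A l) o\<^sub>L S)"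
proof -
  let ?W = "inv_sqrt_reg A l"
  let ?M = "S o\<^sub>L inverse_op (regularize A l) o\<^sub>L S"
  have M: "?M = (S o\<^sub>L ?W) o\<^sub>L (?W o\<^sub>L S)"
    by (simp add: inv_sqrt_reg_square[OF A l, symmetric] blinfun_compose_assoc)
  note adj = selfadjointD[OF S] selfadjointD[OF inv_sqrt_reg_selfadjoint[OF A l]]
  have le: "norm (?W o\<^sub>L S) \<le> sqrt (norm ?M)"
  proof (rule norm_blinfun_bound)
    fix x
    have "(norm (blinfun_apply (?W o\<^sub>L S) x))\<^sup>2 = inner (blinfun_apply ?M x) x"
      by (simp add: M power2_norm_eq_inner adj)
    also have "\<dots> \<le> norm (blinfun_apply ?M x) * norm x" by (rule norm_cauchy_schwarz)
    also have "\<dots> \<le> (norm ?M * norm x) * norm x" by (intro mult_right_mono norm_blinfun) auto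
    also have "\<dots> = (sqrt (norm ?M) * norm x)\<^sup>2" by (simp add: power2_eq_square mult_ac)
    finally show "norm (blinfun_apply (?W o\<^sub>L S) x) \<le> sqrt (norm ?M) * norm x"
      by (rule power2_le_imp_le) auto
  qed auto
  have "norm (S o\<^sub>L ?W) \<le> norm (?W o\<^sub>L S)"
  proof (rule norm_blinfun_bound)
    fix x
    let ?y = "blinfun_apply (S o\<^sub>L ?W) x"
    have "norm ?y * norm ?y = inner (blinfun_apply (?W o\<^sub>L S) ?y) x"
      by (simp add: adj flip: power2_eq_square power2_norm_eq_inner)
    also have "\<dots> \<le> norm (blinfun_apply (?W o\<^sub>L S) ?y) * norm x" by (rule norm_cauchy_schwarz)
    also have "\<dots> \<le> (norm (?W o\<^sub>L S) * norm ?y) * norm x" by (intro mult_right_mono norm_blinfun) auto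
    finally have "norm ?y * norm ?y \<le> (norm (?W o\<^sub>L S) * norm x) * norm ?y" by (simp add: mult_ac)
    then show "norm ?y \<le> norm (?W o\<^sub>L S) * norm x"
      by (cases "?y = 0") (simp_all add: mult_le_cancel_right)
  qed auto
  then have "norm ?M \<le> (norm (?W o\<^sub>L S))\<^sup>2"
    using norm_blinfun_compose[of "S o\<^sub>L ?W" "?W o\<^sub>L S"]
      mult_right_mono[of "norm (S o\<^sub>L ?W)" "norm (?W o\<^sub>L S)" "norm (?W o\<^sub>L S)"]
    by (simp add: M power2_eq_square)
  moreover have "(norm (?W o\<^sub>L S))\<^sup>2 \<le> norm ?M"
    using power_mono[OF le, of 2] by simp
  ultimately show ?thesis by simp
qed

text \<open>Resolvent identity, with each of the two inverses bounded by \<open>1/l\<close>.\<close>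

lemma inverse_op_regularize_lipschitz:
  fixes A B :: "'h::{real_inner,banach} \<Rightarrow>\<^sub>L 'h"
  assumes A: "positive_op A" and B: "positive_op B" and l: "0 < l"
  shows "dist (inverse_op (regularize A l)) (inverse_op (regularize B l)) \<le> (1 / l\<^sup>2) * dist A B"
proof -
  note cA = regularize_coercive[OF A l] and cB = regularize_coercive[OF B l]
  let ?A = "inverse_op (regularize A l)" and ?B = "inverse_op (regularize B l)"
  have eq: "?A - ?B = ?A o\<^sub>L (B - A) o\<^sub>L ?B"
  proof (rule blinfun_eqI)
    fix x
    let ?y = "blinfun_apply ?B x"
    have "blinfun_apply (?A o\<^sub>L (B - A) o\<^sub>L ?B) x =
        blinfun_apply ?A (blinfun_apply (regularize B l) ?y) - blinfun_apply ?A (blinfun_apply (regularize A l) ?y)"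
      by (simp add: blinfun.diff_left blinfun.diff_right blinfun.add_right)
    also have "\<dots> = blinfun_apply ?A x - ?y"
      by (simp only: inverse_op_apply[OF cA] inverse_op_apply[OF cB])
    finally show "blinfun_apply (?A - ?B) x = blinfun_apply (?A o\<^sub>L (B - A) o\<^sub>L ?B) x"
      by (simp add: blinfun.diff_left)
  qed
  have "norm (?A - ?B) \<le> norm (?A o\<^sub>L (B - A)) * norm ?B"
    unfolding eq by (rule norm_blinfun_compose)
  also have "\<dots> \<le> (norm ?A * norm (B - A)) * norm ?B"
    by (intro mult_right_mono norm_blinfun_compose) auto
  also have "\<dots> \<le> ((1 / l) * norm (B - A)) * (1 / l)"
    using l by (intro mult_mono inverse_op_norm_le[OF cA] inverse_op_norm_le[OF cB]) auto
  also have "\<dots> = (1 / l\<^sup>2) * dist A B"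
    by (simp add: dist_norm norm_minus_commute power2_eq_square)
  finally show ?thesis by (simp add: dist_norm)
qed

section \<open>Hilbert-Schmidt norms\<close>

lemma has_sum_finite_sum:
  fixes f :: "'a \<Rightarrow> 'b \<Rightarrow> real"
  assumes "finite F" "\<And>i. i \<in> F \<Longrightarrow> (f i has_sum s i) A"
  shows "((\<lambda>x. \<Sum>i\<in>F. f i x) has_sum (\<Sum>i\<in>F. s i)) A"
  using assms by (induction F rule: finite_induct) (auto intro: has_sum_add)

text \<open>Hypotheses and conclusions of this kind speak of finite sums, so no summability has to
  be known beforehand; Parseval expands each \<open>norm (A e)\<close>.\<close>

lemma onb_sum_coordinates_le:
  fixes A :: "'h::{real_inner,banach} \<Rightarrow>\<^sub>L 'h"
  assumes F: "finite F"
    and le: "\<And>G. finite G \<Longrightarrow> G \<subseteq> onb \<Longrightarrow> (\<Sum>e'\<in>G. \<Sum>e\<in>F. (inner (blinfun_apply A e) e')\<^sup>2) \<le> c"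
  shows "(\<Sum>e\<in>F. (norm (blinfun_apply A e))\<^sup>2) \<le> c"
proof (rule has_sum_le_finite_sums)
  show "((\<lambda>e'. \<Sum>e\<in>F. (inner (blinfun_apply A e) e')\<^sup>2) has_sum (\<Sum>e\<in>F. (norm (blinfun_apply A e))\<^sup>2)) onb"
    by (rule has_sum_finite_sum[OF F parseval_onb])
qed (rule le)

text \<open>Invariance of the Hilbert-Schmidt norm under adjoints: the squared matrix entries are
  summed by columns instead of rows.\<close>

lemma onb_sum_adjoint_le:
  fixes A B :: "'h::{real_inner,banach} \<Rightarrow>\<^sub>L 'h"
  assumes adj: "\<And>f g. inner (blinfun_apply A f) g = inner f (blinfun_apply B g)"
    and le: "\<And>G. finite G \<Longrightarrow> G \<subseteq> onb \<Longrightarrow> (\<Sum>e\<in>G. (norm (blinfun_apply B e))\<^sup>2) \<le> c"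
    and F: "finite F" "F \<subseteq> onb"
  shows "(\<Sum>e\<in>F. (norm (blinfun_apply A e))\<^sup>2) \<le> c"
proof (rule onb_sum_coordinates_le[OF F(1)])
  fix G :: "'h set" assume G: "finite G" "G \<subseteq> onb"
  have "(\<Sum>e'\<in>G. \<Sum>e\<in>F. (inner (blinfun_apply A e) e')\<^sup>2) = (\<Sum>e'\<in>G. \<Sum>e\<in>F. (inner (blinfun_apply B e') e)\<^sup>2)"
    by (intro sum.cong refl) (metis adj inner_commute)
  also have "\<dots> \<le> (\<Sum>e'\<in>G. (norm (blinfun_apply B e'))\<^sup>2)"
    by (intro sum_mono bessel_finite F orthonormal_subset[OF orthonormal_onb])
  also have "\<dots> \<le> c" by (rule le[OF G])
  finally show "(\<Sum>e'\<in>G. \<Sum>e\<in>F. (inner (blinfun_apply A e) e')\<^sup>2) \<le> c" .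
qed

lemma onb_sum_square_le:
  fixes A :: "'h::{real_inner,banach} \<Rightarrow>\<^sub>L 'h"
  assumes le: "\<And>G. finite G \<Longrightarrow> G \<subseteq> onb \<Longrightarrow> (\<Sum>e\<in>G. \<Sum>e'\<in>G. (inner (blinfun_apply A e) e')\<^sup>2) \<le> c"
    and F: "finite F" "F \<subseteq> onb"
  shows "(\<Sum>e\<in>F. (norm (blinfun_apply A e))\<^sup>2) \<le> c"
proof (rule onb_sum_coordinates_le[OF F(1)])
  fix G :: "'h set" assume G: "finite G" "G \<subseteq> onb"
  have "(\<Sum>e'\<in>G. \<Sum>e\<in>F. (inner (blinfun_apply A e) e')\<^sup>2) = (\<Sum>e\<in>F. \<Sum>e'\<in>G. (inner (blinfun_apply A e) e')\<^sup>2)"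
    by (rule sum.swap)
  also have "\<dots> \<le> (\<Sum>e\<in>F. \<Sum>e'\<in>F \<union> G. (inner (blinfun_apply A e) e')\<^sup>2)"
    using F G by (intro sum_mono sum_mono2) auto
  also have "\<dots> \<le> (\<Sum>e\<in>F \<union> G. \<Sum>e'\<in>F \<union> G. (inner (blinfun_apply A e) e')\<^sup>2)"
    using F G by (intro sum_mono2) (auto intro: sum_nonneg)
  also have "\<dots> \<le> c" by (rule le) (use F G in auto)
  finally show "(\<Sum>e'\<in>G. \<Sum>e\<in>F. (inner (blinfun_apply A e) e')\<^sup>2) \<le> c" .
qed

lemma onb_summableI:
  assumes "\<And>F. finite F \<Longrightarrow> F \<subseteq> onb \<Longrightarrow> (\<Sum>e\<in>F. (norm (blinfun_apply A e))\<^sup>2) \<le> c"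
  shows "(\<lambda>e. (norm (blinfun_apply A e))\<^sup>2) summable_on onb"
  by (rule nonneg_bdd_above_summable_on) (auto intro!: bdd_aboveI[of _ c] assms)

lemma hs_norm_le:
  fixes A :: "'h::{real_inner,banach} \<Rightarrow>\<^sub>L 'h"
  assumes "\<And>F. finite F \<Longrightarrow> F \<subseteq> onb \<Longrightarrow> (\<Sum>e\<in>F. (norm (blinfun_apply A e))\<^sup>2) \<le> c\<^sup>2" "0 \<le> c"
  shows "hs_norm A \<le> c"
  unfolding hs_norm_def
  by (rule real_le_lsqrt) (use assms in \<open>auto intro!: infsum_le_finite_sums onb_summableI[of _ "c\<^sup>2"]\<close>)

text \<open>The uniform bound \<open>c\<close> secures summability; for a divergent sum the norm on
  the right would be 0 by default.\<close>

lemma sum_le_hs_norm: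
  fixes A :: "'h::{real_inner,banach} \<Rightarrow>\<^sub>L 'h"
  assumes "\<And>F. finite F \<Longrightarrow> F \<subseteq> onb \<Longrightarrow> (\<Sum>e\<in>F. (norm (blinfun_apply A e))\<^sup>2) \<le> c"
    and F: "finite F" "F \<subseteq> onb"
  shows "(\<Sum>e\<in>F. (norm (blinfun_apply A e))\<^sup>2) \<le> (hs_norm A)\<^sup>2"
proof -
  have "(\<Sum>e\<in>F. (norm (blinfun_apply A e))\<^sup>2) \<le> (\<Sum>\<^sub>\<infinity>e\<in>onb. (norm (blinfun_apply A e))\<^sup>2)"
    by (rule finite_sum_le_infsum[OF onb_summableI F]) (use assms in auto)
  then show ?thesis by (simp add: hs_norm_def infsum_nonneg)
qed

lemma hs_norm_le_iff:
  fixes A :: "'h::{real_inner,banach} \<Rightarrow>\<^sub>L 'h"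
  assumes "\<And>F. finite F \<Longrightarrow> F \<subseteq> onb \<Longrightarrow> (\<Sum>e\<in>F. (norm (blinfun_apply A e))\<^sup>2) \<le> d" "0 \<le> c"
  shows "hs_norm A \<le> c \<longleftrightarrow> (\<forall>F. finite F \<longrightarrow> F \<subseteq> onb \<longrightarrow> (\<Sum>e\<in>F. (norm (blinfun_apply A e))\<^sup>2) \<le> c\<^sup>2)"
proof
  assume "hs_norm A \<le> c"
  moreover have "0 \<le> hs_norm A" by (simp add: hs_norm_def infsum_nonneg)
  ultimately have "(hs_norm A)\<^sup>2 \<le> c\<^sup>2" by (rule power_mono)
  then show "\<forall>F. finite F \<longrightarrow> F \<subseteq> onb \<longrightarrow> (\<Sum>e\<in>F. (norm (blinfun_apply A e))\<^sup>2) \<le> c\<^sup>2"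
    using sum_le_hs_norm[OF assms(1)] order_trans by blast
next
  assume "\<forall>F. finite F \<longrightarrow> F \<subseteq> onb \<longrightarrow> (\<Sum>e\<in>F. (norm (blinfun_apply A e))\<^sup>2) \<le> c\<^sup>2"
  then show "hs_norm A \<le> c" by (intro hs_norm_le assms(2)) auto
qed

lemma hs_norm_nonneg: "0 \<le> hs_norm A"
  by (simp add: hs_norm_def infsum_nonneg)

text \<open>$\hat W A \hat W = M (W A W) M^*$ for $W = \Sigma_\lambda^{-1/2}$, $\hat W = A_\lambda^{-1/2}$ and
  $M = \hat W \Sigma_\lambda^{1/2}$.\<close>

lemma N2_le_of_conjugate:
  fixes A \<Sigma> :: "'h::{real_inner,banach} \<Rightarrow>\<^sub>L 'h"
  assumes A: "positive_op A" and \<Sigma>: "positive_op \<Sigma>" and l: "0 < l" and c: "0 \<le> c"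
    and le: "\<And>F. finite F \<Longrightarrow> F \<subseteq> onb \<Longrightarrow>
      (\<Sum>e\<in>F. (norm (blinfun_apply (inv_sqrt_reg \<Sigma> l o\<^sub>L A o\<^sub>L inv_sqrt_reg \<Sigma> l) e))\<^sup>2) \<le> c\<^sup>2"
  shows "N2 A l \<le> (norm (inv_sqrt_reg A l o\<^sub>L sqrt_op (regularize \<Sigma> l)))\<^sup>2 * c"
proof -
  define V where "V = inv_sqrt_reg A l"
  define W where "W = inv_sqrt_reg \<Sigma> l"
  define S where "S = sqrt_op (regularize \<Sigma> l)"
  define X where "X = W o\<^sub>L A o\<^sub>L W"
  define M where "M = V o\<^sub>L S"
  define D where "D = X o\<^sub>L (S o\<^sub>L V)"
  have sV: "inner (blinfun_apply V f) g = inner f (blinfun_apply V g)" for f g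
    unfolding V_def by (rule selfadjointD[OF inv_sqrt_reg_selfadjoint[OF A l]])
  have sS: "inner (blinfun_apply S f) g = inner f (blinfun_apply S g)" for f g
    unfolding S_def by (rule selfadjointD[OF sqrt_reg_selfadjoint[OF \<Sigma> l]])
  have "selfadjoint X"
    unfolding X_def W_def
    by (intro selfadjoint_conj inv_sqrt_reg_selfadjoint \<Sigma> l positive_op_selfadjoint A)
  then have sX: "inner (blinfun_apply X f) g = inner f (blinfun_apply X g)" for f g
    by (rule selfadjointD)
  have WS: "blinfun_apply W (blinfun_apply S x) = x" "blinfun_apply S (blinfun_apply W x) = x" for x
    unfolding W_def S_def by (rule inv_sqrt_reg_apply[OF \<Sigma> l])+
  \<comment> \<open>\<open>S\<close> and \<open>W\<close> are mutually inverse, so their products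
    may be inserted on both sides of \<open>A\<close>.\<close>
  have eq: "V o\<^sub>L A o\<^sub>L V = M o\<^sub>L D"
    by (rule blinfun_eqI) (simp add: M_def D_def X_def WS)
  have MX: "(\<Sum>e\<in>F. (norm (blinfun_apply (M o\<^sub>L X) e))\<^sup>2) \<le> (norm M * c)\<^sup>2"
    if F: "finite F" "F \<subseteq> onb" for F
  proof -
    have "(\<Sum>e\<in>F. (norm (blinfun_apply (M o\<^sub>L X) e))\<^sup>2) \<le> (\<Sum>e\<in>F. (norm M)\<^sup>2 * (norm (blinfun_apply X e))\<^sup>2)"
      by (intro sum_mono) (use norm_blinfun[of M] in \<open>simp flip: power_mult_distrib add: power_mono\<close>)
    also have "\<dots> = (norm M)\<^sup>2 * (\<Sum>e\<in>F. (norm (blinfun_apply X e))\<^sup>2)"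
      by (simp add: sum_distrib_left)
    also have "\<dots> \<le> (norm M)\<^sup>2 * c\<^sup>2"
      unfolding X_def W_def by (intro mult_left_mono le F) auto
    finally show ?thesis by (simp add: power_mult_distrib)
  qed
  \<comment> \<open>The adjoint of \<open>D\<close> is \<open>M X\<close>, where \<open>M\<close>
    multiplies from the left and the estimate is immediate; multiplication from the right is reached
    through the adjoint.\<close>
  have D: "(\<Sum>e\<in>F. (norm (blinfun_apply D e))\<^sup>2) \<le> (norm M * c)\<^sup>2"
    if F: "finite F" "F \<subseteq> onb" for F
    by (rule onb_sum_adjoint_le[OF _ MX F]) (simp_all add: D_def M_def sX sS sV)
  have MD: "(\<Sum>e\<in>F. (norm (blinfun_apply (M o\<^sub>L D) e))\<^sup>2) \<le> ((norm M)\<^sup>2 * c)\<^sup>2"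
    if F: "finite F" "F \<subseteq> onb" for F
  proof -
    have "(\<Sum>e\<in>F. (norm (blinfun_apply (M o\<^sub>L D) e))\<^sup>2) \<le> (\<Sum>e\<in>F. (norm M)\<^sup>2 * (norm (blinfun_apply D e))\<^sup>2)"
      by (intro sum_mono) (use norm_blinfun[of M] in \<open>simp flip: power_mult_distrib add: power_mono\<close>)
    also have "\<dots> = (norm M)\<^sup>2 * (\<Sum>e\<in>F. (norm (blinfun_apply D e))\<^sup>2)"
      by (simp add: sum_distrib_left)
    also have "\<dots> \<le> (norm M)\<^sup>2 * (norm M * c)\<^sup>2"
      by (intro mult_left_mono D F) auto
    also have "\<dots> = ((norm M)\<^sup>2 * c)\<^sup>2" by (simp add: power2_eq_square mult_ac)
    finally show ?thesis .
  qed
  have "hs_norm (V o\<^sub>L A o\<^sub>L V) \<le> (norm M)\<^sup>2 * c"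
    unfolding eq by (rule hs_norm_le[OF MD]) (use c in auto)
  then show ?thesis by (simp add: N2_def V_def M_def S_def)
qed

section \<open>A Bernstein inequality for vector-valued U-statistics\<close>

lemma convex_power_nonneg: "convex_on {0::real..} (\<lambda>x. x ^ n)"
  by (cases "even n") (auto intro: convex_power_odd convex_on_subset[OF convex_power_even])

text \<open>\<open>cosh (sqrt u)\<close> is the power series with terms \<open>u^k / (2k)!\<close>;
  its coefficients are nonnegative, so convexity on the half-line holds term by term.\<close>

lemma cosh_sqrt_convex:
  fixes u v \<theta> :: real
  assumes "0 \<le> u" "0 \<le> v" "0 \<le> \<theta>" "\<theta> \<le> 1"
  shows "cosh (sqrt ((1 - \<theta>) * u + \<theta> * v)) \<le> (1 - \<theta>) * cosh (sqrt u) + \<theta> * cosh (sqrt v)"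
proof (rule sums_le)
  let ?c = "\<lambda>x n. if even n then x ^ n /\<^sub>R fact n else (0::real)"
  let ?w = "(1 - \<theta>) * u + \<theta> * v"
  show "?c (sqrt ?w) sums cosh (sqrt ?w)" by (rule cosh_converges)
  show "(\<lambda>n. (1 - \<theta>) * ?c (sqrt u) n + \<theta> * ?c (sqrt v) n) sums
      ((1 - \<theta>) * cosh (sqrt u) + \<theta> * cosh (sqrt v))"
    by (intro sums_add sums_mult cosh_converges)
  fix n
  show "?c (sqrt ?w) n \<le> (1 - \<theta>) * ?c (sqrt u) n + \<theta> * ?c (sqrt v) n"
  proof (cases "even n")
    case True
    then obtain k where k: "n = 2 * k" by blast
    have w: "0 \<le> ?w" using assms by simp
    have "?w ^ k \<le> (1 - \<theta>) * u ^ k + \<theta> * v ^ k"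
      using convex_onD[OF convex_power_nonneg[of k], of \<theta> u v] assms by simp
    then have "?w ^ k / fact n \<le> ((1 - \<theta>) * u ^ k + \<theta> * v ^ k) / fact n"
      by (rule divide_right_mono) simp
    moreover have "sqrt x ^ n = x ^ k" if "0 \<le> x" for x
      using that by (simp add: k power_mult)
    ultimately show ?thesis
      using True assms w by (simp add: divide_inverse algebra_simps)
  qed simp
qed

lemma cosh_le_exp_minus:
  assumes "0 \<le> (b::real)"
  shows "cosh b \<le> exp b - b" "b \<le> sinh b"
proof -
  show "b \<le> sinh b" using real_le_x_sinh[OF assms] by (simp add: sinh_field_def exp_minus)
  then show "cosh b \<le> exp b - b" using sinh_plus_cosh[of b] by linarith
qed

text \<open>The linear term on the right integrates to zero in the application, where \<open>p\<close> is the
  inner product of a fixed vector of norm \<open>a\<close> with a centred random vector of norm \<open>b\<close>.\<close>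

lemma cosh_norm_add_le:
  fixes a b p :: real
  assumes a: "0 \<le> a" and b: "0 \<le> b" and p: "\<bar>p\<bar> \<le> a * b"
  shows "cosh (sqrt (a\<^sup>2 + 2 * p + b\<^sup>2)) \<le> cosh a * (exp b - b) + sinh a / a * p"
proof (cases "a = 0 \<or> b = 0")
  \<comment> \<open>At \<open>a = 0\<close> the quotient \<open>sinh a / a\<close> has the value 0,
    which is harmless because \<open>p\<close> vanishes as well.\<close>
  case True
  then have "p = 0" using p by auto
  moreover have "1 \<le> exp b - b" using exp_ge_add_one_self[of b] by linarith
  ultimately show ?thesis
    using True a b cosh_le_exp_minus[OF b] by auto
next
  case False
  then have ab: "a > 0" "b > 0" using a b by auto
  \<comment> \<open>\<open>c\<close> is the cosine of the angle between the two vectors; it exhibits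
    the squared norm of their sum as a convex combination of \<open>(a - b)^2\<close> and
    \<open>(a + b)^2\<close>.\<close>
  define c where "c = p / (a * b)"
  have pc: "p = c * (a * b)" using ab by (simp add: c_def)
  have c: "-1 \<le> c" "c \<le> 1" using p ab by (auto simp: c_def field_simps abs_le_iff)
  define \<theta> where "\<theta> = (1 + c) / 2"
  have "a\<^sup>2 + 2 * p + b\<^sup>2 = (1 - \<theta>) * (a - b)\<^sup>2 + \<theta> * (a + b)\<^sup>2"
    by (simp add: pc \<theta>_def power2_eq_square field_simps)
  then have "cosh (sqrt (a\<^sup>2 + 2 * p + b\<^sup>2)) \<le> (1 - \<theta>) * cosh (sqrt ((a - b)\<^sup>2)) + \<theta> * cosh (sqrt ((a + b)\<^sup>2))"
    using cosh_sqrt_convex[of "(a - b)\<^sup>2" "(a + b)\<^sup>2" \<theta>] c by (simp add: \<theta>_def)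
  also have "\<dots> = (1 - \<theta>) * cosh (a - b) + \<theta> * cosh (a + b)"
    using ab by simp
  also have "\<dots> = cosh a * cosh b + c * (sinh a * sinh b)"
    by (simp add: cosh_add cosh_diff \<theta>_def field_simps)
  \<comment> \<open>The part \<open>c * sinh a * b\<close> is exactly the linear term; the remainder
    is bounded using \<open>c \<le> 1\<close> and \<open>sinh a \<le> cosh a\<close>.\<close>
  also have "\<dots> = cosh a * cosh b + sinh a / a * p + c * (sinh a * (sinh b - b))"
    using ab by (simp add: pc field_simps)
  also have "\<dots> \<le> cosh a * cosh b + sinh a / a * p + 1 * (cosh a * (sinh b - b))"
    using ab c cosh_le_exp_minus(2)[OF b] sinh_le_cosh_real[of a]
    by (intro add_mono mult_mono order_refl) (auto intro: mult_right_mono order_trans[OF mult_right_mono])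
  also have "\<dots> = cosh a * (exp b - b) + sinh a / a * p"
    by (simp add: sinh_plus_cosh[symmetric] algebra_simps)
  finally show ?thesis .
qed

text \<open>In the third-order remainder \<open>exp t \<le> 7/4\<close> and
  \<open>b \<le> 1/2\<close> give the coefficient 1/2 + 7/48 = 31/48, below 2/3. The restriction on
  \<open>b\<close> is the source of the condition \<open>t * B \<le> 1/2\<close> below.\<close>

lemma exp_minus_le_quadratic:
  fixes b :: real
  assumes "0 \<le> b" "b \<le> 1/2"
  shows "exp b - b \<le> 1 + 2/3 * b\<^sup>2"
proof -
  obtain t where t: "\<bar>t\<bar> \<le> \<bar>b\<bar>" "exp b = (\<Sum>m<3. b ^ m / fact m) + (exp t / fact 3) * b ^ 3"
    using Maclaurin_exp_le[of b 3] by blast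
  have "exp t \<le> exp (1/2)" using t(1) assms by simp
  also have "\<dots> \<le> 1 + 1/2 + (1/2)\<^sup>2" by (rule exp_bound) auto
  finally have e: "exp t \<le> 7/4" by (simp add: power2_eq_square)
  have "exp b = 1 + b + b\<^sup>2/2 + exp t / 6 * b ^ 3"
    using t(2) by (simp add: eval_nat_numeral fact_numeral)
  also have "exp t / 6 * b ^ 3 \<le> (7/4) / 6 * ((1/2) * b\<^sup>2)"
  proof (intro mult_mono)
    show "b ^ 3 \<le> 1/2 * b\<^sup>2"
      using mult_right_mono[OF assms(2), of "b\<^sup>2"] by (simp add: power3_eq_cube power2_eq_square mult_ac)
  qed (use assms e in auto)
  finally have "exp b \<le> 1 + b + b\<^sup>2/2 + (7/4) / 6 * ((1/2) * b\<^sup>2)" by simp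
  then show ?thesis using zero_le_power2[of b] by linarith
qed

section \<open>One centred step in a Euclidean norm\<close>

abbreviation vnorm :: "'j set \<Rightarrow> ('j \<Rightarrow> real) \<Rightarrow> real" where
  "vnorm F x \<equiv> L2_Norm.L2_set x F"

lemma vnorm_square: "(vnorm F x)\<^sup>2 = (\<Sum>j\<in>F. (x j)\<^sup>2)"
  by (simp add: L2_Norm.L2_set_def sum_nonneg)

lemma vnorm_sum_le: "finite A \<Longrightarrow> vnorm F (\<lambda>j. \<Sum>i\<in>A. f i j) \<le> (\<Sum>i\<in>A. vnorm F (f i))"
proof (induction A rule: finite_induct)
  case empty
  then show ?case by (simp add: L2_Norm.L2_set_def)
next
  case (insert a A)
  then show ?case
    using L2_set_triangle_ineq[of "f a" "\<lambda>j. \<Sum>i\<in>A. f i j" F] by simp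
qed

lemma vnorm_scale: "0 \<le> c \<Longrightarrow> vnorm F (\<lambda>j. c * x j) = c * vnorm F x"
  by (simp add: L2_set_right_distrib)

text \<open>The nonnegative integral on the left lets the step be iterated inside a product measure
  without integrability conditions on \<open>cosh\<close>; integrability is needed only for the
  majorant \<open>g\<close>, quadratic in bounded coordinates.\<close>

lemma (in prob_space) cosh_step:
  fixes X :: "'a \<Rightarrow> 'j \<Rightarrow> real"
  assumes F: "finite F"
    and X [measurable]: "\<And>j. j \<in> F \<Longrightarrow> (\<lambda>\<omega>. X \<omega> j) \<in> borel_measurable M"
    and centred: "\<And>j. j \<in> F \<Longrightarrow> expectation (\<lambda>\<omega>. X \<omega> j) = 0"
    and bound: "AE \<omega> in M. vnorm F (X \<omega>) \<le> B"
    and var: "expectation (\<lambda>\<omega>. (vnorm F (X \<omega>))\<^sup>2) \<le> \<sigma>2"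
    and t: "0 \<le> t" "t * B \<le> 1/2"
  shows "(\<integral>\<^sup>+\<omega>. ennreal (cosh (t * vnorm F (\<lambda>j. x j + X \<omega> j))) \<partial>M)
    \<le> ennreal (cosh (t * vnorm F x) * exp (2/3 * t\<^sup>2 * \<sigma>2))"
proof -
  define k where "k = sinh (t * vnorm F x) / (t * vnorm F x)"
  define g where "g \<omega> = cosh (t * vnorm F x) * (1 + 2/3 * (t\<^sup>2 * (vnorm F (X \<omega>))\<^sup>2)) +
    k * (t\<^sup>2 * (\<Sum>j\<in>F. x j * X \<omega> j))" for \<omega>
  have coord: "integrable M (\<lambda>\<omega>. X \<omega> j)" "integrable M (\<lambda>\<omega>. (X \<omega> j)\<^sup>2)" if j: "j \<in> F" for j
  proof -
    have le: "\<bar>X \<omega> j\<bar> \<le> vnorm F (X \<omega>)" for \<omega>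
      using member_le_L2_set[OF F j, of "\<lambda>j. \<bar>X \<omega> j\<bar>"] by (simp add: L2_Norm.L2_set_def)
    show "integrable M (\<lambda>\<omega>. X \<omega> j)"
    proof (rule integrable_const_bound[where B=B])
      show "AE \<omega> in M. norm (X \<omega> j) \<le> B"
        using bound
      proof eventually_elim
        case (elim \<omega>)
        then show ?case using le[of \<omega>] by simp
      qed
    qed (use j in simp)
    show "integrable M (\<lambda>\<omega>. (X \<omega> j)\<^sup>2)"
    proof (rule integrable_const_bound[where B="B\<^sup>2"])
      show "AE \<omega> in M. norm ((X \<omega> j)\<^sup>2) \<le> B\<^sup>2"
        using bound
      proof eventually_elim
        case (elim \<omega>)
        then have "\<bar>X \<omega> j\<bar> \<le> B" using le[of \<omega>] by linarith
        then have "\<bar>X \<omega> j\<bar>\<^sup>2 \<le> B\<^sup>2" by (intro power_mono) auto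
        then show ?case by simp
      qed
    qed (use j in simp)
  qed
  have int_g: "integrable M g"
    unfolding g_def vnorm_square using coord
    by (intro Bochner_Integration.integrable_add Bochner_Integration.integrable_mult_right
        Bochner_Integration.integrable_sum integrable_const) auto
  have le: "AE \<omega> in M. cosh (t * vnorm F (\<lambda>j. x j + X \<omega> j)) \<le> g \<omega>"
    using bound
  proof eventually_elim
    case (elim \<omega>)
    define a b p where "a = t * vnorm F x" and "b = t * vnorm F (X \<omega>)" and "p = t\<^sup>2 * (\<Sum>j\<in>F. x j * X \<omega> j)"
    have ab: "0 \<le> a" "0 \<le> b" using t by (auto simp: a_def b_def)
    have b2: "b \<le> 1/2" using mult_left_mono[OF elim t(1)] t(2) by (simp add: b_def)
    have "\<bar>\<Sum>j\<in>F. x j * X \<omega> j\<bar> \<le> (\<Sum>j\<in>F. \<bar>x j\<bar> * \<bar>X \<omega> j\<bar>)"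
      by (rule order_trans[OF sum_abs]) (simp add: abs_mult)
    also have "\<dots> \<le> vnorm F x * vnorm F (X \<omega>)" by (rule L2_set_mult_ineq)
    finally have p: "\<bar>p\<bar> \<le> a * b"
      using t(1) by (auto simp: p_def a_def b_def abs_mult power2_eq_square mult_ac intro!: mult_left_mono)
    have "(t * vnorm F (\<lambda>j. x j + X \<omega> j))\<^sup>2 = a\<^sup>2 + 2 * p + b\<^sup>2"
      by (simp add: a_def b_def p_def power_mult_distrib vnorm_square power2_sum sum.distrib sum_distrib_left algebra_simps)
    then have "t * vnorm F (\<lambda>j. x j + X \<omega> j) = sqrt (a\<^sup>2 + 2 * p + b\<^sup>2)"
      using t(1) by (metis L2_set_nonneg mult_nonneg_nonneg real_sqrt_abs abs_of_nonneg)
    then have "cosh (t * vnorm F (\<lambda>j. x j + X \<omega> j)) \<le> cosh a * (exp b - b) + sinh a / a * p"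
      using cosh_norm_add_le[OF ab p] by simp
    also have "\<dots> \<le> cosh a * (1 + 2/3 * b\<^sup>2) + sinh a / a * p"
      using exp_minus_le_quadratic[OF ab(2) b2] by (intro add_right_mono mult_left_mono) auto
    also have "\<dots> = g \<omega>"
      by (simp add: g_def k_def a_def b_def p_def power_mult_distrib)
    finally show ?case .
  qed
  have "(\<integral>\<^sup>+\<omega>. ennreal (cosh (t * vnorm F (\<lambda>j. x j + X \<omega> j))) \<partial>M) \<le> (\<integral>\<^sup>+\<omega>. ennreal (g \<omega>) \<partial>M)"
    by (rule nn_integral_mono_AE) (use le in \<open>auto elim!: eventually_mono intro!: ennreal_leI\<close>)
  also have "\<dots> = ennreal (expectation g)"
  proof (rule nn_integral_eq_integral[OF int_g])
    show "AE \<omega> in M. 0 \<le> g \<omega>"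
      using le by eventually_elim (rule order_trans[OF cosh_real_nonneg])
  qed
  also have "expectation g = cosh (t * vnorm F x) * (1 + 2/3 * (t\<^sup>2 * expectation (\<lambda>\<omega>. (vnorm F (X \<omega>))\<^sup>2)))"
  proof -
    have "expectation (\<lambda>\<omega>. \<Sum>j\<in>F. x j * X \<omega> j) = 0"
      using coord centred by (subst Bochner_Integration.integral_sum) auto
    moreover have "integrable M (\<lambda>\<omega>. (vnorm F (X \<omega>))\<^sup>2)" "integrable M (\<lambda>\<omega>. \<Sum>j\<in>F. x j * X \<omega> j)"
      unfolding vnorm_square using coord by auto
    ultimately show ?thesis
      unfolding g_def by (simp add: prob_space)
  qed
  also have "\<dots> \<le> cosh (t * vnorm F x) * exp (2/3 * t\<^sup>2 * \<sigma>2)"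
  proof (rule mult_left_mono)
    have "t\<^sup>2 * expectation (\<lambda>\<omega>. (vnorm F (X \<omega>))\<^sup>2) \<le> t\<^sup>2 * \<sigma>2"
      by (intro mult_left_mono var) auto
    then have "1 + 2/3 * (t\<^sup>2 * expectation (\<lambda>\<omega>. (vnorm F (X \<omega>))\<^sup>2)) \<le> 1 + 2/3 * t\<^sup>2 * \<sigma>2" by simp
    also have "\<dots> \<le> exp (2/3 * t\<^sup>2 * \<sigma>2)" by (rule exp_ge_add_one_self)
    finally show "1 + 2/3 * (t\<^sup>2 * expectation (\<lambda>\<omega>. (vnorm F (X \<omega>))\<^sup>2)) \<le> exp (2/3 * t\<^sup>2 * \<sigma>2)" .
  qed auto
  finally show ?thesis by (auto simp: ennreal_leI)
qed

section \<open>Averaging over permutations\<close>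

lemma transitive_on_pairs:
  assumes "a \<in> S" "b \<in> S" "a \<noteq> b" "a' \<in> S" "b' \<in> S" "a' \<noteq> b'"
  obtains \<rho> where "\<rho> permutes S" "\<rho> a' = a" "\<rho> b' = b"
proof -
  \<comment> \<open>The first transposition sends \<open>a'\<close> to \<open>a\<close> and
    \<open>b'\<close> to \<open>c\<close>; as \<open>a\<close> differs from both \<open>b\<close>
    and \<open>c\<close>, the second can move \<open>c\<close> to \<open>b\<close> without
    disturbing \<open>a\<close>.\<close>
  define c where "c = Transposition.transpose a' a b'"
  have c: "c \<noteq> a" "c \<in> S" using assms by (auto simp: c_def Transposition.transpose_def)
  show ?thesis
  proof (rule that)
    show "Transposition.transpose c b \<circ> Transposition.transpose a' a permutes S"
      using assms c by (intro permutes_compose permutes_swap_id)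
    show "(Transposition.transpose c b \<circ> Transposition.transpose a' a) a' = a"
      using assms c by (simp add: Transposition.transpose_def)
    show "(Transposition.transpose c b \<circ> Transposition.transpose a' a) b' = b"
      by (simp flip: c_def)
  qed
qed

lemma card_off_diagonal:
  assumes "finite S"
  shows "real (card {(i, j). i \<in> S \<and> j \<in> S \<and> i \<noteq> j}) = real (card S) * (real (card S) - 1)"
proof -
  have D: "{(i, j). i \<in> S \<and> j \<in> S \<and> i \<noteq> j} = S \<times> S - (\<lambda>i. (i, i)) ` S" by auto
  have "card {(i, j). i \<in> S \<and> j \<in> S \<and> i \<noteq> j} = card S * card S - card S"
    unfolding D using assms by (subst card_Diff_subset) (auto simp: card_cartesian_product card_image inj_on_def)
  then show ?thesis by (cases "card S") (auto simp: algebra_simps)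
qed

text \<open>Right translation by a permutation carrying one pair of positions to another shows that
  the sum is the same for all pairs. After summing over the pairs, each single permutation merely
  permutes the off-diagonal indices, which leaves the factor \<open>fact (card S)\<close>.\<close>

lemma sum_permutations_pair:
  fixes f :: "'a \<Rightarrow> 'a \<Rightarrow> real"
  assumes S: "finite S" and ab: "a \<in> S" "b \<in> S" "a \<noteq> b"
  shows "real (card S) * (real (card S) - 1) * (\<Sum>\<pi> | \<pi> permutes S. f (\<pi> a) (\<pi> b)) =
    fact (card S) * (\<Sum>(i, j) \<in> {(i, j). i \<in> S \<and> j \<in> S \<and> i \<noteq> j}. f i j)"
proof -
  let ?D = "{(i, j). i \<in> S \<and> j \<in> S \<and> i \<noteq> j}"
  define H where "H a b = (\<Sum>\<pi> | \<pi> permutes S. f (\<pi> a) (\<pi> b))" for a b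
  have H: "H a' b' = H a b" if "a' \<in> S" "b' \<in> S" "a' \<noteq> b'" for a' b'
  proof -
    obtain \<rho> where \<rho>: "\<rho> permutes S" "\<rho> a' = a" "\<rho> b' = b"
      using transitive_on_pairs[OF ab \<open>a' \<in> S\<close> \<open>b' \<in> S\<close> \<open>a' \<noteq> b'\<close>] by metis
    show ?thesis
      unfolding H_def using sum_permutations_compose_right[OF \<rho>(1), of "\<lambda>\<pi>. f (\<pi> a') (\<pi> b')"]
      by (simp add: \<rho>)
  qed
  note cD = card_off_diagonal[OF S]
  have "real (card S) * (real (card S) - 1) * H a b = (\<Sum>(a', b')\<in>?D. H a' b')"
    using H by (simp add: cD[symmetric] split_beta')
  also have "\<dots> = (\<Sum>\<pi> | \<pi> permutes S. \<Sum>(a', b')\<in>?D. f (\<pi> a') (\<pi> b'))"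
    unfolding H_def by (subst sum.swap) (simp add: split_beta')
  also have "\<dots> = (\<Sum>\<pi> | \<pi> permutes S. \<Sum>(i, j)\<in>?D. f i j)"
  proof (rule sum.cong[OF refl])
    fix \<pi> assume "\<pi> \<in> {\<pi>. \<pi> permutes S}"
    then have \<pi>: "\<pi> permutes S" by simp
    have "bij_betw (\<lambda>(i, j). (\<pi> i, \<pi> j)) ?D ?D"
    proof (rule bij_betw_byWitness[where f' = "\<lambda>(i, j). (inv \<pi> i, inv \<pi> j)"])
      show "(\<lambda>(i, j). (\<pi> i, \<pi> j)) ` ?D \<subseteq> ?D"
        using permutes_in_image[OF \<pi>] permutes_inj[OF \<pi>] by (auto simp: inj_eq)
      show "(\<lambda>(i, j). (inv \<pi> i, inv \<pi> j)) ` ?D \<subseteq> ?D"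
        using permutes_in_image[OF permutes_inv[OF \<pi>]] permutes_inj[OF permutes_inv[OF \<pi>]] by (auto simp: inj_eq)
    qed (auto simp: permutes_inverses[OF \<pi>])
    from sum.reindex_bij_betw[OF this, of "\<lambda>(i, j). f i j"]
    show "(\<Sum>(a', b')\<in>?D. f (\<pi> a') (\<pi> b')) = (\<Sum>(i, j)\<in>?D. f i j)"
      by (simp add: split_beta')
  qed
  also have "\<dots> = fact (card S) * (\<Sum>(i, j)\<in>?D. f i j)"
    by (simp add: card_permutations[OF refl S])
  finally show ?thesis unfolding H_def .
qed

lemma measurable_vnorm:
  assumes "\<And>j. j \<in> F \<Longrightarrow> (\<lambda>\<omega>. x \<omega> j) \<in> borel_measurable N"
  shows "(\<lambda>\<omega>. vnorm F (x \<omega>)) \<in> borel_measurable N"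
proof -
  have "(\<lambda>\<omega>. \<Sum>j\<in>F. (x \<omega> j)\<^sup>2) \<in> borel_measurable N"
    by (intro borel_measurable_sum borel_measurable_power assms)
  then show ?thesis unfolding L2_Norm.L2_set_def by simp
qed

lemma measurable_cosh_vnorm:
  assumes "\<And>j. j \<in> F \<Longrightarrow> (\<lambda>\<omega>. x \<omega> j) \<in> borel_measurable N"
  shows "(\<lambda>\<omega>. ennreal (cosh (t * vnorm F (x \<omega>)))) \<in> borel_measurable N"
proof -
  have "(\<lambda>\<omega>. vnorm F (x \<omega>)) \<in> borel_measurable N"
    by (rule measurable_vnorm[OF assms])
  moreover have "(\<lambda>y. ennreal (cosh (t * y))) \<in> borel_measurable borel"
    by (intro measurable_compose[OF _ measurable_ennreal] borel_measurable_continuous_onI continuous_intros)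
  ultimately show ?thesis by (rule measurable_compose)
qed

lemma convex_on_cosh: "convex_on UNIV (cosh :: real \<Rightarrow> real)"
  by (rule f''_ge0_imp_convex[where f' = sinh and f'' = cosh]) (auto intro!: derivative_eq_intros)

section \<open>Exponential moments and tails of a centred U-statistic\<close>

locale centred_pair_kernel = prob_space +
  fixes X :: "'a \<Rightarrow> 'a \<Rightarrow> 'j \<Rightarrow> real" and F :: "'j set" and B \<sigma>2 t :: real
  assumes fin: "finite F"
    and meas: "j \<in> F \<Longrightarrow> (\<lambda>z. X (fst z) (snd z) j) \<in> borel_measurable (M \<Otimes>\<^sub>M M)"
    and centred: "j \<in> F \<Longrightarrow> (\<integral>z. X (fst z) (snd z) j \<partial>(M \<Otimes>\<^sub>M M)) = 0"
    and bound: "AE z in M \<Otimes>\<^sub>M M. vnorm F (X (fst z) (snd z)) \<le> B"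
    and var: "(\<integral>z. (vnorm F (X (fst z) (snd z)))\<^sup>2 \<partial>(M \<Otimes>\<^sub>M M)) \<le> \<sigma>2"
    and t: "0 \<le> t" "t * B \<le> 1/2"
begin

lemma meas_compose:
  assumes "j \<in> F" "f \<in> measurable N M" "g \<in> measurable N M"
  shows "(\<lambda>\<omega>. X (f \<omega>) (g \<omega>) j) \<in> borel_measurable N"
  using measurable_compose[OF measurable_Pair[OF assms(2,3)] meas[OF assms(1)]] by simp

lemma cosh_pair_step:
  "(\<integral>\<^sup>+y'. \<integral>\<^sup>+y. ennreal (cosh (t * vnorm F (\<lambda>j. x j + X y y' j))) \<partial>M \<partial>M)
    \<le> ennreal (cosh (t * vnorm F x) * exp (2/3 * t\<^sup>2 * \<sigma>2))"
proof -
  interpret MM: pair_prob_space M M ..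
  have "(\<lambda>z. ennreal (cosh (t * vnorm F (\<lambda>j. x j + X (fst z) (snd z) j)))) \<in> borel_measurable (M \<Otimes>\<^sub>M M)"
    by (rule measurable_cosh_vnorm) (use meas in auto)
  from MM.nn_integral_snd[OF this]
  have "(\<integral>\<^sup>+y'. \<integral>\<^sup>+y. ennreal (cosh (t * vnorm F (\<lambda>j. x j + X y y' j))) \<partial>M \<partial>M) =
      (\<integral>\<^sup>+z. ennreal (cosh (t * vnorm F (\<lambda>j. x j + X (fst z) (snd z) j))) \<partial>(M \<Otimes>\<^sub>M M))"
    by simp
  also have "\<dots> \<le> ennreal (cosh (t * vnorm F x) * exp (2/3 * t\<^sup>2 * \<sigma>2))"
    by (rule MM.cosh_step[OF fin meas centred bound var t])
  finally show ?thesis .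
qed

text \<open>Induction on the number of blocks: the two coordinates of the last block are integrated
  out first, the earlier sum being held fixed. \<open>I\<close> stays general because it shrinks
  with each block and may contain coordinates belonging to no block, as for odd sample size.\<close>

lemma cosh_blocks:
  assumes "finite I" "inj_on a {..<2 * m}" "a ` {..<2 * m} \<subseteq> I"
  shows "(\<integral>\<^sup>+Y. ennreal (cosh (t * vnorm F (\<lambda>j. \<Sum>k<m. X (Y (a (2 * k))) (Y (a (2 * k + 1))) j))) \<partial>Pi\<^sub>M I (\<lambda>_. M))
    \<le> ennreal (exp (2/3 * t\<^sup>2 * \<sigma>2) ^ m)"
  using assms
proof (induction m arbitrary: I)
  case 0
  interpret PI: prob_space "Pi\<^sub>M I (\<lambda>_. M)"
    by (rule prob_space_PiM) (rule prob_space_axioms)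
  show ?case by (simp add: L2_Norm.L2_set_def PI.emeasure_space_1)
next
  case (Suc m)
  interpret product_sigma_finite "\<lambda>_. M" ..
  define p q where "p = a (2 * m)" and "q = a (2 * m + 1)"
  define I' where "I' = I - {p, q}"
  have pq: "p \<in> I" "q \<in> I" using Suc.prems(3) by (auto simp: p_def q_def)
  have "p \<noteq> q" using inj_onD[OF Suc.prems(2), of "2 * m" "2 * m + 1"] by (auto simp: p_def q_def)
  have inj': "inj_on a {..<2 * m}" using Suc.prems(2) by (rule inj_on_subset) auto
  have out: "a i \<noteq> p" "a i \<noteq> q" if "i < 2 * m" for i
    using that inj_onD[OF Suc.prems(2), of i "2 * m"] inj_onD[OF Suc.prems(2), of i "2 * m + 1"]
    by (auto simp: p_def q_def)
  have in_I: "a i \<in> I" if "i < 2 * m" for i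
    using Suc.prems(3) that by auto
  have sub: "a ` {..<2 * m} \<subseteq> I'"
    using Suc.prems(3) out by (auto simp: I'_def)
  have fin': "finite I'" "q \<notin> I'" "p \<notin> insert q I'" "I = insert p (insert q I')"
    using Suc.prems(1) pq \<open>p \<noteq> q\<close> by (auto simp: I'_def)
  define S where "S Y j = (\<Sum>k<m. X (Y (a (2 * k))) (Y (a (2 * k + 1))) j)" for Y j
  define f where "f Y = ennreal (cosh (t * vnorm F (\<lambda>j. S Y j + X (Y p) (Y q) j)))" for Y
  have comp: "(\<lambda>Y. Y i) \<in> measurable (Pi\<^sub>M I (\<lambda>_. M)) M" if "i \<in> I" for i
    using that by (rule measurable_component_singleton)
  have [measurable]: "f \<in> borel_measurable (Pi\<^sub>M (insert p (insert q I')) (\<lambda>_. M))"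
    unfolding fin'(4)[symmetric] f_def S_def
    by (intro measurable_cosh_vnorm borel_measurable_add borel_measurable_sum meas_compose comp pq)
      (use in_I in auto)
  have g: "(\<lambda>Y. \<integral>\<^sup>+y. f (Y(p := y)) \<partial>M) \<in> borel_measurable (Pi\<^sub>M (insert q I') (\<lambda>_. M))"
    by measurable
  have "(\<integral>\<^sup>+Y. f Y \<partial>Pi\<^sub>M I (\<lambda>_. M)) = (\<integral>\<^sup>+Y. \<integral>\<^sup>+y'. \<integral>\<^sup>+y. f (Y(q := y', p := y)) \<partial>M \<partial>M \<partial>Pi\<^sub>M I' (\<lambda>_. M))"
    unfolding fin'(4) using fin'
    by (subst product_nn_integral_insert, simp_all add: product_nn_integral_insert g)
  also have "\<dots> \<le> (\<integral>\<^sup>+Y. ennreal (exp (2/3 * t\<^sup>2 * \<sigma>2)) * ennreal (cosh (t * vnorm F (S Y))) \<partial>Pi\<^sub>M I' (\<lambda>_. M))"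
  proof (rule nn_integral_mono)
    fix Y
    have "f (Y(q := y', p := y)) = ennreal (cosh (t * vnorm F (\<lambda>j. S Y j + X y y' j)))" for y y'
    proof -
      have "S (Y(q := y', p := y)) = S Y"
        unfolding S_def using out by (intro ext sum.cong refl) auto
      then show ?thesis using \<open>p \<noteq> q\<close> by (simp add: f_def)
    qed
    then have "(\<integral>\<^sup>+y'. \<integral>\<^sup>+y. f (Y(q := y', p := y)) \<partial>M \<partial>M) \<le> ennreal (cosh (t * vnorm F (S Y)) * exp (2/3 * t\<^sup>2 * \<sigma>2))"
      using cosh_pair_step[of "S Y"] by simp
    then show "(\<integral>\<^sup>+y'. \<integral>\<^sup>+y. f (Y(q := y', p := y)) \<partial>M \<partial>M) \<le>
        ennreal (exp (2/3 * t\<^sup>2 * \<sigma>2)) * ennreal (cosh (t * vnorm F (S Y)))"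
      by (simp add: ennreal_mult[symmetric] mult.commute)
  qed
  also have "\<dots> = ennreal (exp (2/3 * t\<^sup>2 * \<sigma>2)) * (\<integral>\<^sup>+Y. ennreal (cosh (t * vnorm F (S Y))) \<partial>Pi\<^sub>M I' (\<lambda>_. M))"
    unfolding S_def
    by (intro nn_integral_cmult measurable_cosh_vnorm borel_measurable_sum meas_compose measurable_component_singleton)
      (use in_I out in \<open>auto simp: I'_def\<close>)
  also have "\<dots> \<le> ennreal (exp (2/3 * t\<^sup>2 * \<sigma>2)) * ennreal (exp (2/3 * t\<^sup>2 * \<sigma>2) ^ m)"
    unfolding S_def by (intro mult_left_mono Suc.IH fin'(1) inj' sub) auto
  also have "\<dots> = ennreal (exp (2/3 * t\<^sup>2 * \<sigma>2) ^ Suc m)"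
    by (simp add: ennreal_mult[symmetric])
  finally show ?case unfolding f_def S_def p_def q_def by simp
qed

definition ustat :: "nat \<Rightarrow> (nat \<Rightarrow> 'a) \<Rightarrow> 'j \<Rightarrow> real" where
  "ustat s Y j = 1 / (real s * (real s - 1)) *
    (\<Sum>(i, i') \<in> {(i, i'). i \<in> {1..s} \<and> i' \<in> {1..s} \<and> i \<noteq> i'}. X (Y i) (Y i') j)"

text \<open>Hoeffding's device: the statistic is the average, over all orderings of the sample, of a sum
  of \<open>s div 2\<close> independent terms.\<close>

lemma ustat_average:
  assumes s: "2 \<le> s"
  shows "real (s div 2) * ustat s Y j =
    (\<Sum>\<pi> | \<pi> permutes {1..s}. 1 / fact s * (\<Sum>k<s div 2. X (Y (\<pi> (Suc (2 * k)))) (Y (\<pi> (Suc (2 * k + 1)))) j))"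
proof -
  define T where "T = (\<Sum>(i, i') \<in> {(i, i'). i \<in> {1..s} \<and> i' \<in> {1..s} \<and> i \<noteq> i'}. X (Y i) (Y i') j)"
  \<comment> \<open>The sample is numbered from 1 and the blocks from 0, so block \<open>k\<close>
    occupies positions \<open>2k+1\<close> and \<open>2k+2\<close>.\<close>
  have each: "(\<Sum>\<pi> | \<pi> permutes {1..s}. X (Y (\<pi> (Suc (2 * k)))) (Y (\<pi> (Suc (2 * k + 1)))) j) =
      fact s * T / (real s * (real s - 1))" if k: "k < s div 2" for k
  proof -
    have "Suc (2 * k) \<in> {1..s}" "Suc (2 * k + 1) \<in> {1..s}" "Suc (2 * k) \<noteq> Suc (2 * k + 1)" using k by auto
    from sum_permutations_pair[OF _ this, of "\<lambda>i i'. X (Y i) (Y i') j"]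
    show ?thesis using s by (simp add: T_def field_simps)
  qed
  have "(\<Sum>\<pi> | \<pi> permutes {1..s}. 1 / fact s * (\<Sum>k<s div 2. X (Y (\<pi> (Suc (2 * k)))) (Y (\<pi> (Suc (2 * k + 1)))) j)) =
      1 / fact s * (\<Sum>k<s div 2. \<Sum>\<pi> | \<pi> permutes {1..s}. X (Y (\<pi> (Suc (2 * k)))) (Y (\<pi> (Suc (2 * k + 1)))) j)"
    by (subst sum.swap) (simp add: sum_distrib_left)
  also have "\<dots> = 1 / fact s * (\<Sum>k<s div 2. fact s * T / (real s * (real s - 1)))"
    by (intro arg_cong2[where f = "(*)"] sum.cong refl) (use each in auto)
  also have "\<dots> = real (s div 2) * ustat s Y j"
    by (simp add: ustat_def T_def)
  finally show ?thesis by simp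
qed

lemma cosh_ustat:
  assumes s: "2 \<le> s"
  shows "(\<integral>\<^sup>+Y. ennreal (cosh (t * (real (s div 2) * vnorm F (ustat s Y)))) \<partial>Pi\<^sub>M {1..s} (\<lambda>_. M))
    \<le> ennreal (exp (2/3 * t\<^sup>2 * \<sigma>2) ^ (s div 2))"
proof -
  define m where "m = s div 2"
  define Ps where "Ps = {\<pi>. \<pi> permutes {1..s}}"
  have finPs: "finite Ps" by (simp add: Ps_def finite_permutations)
  have cardPs: "card Ps = fact s" by (simp add: Ps_def card_permutations)
  then have ne: "Ps \<noteq> {}" by (metis card.empty fact_nonzero)
  define S where "S \<pi> Y j = (\<Sum>k<m. X (Y (\<pi> (Suc (2 * k)))) (Y (\<pi> (Suc (2 * k + 1)))) j)" for \<pi> and Y :: "nat \<Rightarrow> 'a" and j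
  define w where "w = (1 / fact s :: real)"
  have w: "w \<ge> 0" "(\<Sum>\<pi>\<in>Ps. w) = 1" by (auto simp: w_def cardPs)
  have pointwise: "cosh (t * (real m * vnorm F (ustat s Y))) \<le> (\<Sum>\<pi>\<in>Ps. w * cosh (t * vnorm F (S \<pi> Y)))" for Y
  proof -
    have "real m * vnorm F (ustat s Y) = vnorm F (\<lambda>j. real m * ustat s Y j)"
      by (simp add: vnorm_scale)
    also have "\<dots> = vnorm F (\<lambda>j. \<Sum>\<pi>\<in>Ps. w * S \<pi> Y j)"
      unfolding m_def ustat_average[OF s] Ps_def w_def S_def ..
    also have "\<dots> \<le> (\<Sum>\<pi>\<in>Ps. vnorm F (\<lambda>j. w * S \<pi> Y j))"
      by (rule vnorm_sum_le[OF finPs])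
    also have "\<dots> = (\<Sum>\<pi>\<in>Ps. w * vnorm F (S \<pi> Y))"
      using w(1) by (simp add: vnorm_scale)
    finally have "t * (real m * vnorm F (ustat s Y)) \<le> (\<Sum>\<pi>\<in>Ps. w *\<^sub>R (t * vnorm F (S \<pi> Y)))"
      using t(1) by (auto simp: sum_distrib_left mult_ac dest: mult_left_mono[of _ _ t])
    then have "cosh (t * (real m * vnorm F (ustat s Y))) \<le> cosh (\<Sum>\<pi>\<in>Ps. w *\<^sub>R (t * vnorm F (S \<pi> Y)))"
      using t(1) w(1) by (subst cosh_real_nonneg_le_iff) (auto intro!: sum_nonneg mult_nonneg_nonneg)
    also have "\<dots> \<le> (\<Sum>\<pi>\<in>Ps. w * cosh (t * vnorm F (S \<pi> Y)))"
      by (rule convex_on_sum[OF finPs ne convex_on_cosh]) (use w in auto)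
    finally show ?thesis .
  qed
  have "(\<integral>\<^sup>+Y. ennreal (cosh (t * (real m * vnorm F (ustat s Y)))) \<partial>Pi\<^sub>M {1..s} (\<lambda>_. M))
      \<le> (\<integral>\<^sup>+Y. (\<Sum>\<pi>\<in>Ps. ennreal w * ennreal (cosh (t * vnorm F (S \<pi> Y)))) \<partial>Pi\<^sub>M {1..s} (\<lambda>_. M))"
    by (rule nn_integral_mono)
      (use pointwise w(1) in \<open>simp add: ennreal_mult[symmetric] sum_nonneg ennreal_leI\<close>)
  also have "\<dots> = (\<Sum>\<pi>\<in>Ps. ennreal w * (\<integral>\<^sup>+Y. ennreal (cosh (t * vnorm F (S \<pi> Y))) \<partial>Pi\<^sub>M {1..s} (\<lambda>_. M)))"
  proof -
    have ms: "(\<lambda>Y. ennreal (cosh (t * vnorm F (S \<pi> Y)))) \<in> borel_measurable (Pi\<^sub>M {1..s} (\<lambda>_. M))"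
      if "\<pi> \<in> Ps" for \<pi>
    proof -
      have \<pi>: "\<pi> permutes {1..s}" using that by (simp add: Ps_def)
      show ?thesis
        unfolding S_def
        by (intro measurable_cosh_vnorm borel_measurable_sum meas_compose measurable_component_singleton)
          (auto simp: permutes_in_image[OF \<pi>, simplified] m_def)
    qed
    then show ?thesis by (subst nn_integral_sum) (auto simp: nn_integral_cmult)
  qed
  also have "\<dots> \<le> (\<Sum>\<pi>\<in>Ps. ennreal w * ennreal (exp (2/3 * t\<^sup>2 * \<sigma>2) ^ m))"
  proof (intro sum_mono mult_left_mono)
    fix \<pi> assume "\<pi> \<in> Ps"
    then have \<pi>: "\<pi> permutes {1..s}" by (simp add: Ps_def)
    have "inj_on (\<lambda>i. \<pi> (Suc i)) {..<2 * m}"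
      by (intro inj_onI) (metis permutes_inj[OF \<pi>] injD Suc_inject)
    moreover have "(\<lambda>i. \<pi> (Suc i)) ` {..<2 * m} \<subseteq> {1..s}"
    proof (rule image_subsetI)
      fix i assume "i \<in> {..<2 * m}"
      then have "Suc i \<in> {1..s}" by (auto simp: m_def)
      then show "\<pi> (Suc i) \<in> {1..s}" unfolding permutes_in_image[OF \<pi>] .
    qed
    ultimately show "(\<integral>\<^sup>+Y. ennreal (cosh (t * vnorm F (S \<pi> Y))) \<partial>Pi\<^sub>M {1..s} (\<lambda>_. M)) \<le> ennreal (exp (2/3 * t\<^sup>2 * \<sigma>2) ^ m)"
      unfolding S_def using cosh_blocks[of "{1..s}" "\<lambda>i. \<pi> (Suc i)" m] by simp
  qed auto
  also have "\<dots> = ennreal (\<Sum>\<pi>\<in>Ps. w * exp (2/3 * t\<^sup>2 * \<sigma>2) ^ m)"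
    by (subst sum_ennreal[symmetric]) (use w(1) in \<open>auto simp: ennreal_mult\<close>)
  also have "(\<Sum>\<pi>\<in>Ps. w * exp (2/3 * t\<^sup>2 * \<sigma>2) ^ m) = exp (2/3 * t\<^sup>2 * \<sigma>2) ^ m"
    using w(2) by (simp only: sum_distrib_right[symmetric] mult_1)
  finally show ?thesis unfolding m_def .
qed

text \<open>Markov's inequality for \<open>cosh\<close>; the factor 2 comes from
  \<open>cosh y \<ge> exp y / 2\<close>. The parameter \<open>t\<close> stays free until the
  concentration bound.\<close>

lemma ustat_tail:
  assumes s: "2 \<le> s"
  shows "1 - 2 * exp (real (s div 2) * (2/3 * t\<^sup>2 * \<sigma>2 - t * \<epsilon>)) \<le>
    measure (Pi\<^sub>M {1..s} (\<lambda>_. M)) {Y \<in> space (Pi\<^sub>M {1..s} (\<lambda>_. M)). vnorm F (ustat s Y) \<le> \<epsilon>}"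
    and ustat_meas: "{Y \<in> space (Pi\<^sub>M {1..s} (\<lambda>_. M)). vnorm F (ustat s Y) \<le> \<epsilon>} \<in> sets (Pi\<^sub>M {1..s} (\<lambda>_. M))"
proof -
  let ?N = "Pi\<^sub>M {1..s} (\<lambda>_. M)"
  interpret PI: prob_space ?N
    by (rule prob_space_PiM) (rule prob_space_axioms)
  define m where "m = s div 2"
  have coord: "(\<lambda>Y. ustat s Y j) \<in> borel_measurable ?N" if "j \<in> F" for j
    unfolding ustat_def split_beta'
    by (intro borel_measurable_times borel_measurable_const borel_measurable_sum meas_compose[OF that]
        measurable_component_singleton) auto
  then have [measurable]: "(\<lambda>Y. vnorm F (ustat s Y)) \<in> borel_measurable ?N"
    by (rule measurable_vnorm)
  show "{Y \<in> space ?N. vnorm F (ustat s Y) \<le> \<epsilon>} \<in> sets ?N" by measurable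
  let ?u = "\<lambda>Y. ennreal (cosh (t * (real m * vnorm F (ustat s Y))))"
  define c where "c = 2 * exp (- (t * (real m * \<epsilon>)))"
  have c: "c > 0" by (simp add: c_def)
  have um: "?u \<in> borel_measurable ?N"
    using measurable_cosh_vnorm[of F "ustat s" ?N "t * real m"] coord by (simp add: mult.assoc)
  have "emeasure ?N {Y \<in> space ?N. \<not> vnorm F (ustat s Y) \<le> \<epsilon>} \<le> emeasure ?N {Y \<in> space ?N. 1 \<le> ennreal c * ?u Y}"
  proof (rule emeasure_mono)
    show "{Y \<in> space ?N. 1 \<le> ennreal c * ?u Y} \<in> sets ?N" using um by measurable
    show "{Y \<in> space ?N. \<not> vnorm F (ustat s Y) \<le> \<epsilon>} \<subseteq> {Y \<in> space ?N. 1 \<le> ennreal c * ?u Y}"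
    proof safe
      fix Y assume "\<not> vnorm F (ustat s Y) \<le> \<epsilon>"
      then have "t * (real m * \<epsilon>) \<le> t * (real m * vnorm F (ustat s Y))"
        using t(1) by (intro mult_left_mono) auto
      then have "exp (t * (real m * \<epsilon>)) / 2 \<le> exp (t * (real m * vnorm F (ustat s Y))) / 2" by simp
      also have "\<dots> \<le> cosh (t * (real m * vnorm F (ustat s Y)))"
        by (simp add: cosh_field_def)
      finally have "1 \<le> c * cosh (t * (real m * vnorm F (ustat s Y)))"
        by (simp add: c_def exp_minus field_simps)
      then show "1 \<le> ennreal c * ?u Y"
        using c by (simp add: ennreal_mult[symmetric] flip: ennreal_1)
    qed
  qed
  also have "\<dots> \<le> ennreal c * (\<integral>\<^sup>+Y. ?u Y * indicator (space ?N) Y \<partial>?N)"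
    using um by (intro nn_integral_Markov_inequality) auto
  also have "(\<integral>\<^sup>+Y. ?u Y * indicator (space ?N) Y \<partial>?N) = (\<integral>\<^sup>+Y. ?u Y \<partial>?N)"
    by (rule nn_integral_cong) simp
  also have "ennreal c * \<dots> \<le> ennreal c * ennreal (exp (2/3 * t\<^sup>2 * \<sigma>2) ^ m)"
    unfolding m_def by (intro mult_left_mono cosh_ustat[OF s]) auto
  also have "\<dots> = ennreal (2 * exp (real m * (2/3 * t\<^sup>2 * \<sigma>2 - t * \<epsilon>)))"
    using c by (simp add: ennreal_mult[symmetric] c_def exp_of_nat_mult[symmetric] mult.assoc exp_add[symmetric] algebra_simps)
  finally have "PI.prob {Y \<in> space ?N. \<not> vnorm F (ustat s Y) \<le> \<epsilon>} \<le> 2 * exp (real m * (2/3 * t\<^sup>2 * \<sigma>2 - t * \<epsilon>))"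
    unfolding PI.emeasure_eq_measure by (subst (asm) ennreal_le_iff) auto
  moreover have "PI.prob {Y \<in> space ?N. \<not> vnorm F (ustat s Y) \<le> \<epsilon>} = 1 - PI.prob {Y \<in> space ?N. vnorm F (ustat s Y) \<le> \<epsilon>}"
    by (rule PI.prob_neg) measurable
  ultimately show "1 - 2 * exp (real (s div 2) * (2/3 * t\<^sup>2 * \<sigma>2 - t * \<epsilon>)) \<le> PI.prob {Y \<in> space ?N. vnorm F (ustat s Y) \<le> \<epsilon>}"
    unfolding m_def by linarith
qed

end

section \<open>The covariance operator\<close>

context centered_kernel_setting
begin

section \<open>Kernel sections, the centred embedding and its adjoint\<close>

abbreviation "ks \<equiv> ksec evl K"
abbreviation "Cov \<equiv> covariance_op P evl"

lemma evl_zero: "evl 0 x = 0"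
  using evl_scaleR[of 0 0 x] by simp

lemma inner_ks: "inner (ks x) (ks y) = K y x"
  using inner_ksec[of "ks x" y] by (simp add: evl_ksec)

lemma norm_ks: "(norm (ks x))\<^sup>2 \<le> \<kappa>"
  using K_bounded[of x] by (simp add: power2_norm_eq_inner inner_ks)

lemma kappa_nonneg: "0 \<le> \<kappa>"
  using norm_ks zero_le_power2 order_trans by blast

lemma norm_ks_le: "norm (ks x) \<le> sqrt \<kappa>"
  using norm_ks by (rule real_le_rsqrt)

text \<open>By the reproducing property the squared distance of two sections is
  \<open>K y y - K x y - K y x + K x x\<close>, so joint continuity of \<open>K\<close> carries
  over.\<close>

lemma continuous_ks: "continuous_on UNIV ks"
  unfolding continuous_on_def
proof
  fix x :: 'x
  have cK: "continuous_on UNIV (\<lambda>y. K (f y) (g y))" if "continuous_on UNIV f" "continuous_on UNIV g" for f g :: "'x \<Rightarrow> 'x"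
    using continuous_on_compose2[OF K_continuous continuous_on_Pair[OF that]] by simp
  have "continuous_on UNIV (\<lambda>y. sqrt (K y y - K x y - K y x + K x x))"
    by (intro continuous_intros cK)
  then have "((\<lambda>y. sqrt (K y y - K x y - K y x + K x x)) \<longlongrightarrow> 0) (at x)"
    by (auto simp: continuous_on_def dest: spec[of _ x])
  moreover have "dist (ks y) (ks x) = sqrt (K y y - K x y - K y x + K x x)" for y
    by (simp add: dist_norm norm_eq_sqrt_inner inner_diff_left inner_diff_right inner_ks)
  ultimately have "((\<lambda>y. dist (ks y) (ks x)) \<longlongrightarrow> 0) (at x)" by simp
  then show "(ks \<longlongrightarrow> ks x) (at x)" by (rule tendsto_dist_iff[THEN iffD2])
qed

lemma continuous_evl: "continuous_on UNIV (evl f)"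
proof -
  have "continuous_on UNIV (\<lambda>x. inner f (ks x))" by (intro continuous_intros continuous_ks)
  then show ?thesis by (simp add: inner_ksec)
qed

lemma measurable_evl [measurable]: "evl f \<in> borel_measurable P"
proof -
  have "evl f \<in> borel_measurable borel"
    by (rule borel_measurable_continuous_onI[OF continuous_evl])
  then show ?thesis using measurable_cong_sets[OF sets_P refl] by blast
qed

lemma evl_bound: "\<bar>evl f x\<bar> \<le> norm f * sqrt \<kappa>"
  using Cauchy_Schwarz_ineq2[of f "ks x"] mult_left_mono[OF norm_ks_le[of x] norm_ge_zero[of f]]
  by (simp add: inner_ksec)

lemma integrable_evl: "integrable P (evl f)"
  by (rule integrable_const_bound[where B = "norm f * sqrt \<kappa>"]) (auto simp: evl_bound)

lemma integrable_evl_mult: "integrable P (\<lambda>x. evl f x * evl g x)"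
proof (rule integrable_const_bound[where B = "(norm f * sqrt \<kappa>) * (norm g * sqrt \<kappa>)"])
  show "AE x in P. norm (evl f x * evl g x) \<le> (norm f * sqrt \<kappa>) * (norm g * sqrt \<kappa>)"
    by (auto simp: abs_mult kappa_nonneg intro!: mult_mono evl_bound)
qed simp

lemma measurable_centered [measurable]: "centered P evl f \<in> borel_measurable P"
  unfolding centered_def by measurable

lemma centered_add: "centered P evl (f + g) x = centered P evl f x + centered P evl g x"
  using integrable_evl by (simp add: centered_def evl_add)

lemma centered_scaleR: "centered P evl (c *\<^sub>R f) x = c * centered P evl f x"
  using integrable_evl by (simp add: centered_def evl_scaleR algebra_simps)

lemma centered_bound: "\<bar>centered P evl f x\<bar> \<le> 2 * sqrt \<kappa> * norm f"
proof -
  have "\<bar>\<integral>y. evl f y \<partial>P\<bar> \<le> (\<integral>y. \<bar>evl f y\<bar> \<partial>P)"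
    using integral_norm_bound[of P "evl f"] by simp
  also have "\<dots> \<le> (\<integral>y. norm f * sqrt \<kappa> \<partial>P)"
    by (intro integral_mono integrable_abs integrable_evl) (auto simp: evl_bound)
  finally have "\<bar>\<integral>y. evl f y \<partial>P\<bar> \<le> norm f * sqrt \<kappa>" by (simp add: prob_space)
  then show ?thesis using evl_bound[of f x] by (simp add: centered_def algebra_simps abs_le_iff)
qed

lemma centered_L2: "centered P evl f \<in> L2_set P"
  unfolding L2_set_def
proof (intro CollectI conjI)
  show "integrable P (\<lambda>x. (centered P evl f x)\<^sup>2)"
    by (rule integrable_const_bound[where B = "(2 * sqrt \<kappa> * norm f)\<^sup>2"])
      (auto intro!: AE_I2 simp flip: abs_le_square_iff, use centered_bound[of f] kappa_nonneg in simp)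
qed simp

lemma L2_integrable: "g \<in> L2_set P \<Longrightarrow> integrable P g"
  by (rule square_integrable_imp_integrable) (simp_all add: L2_set_def)

lemma integrable_centered_mult:
  assumes "g \<in> L2_set P"
  shows "integrable P (\<lambda>x. centered P evl f x * g x)"
proof (rule Bochner_Integration.integrable_bound)
  show "integrable P (\<lambda>x. (2 * sqrt \<kappa> * norm f) * g x)"
    using L2_integrable[OF assms] by simp
  show "(\<lambda>x. centered P evl f x * g x) \<in> borel_measurable P"
    using assms by (auto simp: L2_set_def)
  show "AE x in P. norm (centered P evl f x * g x) \<le> norm ((2 * sqrt \<kappa> * norm f) * g x)"
    using centered_bound[of f] kappa_nonneg by (auto simp: abs_mult intro!: AE_I2 mult_right_mono)
qed

text \<open>Centred elements are uniformly bounded by a multiple of their norm, so pairing with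
  \<open>g\<close> is a bounded functional; Riesz then shows that the definite description denotes
  the adjoint.\<close>

lemma inner_centered_adj:
  assumes g: "g \<in> L2_set P"
  shows "inner f (centered_adj P evl g) = L2_inner P (centered P evl f) g"
proof -
  have "bounded_linear (\<lambda>f. L2_inner P (centered P evl f) g)"
  proof (rule bounded_linear_intro)
    show "L2_inner P (centered P evl (f + f')) g = L2_inner P (centered P evl f) g + L2_inner P (centered P evl f') g" for f f'
      unfolding L2_inner_def centered_add
      using integrable_centered_mult[OF g] by (simp add: distrib_right)
    show "L2_inner P (centered P evl (c *\<^sub>R f)) g = c *\<^sub>R L2_inner P (centered P evl f) g" for c f
      unfolding L2_inner_def centered_scaleR by (simp add: mult.assoc)
    show "norm (L2_inner P (centered P evl f) g) \<le> norm f * (2 * sqrt \<kappa> * (\<integral>x. \<bar>g x\<bar> \<partial>P))" for f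
    proof -
      have "norm (L2_inner P (centered P evl f) g) \<le> (\<integral>x. \<bar>centered P evl f x * g x\<bar> \<partial>P)"
        unfolding L2_inner_def using integral_norm_bound[of P "\<lambda>x. centered P evl f x * g x"] by simp
      also have "\<dots> \<le> (\<integral>x. (2 * sqrt \<kappa> * norm f) * \<bar>g x\<bar> \<partial>P)"
      proof (rule integral_mono)
        show "integrable P (\<lambda>x. \<bar>centered P evl f x * g x\<bar>)"
          by (intro integrable_abs integrable_centered_mult g)
        show "integrable P (\<lambda>x. (2 * sqrt \<kappa> * norm f) * \<bar>g x\<bar>)"
          by (intro integrable_mult_right integrable_abs L2_integrable g)
      qed (auto simp: abs_mult intro!: mult_right_mono centered_bound)
      finally show ?thesis by (simp add: mult_ac)
    qed
  qed
  from theI'[OF riesz_representation[OF this]] show ?thesis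
    unfolding centered_adj_def L2_adjoint_def by blast
qed

text \<open>\<open>Blinfun\<close> has meaning only for bounded linear maps. Linearity is checked by
  testing against all \<open>g\<close>, the bound by testing against \<open>T f\<close>
  itself.\<close>

lemma covariance_apply: "blinfun_apply Cov f = centered_adj P evl (centered P evl f)"
proof -
  define T where "T f = centered_adj P evl (centered P evl f)" for f
  have T: "inner g (T f) = L2_inner P (centered P evl g) (centered P evl f)" for f g
    unfolding T_def by (rule inner_centered_adj[OF centered_L2])
  have "bounded_linear T"
  proof (rule bounded_linear_intro)
    show "T (f + f') = T f + T f'" for f f'
    proof (rule vector_eq_ldot[THEN iffD1], rule allI)
      fix g
      show "inner g (T (f + f')) = inner g (T f + T f')"
        using integrable_centered_mult[OF centered_L2]
        by (simp add: T inner_add_right L2_inner_def centered_add distrib_left)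
    qed
    show "T (c *\<^sub>R f) = c *\<^sub>R T f" for c f
    proof (rule vector_eq_ldot[THEN iffD1], rule allI)
      fix g
      show "inner g (T (c *\<^sub>R f)) = inner g (c *\<^sub>R T f)"
        by (simp add: T L2_inner_def centered_scaleR mult.left_commute)
    qed
    show "norm (T f) \<le> norm f * (4 * \<kappa>)" for f
    proof -
      have "norm (T f) * norm (T f) = L2_inner P (centered P evl (T f)) (centered P evl f)"
        by (simp flip: T power2_norm_eq_inner power2_eq_square)
      also have "\<dots> \<le> (\<integral>x. (2 * sqrt \<kappa> * norm (T f)) * (2 * sqrt \<kappa> * norm f) \<partial>P)"
        unfolding L2_inner_def
      proof (rule integral_mono)
        show "integrable P (\<lambda>x. centered P evl (T f) x * centered P evl f x)"
          by (rule integrable_centered_mult[OF centered_L2])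
        fix x
        have "centered P evl (T f) x * centered P evl f x \<le> \<bar>centered P evl (T f) x\<bar> * \<bar>centered P evl f x\<bar>"
          by (simp flip: abs_mult)
        also have "\<dots> \<le> (2 * sqrt \<kappa> * norm (T f)) * (2 * sqrt \<kappa> * norm f)"
          using kappa_nonneg by (intro mult_mono centered_bound) auto
        finally show "centered P evl (T f) x * centered P evl f x \<le> (2 * sqrt \<kappa> * norm (T f)) * (2 * sqrt \<kappa> * norm f)" .
      qed simp
      also have "\<dots> = (norm f * (4 * \<kappa>)) * norm (T f)"
        using kappa_nonneg by (simp add: prob_space mult_ac)
      finally show ?thesis by (cases "T f = 0") (auto simp: kappa_nonneg)
    qed
  qed
  then show ?thesis
    unfolding covariance_op_def T_def by (simp add: bounded_linear_Blinfun_apply)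
qed

lemma inner_covariance: "inner (blinfun_apply Cov f) g = L2_inner P (centered P evl f) (centered P evl g)"
  using inner_centered_adj[OF centered_L2, of g f]
  by (simp add: covariance_apply inner_commute L2_inner_def mult.commute)

lemma positive_covariance: "positive_op Cov"
  unfolding positive_op_def
proof (intro conjI allI)
  show "inner (blinfun_apply Cov f) g = inner f (blinfun_apply Cov g)" for f g
    using inner_covariance[of f g] inner_covariance[of g f]
    by (simp add: inner_commute[of f] L2_inner_def mult.commute)
  show "0 \<le> inner (blinfun_apply Cov f) f" for f
    by (simp add: inner_covariance L2_inner_def)
qed

text \<open>Passing to two independent copies removes the mean. This is the unbiasedness of the
  pairwise empirical covariance.\<close>

lemma inner_covariance_pair:
  "(\<integral>z. (evl f (fst z) - evl f (snd z)) * (evl g (fst z) - evl g (snd z)) / 2 \<partial>(P \<Otimes>\<^sub>M P)) =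
    inner (blinfun_apply Cov f) g"
proof -
  interpret PP: pair_prob_space P P ..
  define Ef Eg Efg where "Ef = (\<integral>x. evl f x \<partial>P)" and "Eg = (\<integral>x. evl g x \<partial>P)"
    and "Efg = (\<integral>x. evl f x * evl g x \<partial>P)"
  let ?h = "\<lambda>x y. (evl f x - evl f y) * (evl g x - evl g y) / 2"
  have [measurable]: "(\<lambda>z. ?h (fst z) (snd z)) \<in> borel_measurable (P \<Otimes>\<^sub>M P)" by measurable
  have "integrable (P \<Otimes>\<^sub>M P) (\<lambda>z. ?h (fst z) (snd z))"
  proof (rule PP.P.integrable_const_bound[where B = "(2 * (norm f * sqrt \<kappa>)) * (2 * (norm g * sqrt \<kappa>)) / 2"])
    have d: "\<bar>evl u x - evl u y\<bar> \<le> 2 * (norm u * sqrt \<kappa>)" for u x y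
      using evl_bound[of u x] evl_bound[of u y] by linarith
    show "AE z in P \<Otimes>\<^sub>M P. norm (?h (fst z) (snd z)) \<le> (2 * (norm f * sqrt \<kappa>)) * (2 * (norm g * sqrt \<kappa>)) / 2"
      using kappa_nonneg unfolding real_norm_def abs_divide abs_mult
      by (intro AE_I2 divide_mono mult_mono d) auto
  qed simp
  then have "(\<integral>z. ?h (fst z) (snd z) \<partial>(P \<Otimes>\<^sub>M P)) = (\<integral>x. \<integral>y. ?h x y \<partial>P \<partial>P)"
    using PP.integral_fst[of ?h] by (simp add: split_beta')
  also have "(\<lambda>x. \<integral>y. ?h x y \<partial>P) = (\<lambda>x. (evl f x * evl g x - evl f x * Eg - evl g x * Ef + Efg) / 2)"
  proof
    fix x
    have "(\<integral>y. ?h x y \<partial>P) = (\<integral>y. (evl f x * evl g x - evl f x * evl g y - evl g x * evl f y + evl f y * evl g y) / 2 \<partial>P)"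
      by (intro Bochner_Integration.integral_cong refl) (simp add: algebra_simps)
    then show "(\<integral>y. ?h x y \<partial>P) = (evl f x * evl g x - evl f x * Eg - evl g x * Ef + Efg) / 2"
      using integrable_evl integrable_evl_mult by (simp add: Ef_def Eg_def Efg_def prob_space)
  qed
  also have "(\<integral>x. (evl f x * evl g x - evl f x * Eg - evl g x * Ef + Efg) / 2 \<partial>P) = Efg - Ef * Eg"
    using integrable_evl integrable_evl_mult by (simp add: Ef_def[symmetric] Eg_def[symmetric] Efg_def[symmetric] prob_space)
  also have "\<dots> = inner (blinfun_apply Cov f) g"
  proof -
    have "inner (blinfun_apply Cov f) g = (\<integral>x. evl f x * evl g x - evl f x * Eg - evl g x * Ef + Ef * Eg \<partial>P)"
      unfolding inner_covariance L2_inner_def centered_def Ef_def Eg_def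
      by (intro Bochner_Integration.integral_cong refl) (simp add: algebra_simps)
    also have "\<dots> = Efg - Ef * Eg"
      using integrable_evl integrable_evl_mult by (simp add: Ef_def[symmetric] Eg_def[symmetric] Efg_def[symmetric] prob_space)
    finally show ?thesis by simp
  qed
  finally show ?thesis .
qed

text \<open>Each basis vector is a nonzero continuous function, hence nonzero somewhere on a
  countable dense set; and by Parseval each kernel section has only countably many nonzero
  coefficients.\<close>

lemma countable_onb: "countable (onb :: 'h set)"
proof -
  obtain D :: "'x set" where D: "countable D" "\<And>X. open X \<Longrightarrow> X \<noteq> {} \<Longrightarrow> \<exists>d\<in>D. d \<in> X"
    using countable_dense_exists[where 'a='x] by blast
  have "onb \<subseteq> (\<Union>x\<in>D. {e\<in>onb. (inner (ks x) e)\<^sup>2 \<noteq> 0})"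
  proof
    fix e :: 'h assume e: "e \<in> onb"
    then have "e \<noteq> 0" using orthonormal_onb by (auto simp: orthonormal_def)
    have "{x. evl e x \<noteq> 0} \<noteq> {}"
    proof
      assume "{x. evl e x \<noteq> 0} = {}"
      then have "evl e = evl 0" by (auto simp: evl_zero)
      then show False using evl_inj \<open>e \<noteq> 0\<close> by (auto dest: injD)
    qed
    moreover have "open {x. evl e x \<noteq> 0}"
      by (intro open_Collect_neq continuous_evl continuous_intros)
    ultimately obtain x where "x \<in> D" "evl e x \<noteq> 0" using D(2) by blast
    then show "e \<in> (\<Union>x\<in>D. {e\<in>onb. (inner (ks x) e)\<^sup>2 \<noteq> 0})"
      using e inner_ksec[of e x] by (auto simp: inner_commute[of _ e] intro!: bexI[of _ x])
  qed
  moreover have "countable (\<Union>x\<in>D. {e\<in>onb. (inner (ks x) e)\<^sup>2 \<noteq> 0})"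
  proof (intro countable_UN D(1))
    fix x
    have "(\<lambda>e. (inner (ks x) e)\<^sup>2) summable_on onb"
      using parseval_onb[of "ks x"] by (auto simp: summable_on_def)
    then show "countable {e\<in>onb. (inner (ks x) e)\<^sup>2 \<noteq> 0}"
      by (rule summable_countable_real)
  qed
  ultimately show ?thesis by (rule countable_subset)
qed

text \<open>A countable chain cofinal among the finite subsets of the basis, along which suprema
  over finite subsets become limits of sequences.\<close>

definition trunc :: "nat \<Rightarrow> 'h set" where
  "trunc n = {e \<in> onb. to_nat_on onb e < n}"

lemma finite_trunc: "finite (trunc n)"
proof (rule inj_on_finite)
  show "inj_on (to_nat_on onb) (trunc n)"
    by (rule inj_on_subset[OF inj_on_to_nat_on[OF countable_onb]]) (auto simp: trunc_def)
  show "to_nat_on onb ` trunc n \<subseteq> {..<n}" by (auto simp: trunc_def)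
qed simp

lemma trunc_subset: "trunc n \<subseteq> onb"
  by (auto simp: trunc_def)

lemma trunc_mono: "m \<le> n \<Longrightarrow> trunc m \<subseteq> trunc n"
  by (auto simp: trunc_def)

lemma finite_subset_trunc:
  assumes "finite F" "F \<subseteq> onb"
  shows "\<exists>n. F \<subseteq> trunc n"
proof -
  obtain n where "\<forall>i\<in>to_nat_on onb ` F. i < n"
    using finite_nat_set_iff_bounded[of "to_nat_on onb ` F"] assms(1) by blast
  then show ?thesis using assms(2) by (auto simp: trunc_def intro!: exI[of _ n])
qed

lemma filterlim_trunc: "filterlim trunc (finite_subsets_at_top onb) sequentially"
  unfolding filterlim_iff eventually_finite_subsets_at_top
proof safe
  fix Q and F :: "'h set" assume F: "finite F" "F \<subseteq> onb"
    and Q: "\<forall>Y. finite Y \<and> F \<subseteq> Y \<and> Y \<subseteq> onb \<longrightarrow> Q Y"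
  obtain m where "F \<subseteq> trunc m" using finite_subset_trunc[OF F] by blast
  then have "Q (trunc n)" if "m \<le> n" for n
    using Q finite_trunc[of n] trunc_subset[of n] trunc_mono[OF that] by blast
  then show "\<forall>\<^sub>F n in sequentially. Q (trunc n)"
    by (auto simp: eventually_sequentially)
qed

end

section \<open>The whitened kernel sections\<close>

text \<open>Choice of the free parameter, with \<open>n = sqrt N1\<close> and
  \<open>q = L R / s\<close>. In terms of \<open>y = \<tau> n\<close> the right side is
  \<open>y\<close> times the constant in \<open>c\<close>, minus \<open>2/3 y^2\<close>; and
  \<open>q \<le> 1/(16 c)\<close> bounds that constant below by
  \<open>16 sqrt 2 q + 2 sqrt 2 sqrt q\<close>. The lower bound on \<open>n\<close> turns
  \<open>sqrt 2 y \<le> 1/4\<close> into \<open>\<tau> \<le> 1/4\<close>.\<close>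

lemma exponent_choice:
  fixes n q c :: real
  assumes n: "1/2 \<le> n\<^sup>2" "0 < n" and q: "0 < q" and c: "0 < c" "16 * c * q \<le> 1"
  shows "\<exists>\<tau>. 0 \<le> \<tau> \<and> \<tau> \<le> 1/4 \<and> 3 * q \<le> \<tau> * ((sqrt 2 / c + 1 / sqrt (2 * c)) * n) - 2/3 * \<tau>\<^sup>2 * n\<^sup>2"
proof -
  define r where "r = sqrt q"
  define w where "w = (sqrt 2 :: real)"
  have r: "r > 0" "q = r\<^sup>2" using q by (auto simp: r_def)
  have w: "w > 0" "w * w = 2" by (auto simp: w_def)
  have wn: "1 \<le> w * n"
  proof (rule power2_le_imp_le)
    show "1\<^sup>2 \<le> (w * n)\<^sup>2" using n(1) w(2) by (simp add: power_mult_distrib power2_eq_square[of w])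
  qed (use w n in auto)
  have c1: "16 * r\<^sup>2 \<le> 1 / c" using c r by (simp add: field_simps)
  have "2 * w * r \<le> 1 / sqrt (2 * c)"
  proof (rule power2_le_imp_le)
    have "(2 * w * r)\<^sup>2 = 8 * r\<^sup>2" using w(2) by (simp add: power_mult_distrib power2_eq_square)
    also have "\<dots> \<le> 1 / (2 * c)" using c1 c(1) by (simp add: field_simps)
    finally show "(2 * w * r)\<^sup>2 \<le> (1 / sqrt (2 * c))\<^sup>2" using c(1) by (simp add: power_divide)
  qed (use c in auto)
  moreover have "w * (16 * r\<^sup>2) \<le> sqrt 2 / c"
    using mult_left_mono[OF c1, of w] w by (simp add: w_def)
  ultimately have eps: "16 * w * r\<^sup>2 + 2 * w * r \<le> sqrt 2 / c + 1 / sqrt (2 * c)" by linarith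
  have key: ?thesis if y: "0 \<le> y" "w * y \<le> 1/4"
    and le: "3 * r\<^sup>2 \<le> y * (16 * w * r\<^sup>2 + 2 * w * r) - 2/3 * y\<^sup>2" for y
  proof (intro exI[of _ "y / n"] conjI)
    show "0 \<le> y / n" using y n by simp
    have "y \<le> (w * n) * y" using mult_right_mono[OF wn y(1)] by simp
    also have "\<dots> = (w * y) * n" by simp
    also have "\<dots> \<le> 1/4 * n" using n by (intro mult_right_mono y) auto
    finally show "y / n \<le> 1/4" using n by (simp add: field_simps)
    have "y * (16 * w * r\<^sup>2 + 2 * w * r) \<le> y * (sqrt 2 / c + 1 / sqrt (2 * c))"
      by (intro mult_left_mono eps y)
    then have "3 * q \<le> y * (sqrt 2 / c + 1 / sqrt (2 * c)) - 2/3 * y\<^sup>2"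
      using le r by linarith
    then show "3 * q \<le> y / n * ((sqrt 2 / c + 1 / sqrt (2 * c)) * n) - 2/3 * (y / n)\<^sup>2 * n\<^sup>2"
      using n by (simp add: power_divide)
  qed
  show ?thesis
  proof (cases "r \<le> 1/12")
    case True
    show ?thesis
    \<comment> \<open>The unconstrained maximiser of \<open>2 w r y - 2/3 y^2\<close>, with value
      \<open>3 r^2\<close>; it is admissible exactly for \<open>r \<le> 1/12\<close>.\<close>
    proof (rule key[of "3/2 * w * r"])
      show "0 \<le> 3/2 * w * r" using w r by simp
      have "w * (3/2 * w * r) = 3/2 * (w * w) * r" by simp
      then show "w * (3/2 * w * r) \<le> 1/4" using w True by simp
      have "(3/2 * w * r)\<^sup>2 = 9/4 * (w * w) * r\<^sup>2" by (simp add: power2_eq_square)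
      moreover have "(3/2 * w * r) * (16 * w * r\<^sup>2 + 2 * w * r) = 24 * (w * w) * (r * r\<^sup>2) + 3 * (w * w) * r\<^sup>2"
        by (simp add: algebra_simps power2_eq_square)
      moreover have "0 \<le> r * r\<^sup>2" using r by simp
      ultimately show "3 * r\<^sup>2 \<le> (3/2 * w * r) * (16 * w * r\<^sup>2 + 2 * w * r) - 2/3 * (3/2 * w * r)\<^sup>2"
        unfolding w(2) by linarith
    qed
  next
    case False
    show ?thesis
    \<comment> \<open>The endpoint of the constraint \<open>w y \<le> 1/4\<close>, which is active
      for larger \<open>r\<close>.\<close>
    proof (rule key[of "w / 8"])
      show "0 \<le> w / 8" using w by simp
      show "w * (w / 8) \<le> 1/4" using w by simp
      have "(w / 8)\<^sup>2 = (w * w) / 64" by (simp add: power2_eq_square)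
      moreover have "(w / 8) * (16 * w * r\<^sup>2 + 2 * w * r) = 2 * (w * w) * r\<^sup>2 + (w * w) * r / 4"
        by (simp add: algebra_simps power2_eq_square)
      ultimately show "3 * r\<^sup>2 \<le> (w / 8) * (16 * w * r\<^sup>2 + 2 * w * r) - 2/3 * (w / 8)\<^sup>2"
        unfolding w(2) using False zero_le_power2[of r] by linarith
    qed
  qed
qed

context centered_kernel_setting
begin

section \<open>Moments of the whitened differences\<close>

definition whitened :: "real \<Rightarrow> 'x \<times> 'x \<Rightarrow> 'h" where
  "whitened l z = blinfun_apply (inv_sqrt_reg Cov l) (ks (fst z) - ks (snd z))"

definition whitened_cov :: "real \<Rightarrow> ('h \<Rightarrow>\<^sub>L 'h)" where
  "whitened_cov l = inv_sqrt_reg Cov l o\<^sub>L Cov o\<^sub>L inv_sqrt_reg Cov l"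

context
  fixes l :: real
  assumes l: "0 < l"
begin

lemma inv_sqrt_adj:
  "inner (blinfun_apply (inv_sqrt_reg Cov l) f) g = inner f (blinfun_apply (inv_sqrt_reg Cov l) g)"
  by (rule selfadjointD[OF inv_sqrt_reg_selfadjoint[OF positive_covariance l]])

lemma inner_whitened:
  "inner (whitened l z) f =
    evl (blinfun_apply (inv_sqrt_reg Cov l) f) (fst z) - evl (blinfun_apply (inv_sqrt_reg Cov l) f) (snd z)"
  unfolding whitened_def inv_sqrt_adj
  by (simp add: inner_diff_left inner_diff_right inner_ksec inner_commute[of "ks _"])

lemma measurable_inner_whitened [measurable]:
  "(\<lambda>z. inner (whitened l z) f) \<in> borel_measurable (P \<Otimes>\<^sub>M P)"
  unfolding inner_whitened by measurable

lemma trunc_sum_tendsto: "(\<lambda>n. \<Sum>e\<in>trunc n. (inner v e)\<^sup>2) \<longlonglongrightarrow> (norm v)\<^sup>2"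
  using parseval_onb[of v] filterlim_compose[OF _ filterlim_trunc] unfolding has_sum_def by blast

text \<open>Measurability is at hand for scalar coordinates; the squared norm is the limit of their
  truncated sums of squares.\<close>

lemma measurable_norm_whitened [measurable]:
  "(\<lambda>z. (norm (whitened l z))\<^sup>2) \<in> borel_measurable (P \<Otimes>\<^sub>M P)"
  by (rule borel_measurable_LIMSEQ_real[OF trunc_sum_tendsto]) measurable

lemma norm_whitened_bound: "(norm (whitened l z))\<^sup>2 \<le> 4 * \<kappa> / l"
proof -
  have "norm (ks (fst z) - ks (snd z)) \<le> 2 * sqrt \<kappa>"
    using norm_triangle_ineq4[of "ks (fst z)" "ks (snd z)"] norm_ks_le[of "fst z"] norm_ks_le[of "snd z"]
    by linarith
  then have "(norm (ks (fst z) - ks (snd z)))\<^sup>2 \<le> (2 * sqrt \<kappa>)\<^sup>2" by (rule power_mono) simp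
  then have "(norm (ks (fst z) - ks (snd z)))\<^sup>2 / l \<le> 4 * \<kappa> / l"
    using l kappa_nonneg by (intro divide_right_mono) (auto simp: power_mult_distrib)
  then show ?thesis
    unfolding whitened_def using norm_inv_sqrt_reg_le[OF positive_covariance l] order_trans by blast
qed

lemma integrable_whitened_mult:
  "integrable (P \<Otimes>\<^sub>M P) (\<lambda>z. inner (whitened l z) f * inner (whitened l z) g)"
proof -
  interpret PP: pair_prob_space P P ..
  show ?thesis
  proof (rule PP.P.integrable_const_bound[where B = "4 * \<kappa> / l * (norm f * norm g)"])
    show "AE z in P \<Otimes>\<^sub>M P. norm (inner (whitened l z) f * inner (whitened l z) g) \<le> 4 * \<kappa> / l * (norm f * norm g)"
    proof (rule AE_I2)
      fix z
      have "norm (inner (whitened l z) f * inner (whitened l z) g) \<le>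
          (norm (whitened l z) * norm f) * (norm (whitened l z) * norm g)"
        by (simp add: abs_mult mult_mono Cauchy_Schwarz_ineq2)
      also have "\<dots> = (norm (whitened l z))\<^sup>2 * (norm f * norm g)" by (simp add: power2_eq_square)
      also have "\<dots> \<le> 4 * \<kappa> / l * (norm f * norm g)"
        by (intro mult_right_mono norm_whitened_bound) auto
      finally show "norm (inner (whitened l z) f * inner (whitened l z) g) \<le> 4 * \<kappa> / l * (norm f * norm g)" .
    qed
  qed measurable
qed

lemma integrable_norm_whitened: "integrable (P \<Otimes>\<^sub>M P) (\<lambda>z. (norm (whitened l z))\<^sup>2)"
proof -
  interpret PP: pair_prob_space P P ..
  show ?thesis
    by (rule PP.P.integrable_const_bound[where B = "4 * \<kappa> / l"]) (auto simp: norm_whitened_bound)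
qed

lemma inner_whitened_cov:
  "inner (blinfun_apply (whitened_cov l) f) g =
    (\<integral>z. inner (whitened l z) f * inner (whitened l z) g / 2 \<partial>(P \<Otimes>\<^sub>M P))"
  unfolding inner_whitened inner_covariance_pair by (simp add: whitened_cov_def inv_sqrt_adj)

lemma positive_whitened_cov: "positive_op (whitened_cov l)"
proof (rule positive_opI)
  show "selfadjoint (whitened_cov l)"
    unfolding whitened_cov_def
    by (intro selfadjoint_conj inv_sqrt_reg_selfadjoint positive_op_selfadjoint positive_covariance l)
  show "0 \<le> inner (blinfun_apply (whitened_cov l) f) f" for f
    unfolding inner_whitened_cov by (intro integral_nonneg_AE AE_I2) simp
qed

lemma sum_whitened_cov:
  assumes "finite F"
  shows "(\<Sum>e\<in>F. inner (blinfun_apply (whitened_cov l) e) e) =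
    (\<integral>z. (\<Sum>e\<in>F. (inner (whitened l z) e)\<^sup>2) / 2 \<partial>(P \<Otimes>\<^sub>M P))"
proof -
  have "(\<integral>z. (\<Sum>e\<in>F. (inner (whitened l z) e)\<^sup>2) / 2 \<partial>(P \<Otimes>\<^sub>M P)) =
      (\<integral>z. (\<Sum>e\<in>F. inner (whitened l z) e * inner (whitened l z) e / 2) \<partial>(P \<Otimes>\<^sub>M P))"
    by (simp add: sum_divide_distrib power2_eq_square)
  also have "\<dots> = (\<Sum>e\<in>F. inner (blinfun_apply (whitened_cov l) e) e)"
    unfolding inner_whitened_cov
    by (intro Bochner_Integration.integral_sum integrable_divide_zero impI integrable_whitened_mult)
  finally show ?thesis by simp
qed

lemma sum_whitened_cov_le:
  assumes "finite F" "orthonormal F"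
  shows "(\<Sum>e\<in>F. inner (blinfun_apply (whitened_cov l) e) e) \<le> (\<integral>z. (norm (whitened l z))\<^sup>2 / 2 \<partial>(P \<Otimes>\<^sub>M P))"
  unfolding sum_whitened_cov[OF assms(1)]
proof (rule integral_mono)
  show "integrable (P \<Otimes>\<^sub>M P) (\<lambda>z. (\<Sum>e\<in>F. (inner (whitened l z) e)\<^sup>2) / 2)"
    unfolding power2_eq_square
    by (intro integrable_divide_zero impI Bochner_Integration.integrable_sum integrable_whitened_mult)
  show "integrable (P \<Otimes>\<^sub>M P) (\<lambda>z. (norm (whitened l z))\<^sup>2 / 2)"
    using integrable_norm_whitened by simp
qed (intro divide_right_mono bessel_finite assms, simp)

lemma whitened_cov_trace_summable:
  "(\<lambda>e. inner (blinfun_apply (whitened_cov l) e) e) summable_on onb"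
  by (rule nonneg_bdd_above_summable_on)
    (auto intro!: bdd_aboveI sum_whitened_cov_le positive_op_nonneg[OF positive_whitened_cov]
      orthonormal_subset[OF orthonormal_onb])

lemma N1_eq: "N1 Cov l = (\<Sum>\<^sub>\<infinity>e\<in>onb. inner (blinfun_apply (whitened_cov l) e) e)"
  by (simp add: N1_def trace_op_def whitened_cov_def)

lemma N1_upper: "N1 Cov l \<le> (\<integral>z. (norm (whitened l z))\<^sup>2 / 2 \<partial>(P \<Otimes>\<^sub>M P))"
  unfolding N1_eq
  by (intro infsum_le_finite_sums whitened_cov_trace_summable sum_whitened_cov_le orthonormal_subset[OF orthonormal_onb])

lemma sum_le_N1:
  assumes "finite F" "F \<subseteq> onb"
  shows "(\<Sum>e\<in>F. inner (blinfun_apply (whitened_cov l) e) e) \<le> N1 Cov l"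
  unfolding N1_eq
  by (rule finite_sum_le_infsum[OF whitened_cov_trace_summable assms])
    (rule positive_op_nonneg[OF positive_whitened_cov])

text \<open>Together with \<open>N1_upper\<close> this identifies \<open>N1\<close> with half the
  second moment of the whitened difference: Bessel gives one direction, Parseval with dominated
  convergence the other. The integral refers to no basis, so it also controls traces over other
  orthonormal systems.\<close>

lemma N1_lower: "(\<integral>z. (norm (whitened l z))\<^sup>2 / 2 \<partial>(P \<Otimes>\<^sub>M P)) \<le> N1 Cov l"
proof (rule LIMSEQ_le_const2)
  show "(\<lambda>n. \<integral>z. (\<Sum>e\<in>trunc n. (inner (whitened l z) e)\<^sup>2) / 2 \<partial>(P \<Otimes>\<^sub>M P)) \<longlonglongrightarrow>
      (\<integral>z. (norm (whitened l z))\<^sup>2 / 2 \<partial>(P \<Otimes>\<^sub>M P))"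
  proof (rule integral_dominated_convergence[where w = "\<lambda>z. (norm (whitened l z))\<^sup>2 / 2"])
    show "integrable (P \<Otimes>\<^sub>M P) (\<lambda>z. (norm (whitened l z))\<^sup>2 / 2)"
      using integrable_norm_whitened by simp
    show "AE z in P \<Otimes>\<^sub>M P. (\<lambda>n. (\<Sum>e\<in>trunc n. (inner (whitened l z) e)\<^sup>2) / 2) \<longlonglongrightarrow> (norm (whitened l z))\<^sup>2 / 2"
      by (intro AE_I2 tendsto_divide trunc_sum_tendsto tendsto_const) simp
    show "AE z in P \<Otimes>\<^sub>M P. norm ((\<Sum>e\<in>trunc n. (inner (whitened l z) e)\<^sup>2) / 2) \<le> (norm (whitened l z))\<^sup>2 / 2" for n
      using bessel_finite[OF orthonormal_subset[OF orthonormal_onb trunc_subset] finite_trunc]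
      by (intro AE_I2) (simp add: sum_nonneg)
  qed measurable
  show "\<exists>N. \<forall>n\<ge>N. (\<integral>z. (\<Sum>e\<in>trunc n. (inner (whitened l z) e)\<^sup>2) / 2 \<partial>(P \<Otimes>\<^sub>M P)) \<le> N1 Cov l"
    using sum_le_N1[OF finite_trunc trunc_subset] sum_whitened_cov[OF finite_trunc] by simp
qed

lemma whitened_cov_le_N1: "inner (blinfun_apply (whitened_cov l) f) f \<le> N1 Cov l * (norm f)\<^sup>2"
proof -
  have "inner (blinfun_apply (whitened_cov l) f) f \<le> (\<integral>z. (norm (whitened l z))\<^sup>2 / 2 * (norm f)\<^sup>2 \<partial>(P \<Otimes>\<^sub>M P))"
    unfolding inner_whitened_cov
  proof (rule integral_mono)
    show "integrable (P \<Otimes>\<^sub>M P) (\<lambda>z. inner (whitened l z) f * inner (whitened l z) f / 2)"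
      using integrable_whitened_mult by simp
    show "integrable (P \<Otimes>\<^sub>M P) (\<lambda>z. (norm (whitened l z))\<^sup>2 / 2 * (norm f)\<^sup>2)"
      using integrable_norm_whitened by simp
    fix z
    have "(inner (whitened l z) f)\<^sup>2 \<le> (norm (whitened l z))\<^sup>2 * (norm f)\<^sup>2"
      using Cauchy_Schwarz_ineq[of "whitened l z" f] by (simp add: power2_norm_eq_inner)
    then show "inner (whitened l z) f * inner (whitened l z) f / 2 \<le> (norm (whitened l z))\<^sup>2 / 2 * (norm f)\<^sup>2"
      by (simp add: power2_eq_square)
  qed
  also have "\<dots> = (\<integral>z. (norm (whitened l z))\<^sup>2 / 2 \<partial>(P \<Otimes>\<^sub>M P)) * (norm f)\<^sup>2"
    by simp
  also have "\<dots> \<le> N1 Cov l * (norm f)\<^sup>2"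
    by (intro mult_right_mono N1_lower) simp
  finally show ?thesis .
qed

text \<open>A trace \<open>N < 1/2\<close> would bound the whitened form by \<open>N\<close>;
  undoing the whitening gives \<Sigma> \<le> N (\<Sigma> + l), so \<Sigma> \<le> N l / (1 - N) < l.
  Spectrally, the top eigenvalue alone contributes at least 1/2.\<close>

lemma N1_ge_half:
  assumes "l \<le> norm Cov"
  shows "1/2 \<le> N1 Cov l"
proof (rule ccontr)
  assume "\<not> 1/2 \<le> N1 Cov l"
  then have N: "N1 Cov l < 1/2" by simp
  define N where "N = N1 Cov l"
  have "0 \<le> (\<integral>z. (norm (whitened l z))\<^sup>2 / 2 \<partial>(P \<Otimes>\<^sub>M P))" by (intro integral_nonneg_AE AE_I2) simp
  then have N0: "0 \<le> N" "N < 1/2" using N1_lower N unfolding N_def by linarith+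
  define S where "S = sqrt_op (regularize Cov l)"
  have adjS: "inner (blinfun_apply S f) g = inner f (blinfun_apply S g)" for f g
    unfolding S_def by (rule selfadjointD[OF sqrt_reg_selfadjoint[OF positive_covariance l]])
  have "inner (blinfun_apply Cov g) g \<le> (N * l / (1 - N)) * (norm g)\<^sup>2" for g
  proof -
    have "inner (blinfun_apply Cov g) g = inner (blinfun_apply (whitened_cov l) (blinfun_apply S g)) (blinfun_apply S g)"
      by (simp add: whitened_cov_def inv_sqrt_adj S_def inv_sqrt_reg_apply[OF positive_covariance l])
    also have "\<dots> \<le> N * (norm (blinfun_apply S g))\<^sup>2"
      unfolding N_def by (rule whitened_cov_le_N1)
    also have "(norm (blinfun_apply S g))\<^sup>2 = inner g (blinfun_apply S (blinfun_apply S g))"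
      by (simp add: power2_norm_eq_inner adjS)
    also have "\<dots> = inner (blinfun_apply Cov g) g + l * (norm g)\<^sup>2"
      unfolding S_def sqrt_reg_apply2[OF positive_covariance l]
      by (simp add: inner_add_right inner_commute power2_norm_eq_inner)
    finally have "inner (blinfun_apply Cov g) g * (1 - N) \<le> N * l * (norm g)\<^sup>2"
      by (simp add: algebra_simps)
    then show ?thesis using N0 by (simp add: field_simps)
  qed
  then have "norm Cov \<le> N * l / (1 - N)"
    using N0 l by (intro positive_op_norm_le positive_covariance) auto
  moreover have "N * l / (1 - N) < l"
  proof -
    have "N * l < l * (1 - N)" using N0 l mult_strict_right_mono[of N "1 - N" l] by (simp add: mult.commute)
    then show ?thesis using N0 by (simp add: divide_less_eq)
  qed
  ultimately show False using assms by linarith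
qed

text \<open>Cauchy-Schwarz for a positive form bounds each squared entry by the product of two
  diagonal entries, so the Hilbert-Schmidt norm is at most the trace.\<close>

lemma whitened_cov_square_sum:
  assumes "finite F" "F \<subseteq> onb"
  shows "(\<Sum>e\<in>F. \<Sum>e'\<in>F. (inner (blinfun_apply (whitened_cov l) e) e')\<^sup>2) \<le> (N1 Cov l)\<^sup>2"
proof -
  define a where "a e = inner (blinfun_apply (whitened_cov l) e) e" for e
  have a0: "0 \<le> a e" for e unfolding a_def by (rule positive_op_nonneg[OF positive_whitened_cov])
  have "(\<Sum>e\<in>F. \<Sum>e'\<in>F. (inner (blinfun_apply (whitened_cov l) e) e')\<^sup>2) \<le> (\<Sum>e\<in>F. \<Sum>e'\<in>F. a e * a e')"
    unfolding a_def by (intro sum_mono positive_op_Cauchy_Schwarz positive_whitened_cov)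
  also have "\<dots> = (\<Sum>e\<in>F. a e)\<^sup>2" by (simp add: power2_eq_square sum_product)
  also have "\<dots> \<le> (N1 Cov l)\<^sup>2"
    using sum_le_N1[OF assms] a0 by (intro power_mono) (auto simp: a_def intro: sum_nonneg)
  finally show ?thesis .
qed

end

end

section \<open>Concentration of the empirical covariance operator\<close>

context centered_kernel_setting
begin

definition cov_deviation :: "real \<Rightarrow> 'x \<Rightarrow> 'x \<Rightarrow> 'h \<times> 'h \<Rightarrow> real" where
  "cov_deviation l x y j = inner (whitened l (x, y)) (fst j) * inner (whitened l (x, y)) (snd j) / 2 -
    inner (blinfun_apply (whitened_cov l) (fst j)) (snd j)"

context
  fixes l :: real
  assumes l: "0 < l"
begin

text \<open>The rank-one part has norm at most \<open>R\<close> and its mean at most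
  \<open>N1 \<le> R\<close>, whence \<open>2 * R\<close>. Subtracting the mean only lowers the
  second moment, and the squared norm of the rank-one part is at most \<open>R\<close> times its
  norm, whose expectation is at most \<open>N1\<close>.\<close>

lemma centred_pair_kernel_cov_deviation:
  assumes R: "AE z in P \<Otimes>\<^sub>M P. (norm (whitened l z))\<^sup>2 / 2 \<le> R"
    and F: "finite F" "F \<subseteq> onb" and t: "0 \<le> t" "t * (2 * R) \<le> 1/2"
  shows "centred_pair_kernel P (cov_deviation l) (F \<times> F) (2 * R) (R * N1 Cov l) t"
proof -
  interpret PP: pair_prob_space P P ..
  let ?G = "\<lambda>j. inner (blinfun_apply (whitened_cov l) (fst j)) (snd j)"
  let ?\<xi> = "\<lambda>z j. inner (whitened l z) (fst j) * inner (whitened l z) (snd j) / 2"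
  have dev: "cov_deviation l (fst z) (snd z) j = ?\<xi> z j - ?G j" for z j
    by (simp add: cov_deviation_def)
  have m\<xi> [measurable]: "(\<lambda>z. ?\<xi> z j) \<in> borel_measurable (P \<Otimes>\<^sub>M P)" for j
    using l by measurable
  have i\<xi>: "integrable (P \<Otimes>\<^sub>M P) (\<lambda>z. ?\<xi> z j)" for j
    using integrable_whitened_mult[OF l] by simp
  have E\<xi>: "(\<integral>z. ?\<xi> z j \<partial>(P \<Otimes>\<^sub>M P)) = ?G j" for j
    by (simp add: inner_whitened_cov[OF l])
  have F': "orthonormal F" by (rule orthonormal_subset[OF orthonormal_onb F(2)])
  \<comment> \<open>The entries of a rank-one tensor factorise, so the double sum is the square of a
    single one.\<close>
  have n\<xi>2: "(\<Sum>j\<in>F \<times> F. (?\<xi> z j)\<^sup>2) = ((\<Sum>e\<in>F. (inner (whitened l z) e)\<^sup>2) / 2)\<^sup>2" for z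
    by (simp add: sum.cartesian_product' power_divide power_mult_distrib sum_product
        power2_eq_square[of "\<Sum>e\<in>F. (inner (whitened l z) e)\<^sup>2"] flip: sum_divide_distrib)
  have n\<xi>: "vnorm (F \<times> F) (?\<xi> z) = (\<Sum>e\<in>F. (inner (whitened l z) e)\<^sup>2) / 2" for z
    unfolding L2_Norm.L2_set_def n\<xi>2 by (simp add: sum_nonneg)
  have le_half: "(\<Sum>e\<in>F. (inner (whitened l z) e)\<^sup>2) / 2 \<le> (norm (whitened l z))\<^sup>2 / 2" for z
    by (intro divide_right_mono bessel_finite F F') simp
  have N1R: "N1 Cov l \<le> R"
  proof -
    have "N1 Cov l \<le> (\<integral>z. (norm (whitened l z))\<^sup>2 / 2 \<partial>(P \<Otimes>\<^sub>M P))" by (rule N1_upper[OF l])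
    also have "\<dots> \<le> (\<integral>z. R \<partial>(P \<Otimes>\<^sub>M P))"
      using integrable_norm_whitened[OF l] R by (intro integral_mono_AE) auto
    finally show ?thesis by (simp add: PP.P.prob_space)
  qed
  have N10: "0 \<le> N1 Cov l"
    using sum_le_N1[OF l, of "{}"] by simp
  show ?thesis
  proof
    show "finite (F \<times> F)" using F by simp
    show "(\<lambda>z. cov_deviation l (fst z) (snd z) j) \<in> borel_measurable (P \<Otimes>\<^sub>M P)" for j
      unfolding dev by measurable
    show "(\<integral>z. cov_deviation l (fst z) (snd z) j \<partial>(P \<Otimes>\<^sub>M P)) = 0" for j
      unfolding dev using i\<xi> E\<xi> by (simp add: PP.P.prob_space)
    show "AE z in P \<Otimes>\<^sub>M P. vnorm (F \<times> F) (cov_deviation l (fst z) (snd z)) \<le> 2 * R"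
      using R
    proof eventually_elim
      case (elim z)
      have "vnorm (F \<times> F) (cov_deviation l (fst z) (snd z)) = vnorm (F \<times> F) (\<lambda>j. ?\<xi> z j + - ?G j)"
        by (rule L2_set_cong) (simp_all add: dev)
      also have "\<dots> \<le> vnorm (F \<times> F) (?\<xi> z) + vnorm (F \<times> F) (\<lambda>j. - ?G j)"
        by (rule L2_set_triangle_ineq)
      also have "vnorm (F \<times> F) (?\<xi> z) \<le> R"
        unfolding n\<xi> using le_half elim order_trans by blast
      also have "vnorm (F \<times> F) (\<lambda>j. - ?G j) \<le> N1 Cov l"
        unfolding L2_Norm.L2_set_def
      proof (rule real_le_lsqrt)
        show "(\<Sum>j\<in>F \<times> F. (- ?G j)\<^sup>2) \<le> (N1 Cov l)\<^sup>2"
          using whitened_cov_square_sum[OF l F] by (simp add: sum.cartesian_product')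
      qed (simp_all add: N10 sum_nonneg)
      also note N1R
      finally show ?case by simp
    qed
    show "(\<integral>z. (vnorm (F \<times> F) (cov_deviation l (fst z) (snd z)))\<^sup>2 \<partial>(P \<Otimes>\<^sub>M P)) \<le> R * N1 Cov l"
    proof -
      have i2: "integrable (P \<Otimes>\<^sub>M P) (\<lambda>z. (?\<xi> z j)\<^sup>2)" if j: "j \<in> F \<times> F" for j
      proof (rule PP.P.integrable_const_bound[where B = "R\<^sup>2"])
        show "AE z in P \<Otimes>\<^sub>M P. norm ((?\<xi> z j)\<^sup>2) \<le> R\<^sup>2"
          using R
        proof eventually_elim
          case (elim z)
          have "(?\<xi> z j)\<^sup>2 \<le> (\<Sum>j\<in>F \<times> F. (?\<xi> z j)\<^sup>2)"
            using j F by (intro member_le_sum) auto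
          also have "\<dots> \<le> R\<^sup>2"
            unfolding n\<xi>2 using le_half[of z] elim by (intro power_mono) (auto simp: sum_nonneg)
          finally show ?case by simp
        qed
      qed measurable
      have "(\<integral>z. (vnorm (F \<times> F) (cov_deviation l (fst z) (snd z)))\<^sup>2 \<partial>(P \<Otimes>\<^sub>M P)) =
          (\<integral>z. (\<Sum>j\<in>F \<times> F. (?\<xi> z j)\<^sup>2 - 2 * ?G j * ?\<xi> z j + (?G j)\<^sup>2) \<partial>(P \<Otimes>\<^sub>M P))"
        unfolding vnorm_square dev
        by (intro Bochner_Integration.integral_cong sum.cong refl) (simp add: power2_diff)
      also have "\<dots> = (\<Sum>j\<in>F \<times> F. \<integral>z. (?\<xi> z j)\<^sup>2 - 2 * ?G j * ?\<xi> z j + (?G j)\<^sup>2 \<partial>(P \<Otimes>\<^sub>M P))"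
        by (intro Bochner_Integration.integral_sum Bochner_Integration.integrable_add
            Bochner_Integration.integrable_diff i2 integrable_mult_right i\<xi> PP.P.integrable_const)
      also have "\<dots> \<le> (\<Sum>j\<in>F \<times> F. \<integral>z. (?\<xi> z j)\<^sup>2 \<partial>(P \<Otimes>\<^sub>M P))"
      proof (rule sum_mono)
        fix j assume j: "j \<in> F \<times> F"
        have "(\<integral>z. (?\<xi> z j)\<^sup>2 - 2 * ?G j * ?\<xi> z j + (?G j)\<^sup>2 \<partial>(P \<Otimes>\<^sub>M P)) =
            (\<integral>z. (?\<xi> z j)\<^sup>2 \<partial>(P \<Otimes>\<^sub>M P)) - 2 * ?G j * (\<integral>z. ?\<xi> z j \<partial>(P \<Otimes>\<^sub>M P)) + (?G j)\<^sup>2"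
          using i2[OF j] i\<xi>[of j] integrable_mult_right[OF i\<xi>[of j], of "2 * ?G j"]
          by (subst Bochner_Integration.integral_add Bochner_Integration.integral_diff integral_mult_right; simp add: PP.P.prob_space)+
        then show "(\<integral>z. (?\<xi> z j)\<^sup>2 - 2 * ?G j * ?\<xi> z j + (?G j)\<^sup>2 \<partial>(P \<Otimes>\<^sub>M P)) \<le> (\<integral>z. (?\<xi> z j)\<^sup>2 \<partial>(P \<Otimes>\<^sub>M P))"
          unfolding E\<xi> by (simp add: power2_eq_square)
      qed
      also have "\<dots> = (\<integral>z. (\<Sum>j\<in>F \<times> F. (?\<xi> z j)\<^sup>2) \<partial>(P \<Otimes>\<^sub>M P))"
        by (intro Bochner_Integration.integral_sum[symmetric] i2)
      also have "\<dots> \<le> (\<integral>z. R * ((\<Sum>e\<in>F. (inner (whitened l z) e)\<^sup>2) / 2) \<partial>(P \<Otimes>\<^sub>M P))"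
      proof (rule integral_mono_AE)
        show "integrable (P \<Otimes>\<^sub>M P) (\<lambda>z. \<Sum>j\<in>F \<times> F. (?\<xi> z j)\<^sup>2)"
          by (intro Bochner_Integration.integrable_sum i2)
        show "integrable (P \<Otimes>\<^sub>M P) (\<lambda>z. R * ((\<Sum>e\<in>F. (inner (whitened l z) e)\<^sup>2) / 2))"
          unfolding power2_eq_square
          by (intro integrable_mult_right integrable_divide_zero impI Bochner_Integration.integrable_sum integrable_whitened_mult[OF l])
        show "AE z in P \<Otimes>\<^sub>M P. (\<Sum>j\<in>F \<times> F. (?\<xi> z j)\<^sup>2) \<le> R * ((\<Sum>e\<in>F. (inner (whitened l z) e)\<^sup>2) / 2)"
          using R
        proof eventually_elim
          case (elim z)
          then show ?case
            unfolding n\<xi>2 power2_eq_square[of "(\<Sum>e\<in>F. (inner (whitened l z) e)\<^sup>2) / 2"]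
            using le_half[of z] by (intro mult_right_mono) (auto simp: sum_nonneg)
        qed
      qed
      also have "\<dots> = R * (\<Sum>e\<in>F. inner (blinfun_apply (whitened_cov l) e) e)"
        unfolding sum_whitened_cov[OF l F(1)] by (rule integral_mult_right_zero)
      also have "\<dots> \<le> R * N1 Cov l"
        using N1R N10 by (intro mult_left_mono sum_le_N1[OF l F]) auto
      finally show ?thesis .
    qed
    show "0 \<le> t" "t * (2 * R) \<le> 1/2" by (fact t)+
  qed
qed

lemma inner_whitened_empirical:
  "inner (blinfun_apply (inv_sqrt_reg Cov l o\<^sub>L empirical_covariance evl K s Y o\<^sub>L inv_sqrt_reg Cov l) e) e' =
    1 / (real s * (real s - 1)) * (\<Sum>(i, i') \<in> {(i, i'). i \<in> {1..s} \<and> i' \<in> {1..s} \<and> i \<noteq> i'}.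
      inner (whitened l (Y i, Y i')) e * inner (whitened l (Y i, Y i')) e' / 2)"
proof -
  have "inner (whitened l (x, y)) f = inner (ks x - ks y) (blinfun_apply (inv_sqrt_reg Cov l) f)" for x y f
    unfolding whitened_def by (simp add: inv_sqrt_adj[OF l])
  then show ?thesis
    by (simp add: inv_sqrt_adj[OF l] empirical_covariance_def blinfun.scaleR_left blinfun.sum_left
        inner_sum_left split_beta' sum_divide_distrib[symmetric] mult_ac)
qed

lemma cov_deviation_average:
  assumes s: "2 \<le> s"
  shows "1 / (real s * (real s - 1)) *
      (\<Sum>(i, i') \<in> {(i, i'). i \<in> {1..s} \<and> i' \<in> {1..s} \<and> i \<noteq> i'}. cov_deviation l (Y i) (Y i') (e, e')) =
    inner (blinfun_apply (inv_sqrt_reg Cov l o\<^sub>L empirical_covariance evl K s Y o\<^sub>L inv_sqrt_reg Cov l) e) e' -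
      inner (blinfun_apply (whitened_cov l) e) e'"
proof -
  have "real s * (real s - 1) \<noteq> 0" using s by auto
  then show ?thesis
    unfolding inner_whitened_empirical cov_deviation_def
    using card_off_diagonal[of "{1..s}"]
    by (simp add: split_beta' sum_subtractf right_diff_distrib)
qed

lemma concentration:
  assumes R: "AE z in P \<Otimes>\<^sub>M P. (norm (whitened l z))\<^sup>2 / 2 \<le> R"
    and s: "2 \<le> s" and c: "0 < c" and \<delta>: "0 < \<delta>" "\<delta> < 1/2"
    and lC: "l \<le> norm Cov" and Rs: "16 * c * R * ln (3 / \<delta>) \<le> real s"
  shows "1 - 2 * \<delta> \<le> measure (Pi\<^sub>M {1..s} (\<lambda>_. P)) {Y \<in> space (Pi\<^sub>M {1..s} (\<lambda>_. P)). \<forall>n.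
      (\<Sum>e\<in>trunc n. \<Sum>e'\<in>trunc n.
        (inner (blinfun_apply (inv_sqrt_reg Cov l o\<^sub>L empirical_covariance evl K s Y o\<^sub>L inv_sqrt_reg Cov l) e) e' -
          inner (blinfun_apply (whitened_cov l) e) e')\<^sup>2)
      \<le> ((sqrt 2 / c + 1 / sqrt (2 * c)) * sqrt (N1 Cov l))\<^sup>2}" (is "_ \<le> measure ?N ?E")
proof -
  interpret PP: pair_prob_space P P ..
  interpret PI: prob_space ?N
    by (rule prob_space_PiM) (rule prob_space_axioms)
  define \<epsilon> where "\<epsilon> = (sqrt 2 / c + 1 / sqrt (2 * c)) * sqrt (N1 Cov l)"
  define L where "L = ln (3 / \<delta>)"
  define m where "m = real (s div 2)"
  have N1h: "1/2 \<le> N1 Cov l" by (rule N1_ge_half[OF l lC])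
  have "N1 Cov l \<le> (\<integral>z. (norm (whitened l z))\<^sup>2 / 2 \<partial>(P \<Otimes>\<^sub>M P))" by (rule N1_upper[OF l])
  also have "\<dots> \<le> (\<integral>z. R \<partial>(P \<Otimes>\<^sub>M P))"
    using integrable_norm_whitened[OF l] R by (intro integral_mono_AE) auto
  finally have "N1 Cov l \<le> R" by (simp add: PP.P.prob_space)
  then have R0: "0 < R" using N1h by linarith
  have L0: "0 < L" using \<delta> by (simp add: L_def)
  have \<epsilon>0: "0 \<le> \<epsilon>" using c N1h by (simp add: \<epsilon>_def)
  define q where "q = L * R / real s"
  have q: "0 < q" "16 * c * q \<le> 1"
    using L0 R0 s Rs by (auto simp: q_def L_def field_simps)
  obtain \<tau> where \<tau>: "0 \<le> \<tau>" "\<tau> \<le> 1/4" "3 * q \<le> \<tau> * \<epsilon> - 2/3 * \<tau>\<^sup>2 * N1 Cov l"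
    using exponent_choice[of "sqrt (N1 Cov l)" q c] N1h q c unfolding \<epsilon>_def by auto
  \<comment> \<open>This scaling turns the exponent into \<open>- (m / R)\<close> times the
    expression bounded by \<open>exponent_choice\<close>, and \<open>\<tau> \<le> 1/4\<close> into
    the admissibility of \<open>t\<close>.\<close>
  define t where "t = \<tau> / R"
  have t: "0 \<le> t" "t * (2 * R) \<le> 1/2" using \<tau> R0 by (auto simp: t_def)
  \<comment> \<open>Equality holds at \<open>s = 3\<close>; this loss is paid for by the 3 in front
    of \<open>q\<close>.\<close>
  have "s \<le> 3 * (s div 2)" using s by linarith
  then have m: "real s \<le> 3 * m" unfolding m_def by linarith
  have "m * (2/3 * t\<^sup>2 * (R * N1 Cov l) - t * \<epsilon>) = - (m / R) * (\<tau> * \<epsilon> - 2/3 * \<tau>\<^sup>2 * N1 Cov l)"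
    using R0 by (simp add: t_def field_simps power2_eq_square)
  also have "\<dots> \<le> - (m / R) * (3 * q)"
    using \<tau>(3) R0 by (intro mult_left_mono_neg) (auto simp: m_def)
  also have "\<dots> = - (3 * m / real s) * L"
    using R0 by (simp add: q_def)
  also have "\<dots> \<le> - 1 * L"
    using m s L0 by (intro mult_right_mono) (auto simp: field_simps)
  also have "\<dots> \<le> ln \<delta>" using \<delta> by (simp add: L_def ln_div)
  finally have "exp (m * (2/3 * t\<^sup>2 * (R * N1 Cov l) - t * \<epsilon>)) \<le> \<delta>"
    using \<delta> by (metis exp_le_cancel_iff exp_ln)
  note ex = this
  define D where "D Y j = 1 / (real s * (real s - 1)) *
      (\<Sum>(i, i') \<in> {(i, i'). i \<in> {1..s} \<and> i' \<in> {1..s} \<and> i \<noteq> i'}. cov_deviation l (Y i) (Y i') j)" for Y j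
  \<comment> \<open>The bound for \<open>A n\<close> does not depend on \<open>n\<close>, so it
    passes to the intersection of this decreasing sequence.\<close>
  define A where "A n = {Y \<in> space ?N. vnorm (trunc n \<times> trunc n) (D Y) \<le> \<epsilon>}" for n
  have A: "A n \<in> sets ?N" "1 - 2 * \<delta> \<le> measure ?N (A n)" for n
  proof -
    interpret C: centred_pair_kernel P "cov_deviation l" "trunc n \<times> trunc n" "2 * R" "R * N1 Cov l" t
      by (rule centred_pair_kernel_cov_deviation[OF R finite_trunc trunc_subset t])
    have "C.ustat s = D" by (intro ext) (simp add: C.ustat_def D_def)
    then show "A n \<in> sets ?N" "1 - 2 * \<delta> \<le> measure ?N (A n)"
      using C.ustat_meas[OF s, of \<epsilon>] C.ustat_tail[OF s, of \<epsilon>] ex unfolding A_def m_def by auto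
  qed
  have dec: "decseq A"
  proof (rule decseq_SucI, rule subsetI)
    fix n Y assume "Y \<in> A (Suc n)"
    moreover have "vnorm (trunc n \<times> trunc n) (D Y) \<le> vnorm (trunc (Suc n) \<times> trunc (Suc n)) (D Y)"
      unfolding L2_Norm.L2_set_def using trunc_mono[of n "Suc n"] finite_trunc
      by (intro real_sqrt_le_mono sum_mono2) auto
    ultimately show "Y \<in> A n" by (auto simp: A_def)
  qed
  have "(\<lambda>n. measure ?N (A n)) \<longlonglongrightarrow> measure ?N (\<Inter>n. A n)"
    by (rule PI.finite_Lim_measure_decseq) (use A dec in auto)
  then have "1 - 2 * \<delta> \<le> measure ?N (\<Inter>n. A n)"
    by (rule LIMSEQ_le_const) (use A in auto)
  also have "(\<Inter>n. A n) = ?E"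
  proof -
    have "vnorm (trunc n \<times> trunc n) (D Y) \<le> \<epsilon> \<longleftrightarrow>
        (\<Sum>e\<in>trunc n. \<Sum>e'\<in>trunc n.
        (inner (blinfun_apply (inv_sqrt_reg Cov l o\<^sub>L empirical_covariance evl K s Y o\<^sub>L inv_sqrt_reg Cov l) e) e' -
          inner (blinfun_apply (whitened_cov l) e) e')\<^sup>2) \<le> \<epsilon>\<^sup>2" for n Y
    proof -
      have "(vnorm (trunc n \<times> trunc n) (D Y))\<^sup>2 = (\<Sum>e\<in>trunc n. \<Sum>e'\<in>trunc n.
        (inner (blinfun_apply (inv_sqrt_reg Cov l o\<^sub>L empirical_covariance evl K s Y o\<^sub>L inv_sqrt_reg Cov l) e) e' -
          inner (blinfun_apply (whitened_cov l) e) e')\<^sup>2)"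
        unfolding vnorm_square D_def sum.cartesian_product' cov_deviation_average[OF s] ..
      moreover have "vnorm (trunc n \<times> trunc n) (D Y) \<le> \<epsilon> \<longleftrightarrow> (vnorm (trunc n \<times> trunc n) (D Y))\<^sup>2 \<le> \<epsilon>\<^sup>2"
        using \<epsilon>0 by (simp add: power_mono_iff)
      ultimately show ?thesis by simp
    qed
    then show ?thesis unfolding A_def \<epsilon>_def by auto
  qed
  finally show ?thesis .
qed

end

end

section \<open>Measurability and probability of the event\<close>

lemma bounded_bilinear_tensor_op: "bounded_bilinear (tensor_op :: 'h::{real_inner,banach} \<Rightarrow> 'h \<Rightarrow> 'h \<Rightarrow>\<^sub>L 'h)"
proof
  show "\<exists>C. \<forall>a b. norm (tensor_op a b :: 'h \<Rightarrow>\<^sub>L 'h) \<le> norm a * norm b * C"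
  proof (intro exI[of _ 1] allI)
    fix a b :: 'h
    have "norm (tensor_op a b) \<le> norm a * norm b"
    proof (rule norm_blinfun_bound)
      fix x
      show "norm (blinfun_apply (tensor_op a b) x) \<le> norm a * norm b * norm x"
        using mult_left_mono[OF Cauchy_Schwarz_ineq2[of b x] norm_ge_zero[of a]] by (simp add: mult_ac)
    qed simp
    then show "norm (tensor_op a b) \<le> norm a * norm b * 1" by simp
  qed
qed (rule blinfun_eqI, simp add: blinfun.add_left blinfun.scaleR_left inner_add_left scaleR_add_left scaleR_add_right)+

context centered_kernel_setting
begin

abbreviation "Emp s Y \<equiv> empirical_covariance evl K s Y"

lemma inner_empirical:
  "inner (blinfun_apply (Emp s Y) f) g = 1 / (2 * real s * (real s - 1)) *
    (\<Sum>(i, i') \<in> {(i, i'). i \<in> {1..s} \<and> i' \<in> {1..s} \<and> i \<noteq> i'}.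
      inner (ks (Y i) - ks (Y i')) f * inner (ks (Y i) - ks (Y i')) g)"
  by (simp add: empirical_covariance_def blinfun.scaleR_left blinfun.sum_left inner_sum_left split_beta')

lemma positive_empirical:
  assumes "2 \<le> s"
  shows "positive_op (Emp s Y)"
  unfolding positive_op_def
proof (intro conjI allI)
  show "inner (blinfun_apply (Emp s Y) f) g = inner f (blinfun_apply (Emp s Y) g)" for f g
    unfolding inner_commute[of f] inner_empirical by (simp add: mult_ac)
  show "0 \<le> inner (blinfun_apply (Emp s Y) f) f" for f
    unfolding inner_empirical using assms by (intro mult_nonneg_nonneg sum_nonneg) (auto simp: split_beta')
qed

text \<open>The conjugated operator is positive with finite trace, being a finite sum of rank-one
  terms. The bound excludes the default value 0 of a divergent sum in the norm.\<close>

lemma empirical_hs_bound: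
  assumes s: "2 \<le> s" and V: "selfadjoint V"
  obtains d where "\<And>F. finite F \<Longrightarrow> F \<subseteq> onb \<Longrightarrow>
    (\<Sum>e\<in>F. (norm (blinfun_apply (V o\<^sub>L Emp s Y o\<^sub>L V) e))\<^sup>2) \<le> d"
proof -
  let ?D = "{(i, i'). i \<in> {1..s} \<and> i' \<in> {1..s} \<and> i \<noteq> i'}"
  let ?X = "V o\<^sub>L Emp s Y o\<^sub>L V"
  define c where "c = 1 / (2 * real s * (real s - 1))"
  define v where "v p = blinfun_apply V (ks (Y (fst p)) - ks (Y (snd p)))" for p
  have c: "0 \<le> c" using s by (simp add: c_def)
  have form: "inner (blinfun_apply ?X f) g = c * (\<Sum>p\<in>?D. inner (v p) f * inner (v p) g)" for f g
    by (simp add: selfadjointD[OF V] inner_empirical v_def c_def split_beta')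
  have X: "positive_op ?X"
  proof (rule positive_opI)
    show "selfadjoint ?X"
      by (intro selfadjoint_conj V positive_op_selfadjoint positive_empirical s)
    show "0 \<le> inner (blinfun_apply ?X f) f" for f
      unfolding form power2_eq_square[symmetric]
      by (rule mult_nonneg_nonneg[OF c]) (simp add: sum_nonneg)
  qed
  have diag: "(\<Sum>e\<in>F. inner (blinfun_apply ?X e) e) \<le> c * (\<Sum>p\<in>?D. (norm (v p))\<^sup>2)"
    if F: "finite F" "F \<subseteq> onb" for F
  proof -
    have "(\<Sum>e\<in>F. inner (blinfun_apply ?X e) e) = c * (\<Sum>p\<in>?D. \<Sum>e\<in>F. (inner (v p) e)\<^sup>2)"
      unfolding form by (subst sum.swap) (simp add: sum_distrib_left power2_eq_square)
    also have "\<dots> \<le> c * (\<Sum>p\<in>?D. (norm (v p))\<^sup>2)"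
      by (intro mult_left_mono c sum_mono bessel_finite F orthonormal_subset[OF orthonormal_onb])
    finally show ?thesis .
  qed
  have "(\<Sum>e\<in>F. \<Sum>e'\<in>F. (inner (blinfun_apply ?X e) e')\<^sup>2) \<le> (c * (\<Sum>p\<in>?D. (norm (v p))\<^sup>2))\<^sup>2"
    if F: "finite F" "F \<subseteq> onb" for F
  proof -
    have "(\<Sum>e\<in>F. \<Sum>e'\<in>F. (inner (blinfun_apply ?X e) e')\<^sup>2) \<le>
        (\<Sum>e\<in>F. \<Sum>e'\<in>F. inner (blinfun_apply ?X e) e * inner (blinfun_apply ?X e') e')"
      by (intro sum_mono positive_op_Cauchy_Schwarz X)
    also have "\<dots> = (\<Sum>e\<in>F. inner (blinfun_apply ?X e) e)\<^sup>2" by (simp add: power2_eq_square sum_product)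
    also have "\<dots> \<le> (c * (\<Sum>p\<in>?D. (norm (v p))\<^sup>2))\<^sup>2"
      by (intro power_mono diag F sum_nonneg positive_op_nonneg X)
    finally show ?thesis .
  qed
  from onb_sum_square_le[OF this] show ?thesis using that by blast
qed

lemma continuous_empirical: "continuous_on UNIV (\<lambda>Y. Emp s Y)"
proof -
  have "continuous_on UNIV (\<lambda>Y::nat \<Rightarrow> 'x. ks (Y i))" for i
    by (rule continuous_on_compose2[OF continuous_ks]) auto
  then show ?thesis
    unfolding empirical_covariance_def split_beta'
    by (intro continuous_on_scaleR continuous_on_const continuous_on_sum
        bounded_bilinear.continuous_on[OF bounded_bilinear_tensor_op] continuous_on_diff)
qed

lemma continuous_inverse_empirical:
  assumes s: "2 \<le> s" and l: "0 < l"
  shows "continuous_on UNIV (\<lambda>Y. inverse_op (regularize (Emp s Y) l))"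
  unfolding continuous_on_def
proof
  fix Y0 :: "nat \<Rightarrow> 'x"
  have "((\<lambda>Y. Emp s Y) \<longlongrightarrow> Emp s Y0) (at Y0)"
    using continuous_empirical[of s] unfolding continuous_on_def by blast
  then have "((\<lambda>Y. dist (Emp s Y) (Emp s Y0)) \<longlongrightarrow> 0) (at Y0)"
    by (rule tendsto_dist_iff[THEN iffD1])
  then have lim: "((\<lambda>Y. (1 / l\<^sup>2) * dist (Emp s Y) (Emp s Y0)) \<longlongrightarrow> 0) (at Y0)"
    by (rule tendsto_mult_right_zero)
  show "((\<lambda>Y. inverse_op (regularize (Emp s Y) l)) \<longlongrightarrow> inverse_op (regularize (Emp s Y0) l)) (at Y0)"
  proof (rule tendsto_dist_iff[THEN iffD2], rule tendsto_sandwich[OF _ _ tendsto_const lim])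
    show "\<forall>\<^sub>F Y in at Y0. dist (inverse_op (regularize (Emp s Y) l)) (inverse_op (regularize (Emp s Y0) l))
        \<le> (1 / l\<^sup>2) * dist (Emp s Y) (Emp s Y0)"
      by (intro always_eventually allI inverse_op_regularize_lipschitz positive_empirical s l)
  qed simp
qed

text \<open>Neither side of the inequality defining the event needs a square root of the random operator:
  $\hat\Sigma_\lambda^{-1/2}\hat\Sigma\hat\Sigma_\lambda^{-1/2} = \hat\Sigma\hat\Sigma_\lambda^{-1}$ and
  $\|\hat\Sigma_\lambda^{-1/2} S\|^2 = \|S \hat\Sigma_\lambda^{-1} S\|$. Since the Hilbert--Schmidt norm is
  a supremum of continuous functions, the event is closed in the product topology.\<close>

lemma event_measurable:
  assumes s: "2 \<le> s" and l: "0 < l" and S: "selfadjoint S" and b: "0 \<le> b"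
  shows "{Y \<in> space (Pi\<^sub>M {1..s} (\<lambda>_. P)). N2 (Emp s Y) l \<le> (norm (inv_sqrt_reg (Emp s Y) l o\<^sub>L S))\<^sup>2 * b}
    \<in> sets (Pi\<^sub>M {1..s} (\<lambda>_. P))"
proof -
  let ?N = "Pi\<^sub>M {1..s} (\<lambda>_. P)"
  let ?I = "\<lambda>Y. inverse_op (regularize (Emp s Y) l)"
  let ?ev = "\<lambda>Y. N2 (Emp s Y) l \<le> (norm (inv_sqrt_reg (Emp s Y) l o\<^sub>L S))\<^sup>2 * b"
  have ev: "?ev Y \<longleftrightarrow> (\<forall>F. finite F \<longrightarrow> F \<subseteq> onb \<longrightarrow>
      (\<Sum>e\<in>F. (norm (blinfun_apply (Emp s Y) (blinfun_apply (?I Y) e)))\<^sup>2) \<le> (norm (S o\<^sub>L ?I Y o\<^sub>L S) * b)\<^sup>2)" for Y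
  proof -
    note A = positive_empirical[OF s, of Y]
    obtain d where d: "\<And>F. finite F \<Longrightarrow> F \<subseteq> onb \<Longrightarrow>
        (\<Sum>e\<in>F. (norm (blinfun_apply (inv_sqrt_reg (Emp s Y) l o\<^sub>L Emp s Y o\<^sub>L inv_sqrt_reg (Emp s Y) l) e))\<^sup>2) \<le> d"
      using empirical_hs_bound[OF s inv_sqrt_reg_selfadjoint[OF A l]] by blast
    show ?thesis
      unfolding N2_def norm_inv_sqrt_reg_compose[OF A l S]
      by (subst hs_norm_le_iff[OF d]) (use b in \<open>simp_all add: inv_sqrt_reg_conj[OF A l]\<close>)
  qed
  have "closed (\<Inter>F\<in>{F. finite F \<and> F \<subseteq> onb}. {Y. (\<Sum>e\<in>F. (norm (blinfun_apply (Emp s Y) (blinfun_apply (?I Y) e)))\<^sup>2)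
      \<le> (norm (S o\<^sub>L ?I Y o\<^sub>L S) * b)\<^sup>2})"
    by (intro closed_INT ballI closed_Collect_le continuous_on_sum continuous_on_power continuous_on_norm
        continuous_on_mult continuous_on_const
        bounded_bilinear.continuous_on[OF bounded_bilinear_blinfun_apply]
        bounded_bilinear.continuous_on[OF bounded_bilinear_blinfun_compose]
        continuous_empirical continuous_inverse_empirical s l)
  also have "(\<Inter>F\<in>{F. finite F \<and> F \<subseteq> onb}. {Y. (\<Sum>e\<in>F. (norm (blinfun_apply (Emp s Y) (blinfun_apply (?I Y) e)))\<^sup>2)
      \<le> (norm (S o\<^sub>L ?I Y o\<^sub>L S) * b)\<^sup>2}) = {Y. ?ev Y}"
    unfolding ev by auto
  finally have "{Y. ?ev Y} \<in> sets (borel :: (nat \<Rightarrow> 'x) measure)" by (rule borel_closed)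
  \<comment> \<open>Second countability identifies the Borel sets of the product topology with the
    product \<sigma>-algebra.\<close>
  then have C: "{Y. ?ev Y} \<in> sets (Pi\<^sub>M UNIV (\<lambda>_::nat. borel :: 'x measure))"
    by (simp add: sets_PiM_equal_borel)
  \<comment> \<open>The closed set lives among all sequences, the sample in the product over
    \<open>{1..s}\<close>. Filling the missing coordinates with \<open>Y 1\<close> is measurable and
    leaves the empirical operator unchanged.\<close>
  define ext where "ext Y i = (if i \<in> {1..s} then Y i else Y 1)" for Y :: "nat \<Rightarrow> 'x" and i
  have comp: "(\<lambda>Y. Y i) \<in> measurable ?N borel" if "i \<in> {1..s}" for i
    using measurable_component_singleton[OF that, of "\<lambda>_. P"] measurable_cong_sets[OF refl sets_P] by blast
  have "ext \<in> measurable ?N (Pi\<^sub>M UNIV (\<lambda>_::nat. borel :: 'x measure))"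
  proof (rule measurable_PiM_single')
    fix i :: nat
    show "(\<lambda>Y. ext Y i) \<in> measurable ?N borel"
      unfolding ext_def using comp s by (cases "i \<in> {1..s}") auto
  qed auto
  from measurable_sets[OF this C] have "ext -` {Y. ?ev Y} \<inter> space ?N \<in> sets ?N" .
  moreover have "Emp s (ext Y) = Emp s Y" for Y
    unfolding empirical_covariance_def
    by (intro arg_cong2[where f = scaleR] refl sum.cong) (auto simp: ext_def)
  then have "ext -` {Y. ?ev Y} \<inter> space ?N = {Y \<in> space ?N. ?ev Y}" by auto
  ultimately show ?thesis by simp
qed

lemma event_probability:
  assumes R: "AE z in P \<Otimes>\<^sub>M P. (norm (whitened l z))\<^sup>2 / 2 \<le> R"
    and l: "0 < l" and s: "2 \<le> s" and c: "0 < c" and \<delta>: "0 < \<delta>"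
    and lC: "l \<le> norm Cov" and Rs: "16 * c * R * ln (3 / \<delta>) \<le> real s"
  shows "1 - 2 * \<delta> \<le> measure (Pi\<^sub>M {1..s} (\<lambda>_. P)) {Y \<in> space (Pi\<^sub>M {1..s} (\<lambda>_. P)).
    N2 (Emp s Y) l \<le> (norm (inv_sqrt_reg (Emp s Y) l o\<^sub>L sqrt_op (regularize Cov l)))\<^sup>2 *
      (N2 Cov l + (sqrt 2 / c + 1 / sqrt (2 * c)) * sqrt (N1 Cov l))}"
proof (cases "\<delta> < 1/2")
  case False
  then have "1 - 2 * \<delta> \<le> 0" by simp
  then show ?thesis using measure_nonneg order_trans by blast
next
  \<comment> \<open>Below 1/2, \<open>ln (3 / \<delta>)\<close> is positive, as the concentration
    bound requires.\<close>
  case True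
  let ?N = "Pi\<^sub>M {1..s} (\<lambda>_. P)"
  interpret PI: prob_space ?N
    by (rule prob_space_PiM) (rule prob_space_axioms)
  define \<epsilon> where "\<epsilon> = (sqrt 2 / c + 1 / sqrt (2 * c)) * sqrt (N1 Cov l)"
  define G where "G = whitened_cov l"
  define X where "X Y = inv_sqrt_reg Cov l o\<^sub>L Emp s Y o\<^sub>L inv_sqrt_reg Cov l" for Y
  have \<epsilon>0: "0 \<le> \<epsilon>" using c N1_ge_half[OF l lC] by (simp add: \<epsilon>_def)
  have N2G: "N2 Cov l = hs_norm G" by (simp add: N2_def G_def whitened_cov_def)
  have G: "vnorm (F \<times> F) (\<lambda>(e, e'). inner (blinfun_apply G e) e') \<le> N2 Cov l"
    if F: "finite F" "F \<subseteq> onb" for F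
  proof -
    have "(\<Sum>e\<in>F. \<Sum>e'\<in>F. (inner (blinfun_apply G e) e')\<^sup>2) \<le> (\<Sum>e\<in>F. (norm (blinfun_apply G e))\<^sup>2)"
      by (intro sum_mono bessel_finite F orthonormal_subset[OF orthonormal_onb])
    also have "\<dots> \<le> (N2 Cov l)\<^sup>2"
      unfolding N2G G_def
      by (rule sum_le_hs_norm[OF onb_sum_square_le[OF whitened_cov_square_sum[OF l]] F])
    finally show ?thesis
      unfolding L2_Norm.L2_set_def sum.cartesian_product'
      by (intro real_le_lsqrt) (auto simp: N2G hs_norm_nonneg)
  qed
  have "1 - 2 * \<delta> \<le> PI.prob {Y \<in> space ?N. \<forall>n. (\<Sum>e\<in>trunc n. \<Sum>e'\<in>trunc n.
      (inner (blinfun_apply (X Y) e) e' - inner (blinfun_apply G e) e')\<^sup>2) \<le> \<epsilon>\<^sup>2}"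
    unfolding X_def G_def \<epsilon>_def by (rule concentration[OF l R s c \<delta> True lC Rs])
  also have "\<dots> \<le> PI.prob {Y \<in> space ?N.
      N2 (Emp s Y) l \<le> (norm (inv_sqrt_reg (Emp s Y) l o\<^sub>L sqrt_op (regularize Cov l)))\<^sup>2 * (N2 Cov l + \<epsilon>)}"
  proof (rule PI.finite_measure_mono)
    \<comment> \<open>Monotonicity of the measure needs the larger event measurable: a nonmeasurable
      set has measure 0.\<close>
    show "{Y \<in> space ?N. N2 (Emp s Y) l \<le>
        (norm (inv_sqrt_reg (Emp s Y) l o\<^sub>L sqrt_op (regularize Cov l)))\<^sup>2 * (N2 Cov l + \<epsilon>)} \<in> sets ?N"
      by (intro event_measurable s l sqrt_reg_selfadjoint positive_covariance)
        (auto simp: N2G hs_norm_nonneg \<epsilon>0)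
    show "{Y \<in> space ?N. \<forall>n. (\<Sum>e\<in>trunc n. \<Sum>e'\<in>trunc n.
        (inner (blinfun_apply (X Y) e) e' - inner (blinfun_apply G e) e')\<^sup>2) \<le> \<epsilon>\<^sup>2} \<subseteq>
      {Y \<in> space ?N. N2 (Emp s Y) l \<le>
        (norm (inv_sqrt_reg (Emp s Y) l o\<^sub>L sqrt_op (regularize Cov l)))\<^sup>2 * (N2 Cov l + \<epsilon>)}"
    proof safe
      fix Y assume good: "\<forall>n. (\<Sum>e\<in>trunc n. \<Sum>e'\<in>trunc n.
        (inner (blinfun_apply (X Y) e) e' - inner (blinfun_apply G e) e')\<^sup>2) \<le> \<epsilon>\<^sup>2"
      have sq: "(\<Sum>e\<in>F. \<Sum>e'\<in>F. (inner (blinfun_apply (X Y) e) e')\<^sup>2) \<le> (N2 Cov l + \<epsilon>)\<^sup>2"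
        if F: "finite F" "F \<subseteq> onb" for F
      proof -
        define u where "u = (\<lambda>(e, e'). inner (blinfun_apply (X Y) e) e' - inner (blinfun_apply G e) e')"
        define g where "g = (\<lambda>(e, e'). inner (blinfun_apply G e) e')"
        \<comment> \<open>The good event controls truncations only, and every finite set of basis
          vectors lies inside one.\<close>
        obtain n where n: "F \<subseteq> trunc n" using finite_subset_trunc[OF F] by blast
        have "vnorm (F \<times> F) u \<le> vnorm (trunc n \<times> trunc n) u"
          unfolding L2_Norm.L2_set_def using n finite_trunc
          by (intro real_sqrt_le_mono sum_mono2) auto
        also have "\<dots> \<le> \<epsilon>"
          unfolding L2_Norm.L2_set_def sum.cartesian_product' u_def
          using good \<epsilon>0 by (intro real_le_lsqrt) auto
        finally have u: "vnorm (F \<times> F) u \<le> \<epsilon>" .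
        have "vnorm (F \<times> F) (\<lambda>(e, e'). inner (blinfun_apply (X Y) e) e') = vnorm (F \<times> F) (\<lambda>j. g j + u j)"
          by (rule L2_set_cong) (auto simp: g_def u_def)
        also have "\<dots> \<le> vnorm (F \<times> F) g + vnorm (F \<times> F) u" by (rule L2_set_triangle_ineq)
        also have "\<dots> \<le> N2 Cov l + \<epsilon>" using G[OF F] u unfolding g_def by linarith
        finally have "(vnorm (F \<times> F) (\<lambda>(e, e'). inner (blinfun_apply (X Y) e) e'))\<^sup>2 \<le> (N2 Cov l + \<epsilon>)\<^sup>2"
          by (rule power_mono) simp
        then show ?thesis by (simp add: vnorm_square sum.cartesian_product')
      qed
      show "N2 (Emp s Y) l \<le>
          (norm (inv_sqrt_reg (Emp s Y) l o\<^sub>L sqrt_op (regularize Cov l)))\<^sup>2 * (N2 Cov l + \<epsilon>)"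
        using \<epsilon>0 onb_sum_square_le[OF sq] unfolding X_def
        by (intro N2_le_of_conjugate positive_empirical positive_covariance s l) (auto simp: N2G hs_norm_nonneg)
    qed
  qed
  finally show ?thesis unfolding \<epsilon>_def .
qed

section \<open>Eigenfunctions of the integral operator\<close>

abbreviation "\<phi> \<equiv> eigenfun P evl ews efs"

lemma L2_null:
  assumes "h \<in> L2_set P" "L2_inner P h h = 0"
  shows "AE x in P. h x = 0"
proof -
  have "integrable P (\<lambda>x. h x * h x)"
    using assms(1) by (simp add: L2_set_def power2_eq_square)
  then have "AE x in P. h x * h x = 0"
    using assms(2) integral_nonneg_eq_0_iff_AE[of P "\<lambda>x. h x * h x"] by (simp add: L2_inner_def)
  then show ?thesis by simp
qed

text \<open>On an eigenfunction the partial sums of the spectral series no longer change from index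
  \<open>i + 1\<close> on, so the null limit says that a constant L2 distance is 0.\<close>

lemma integral_op_efs: "AE x in P. integral_op P evl (efs i) x = ews i * efs i x"
proof -
  define h where "h x = integral_op P evl (efs i) x - ews i * efs i x" for x
  have "(\<Sum>j<n. ews j * L2_inner P (efs j) (efs i) * efs j x) = ews i * efs i x" if "Suc i \<le> n" for n x
  proof -
    have "(\<Sum>j<n. ews j * L2_inner P (efs j) (efs i) * efs j x) = (\<Sum>j<n. if j = i then ews i * efs i x else 0)"
      by (intro sum.cong) (auto simp: efs_orthonormal)
    then show ?thesis using that by simp
  qed
  then have "\<forall>\<^sub>F n in sequentially. L2_norm P (\<lambda>x. integral_op P evl (efs i) x -
      (\<Sum>j<n. ews j * L2_inner P (efs j) (efs i) * efs j x)) = L2_norm P h"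
    unfolding eventually_sequentially h_def by (intro exI[of _ "Suc i"]) auto
  then have "(\<lambda>n. L2_norm P h) \<longlonglongrightarrow> 0"
    using spectral_decomposition[OF efs_L2[of i]] by (rule Lim_transform_eventually[rotated])
  then have "L2_norm P h = 0" by (simp add: LIMSEQ_const_iff)
  then have "L2_inner P h h = 0" by (simp add: L2_norm_def)
  moreover have "h \<in> L2_set P"
  proof -
    have c: "integral_op P evl (efs i) \<in> L2_set P" unfolding integral_op_def by (rule centered_L2)
    have m: "integral_op P evl (efs i) \<in> borel_measurable P" "efs i \<in> borel_measurable P"
      "integrable P (\<lambda>x. (integral_op P evl (efs i) x)\<^sup>2)" "integrable P (\<lambda>x. (efs i x)\<^sup>2)"
      using c efs_L2[of i] by (auto simp: L2_set_def)
    have x: "integrable P (\<lambda>x. integral_op P evl (efs i) x * efs i x)"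
      unfolding integral_op_def by (rule integrable_centered_mult[OF efs_L2])
    have "integrable P (\<lambda>x. (integral_op P evl (efs i) x)\<^sup>2 - 2 * ews i * (integral_op P evl (efs i) x * efs i x) + (ews i)\<^sup>2 * (efs i x)\<^sup>2)"
      by (intro Bochner_Integration.integrable_add Bochner_Integration.integrable_diff integrable_mult_right m x)
    moreover have "(h x)\<^sup>2 = (integral_op P evl (efs i) x)\<^sup>2 - 2 * ews i * (integral_op P evl (efs i) x * efs i x) + (ews i)\<^sup>2 * (efs i x)\<^sup>2" for x
      by (simp add: h_def power2_diff power_mult_distrib)
    ultimately have "integrable P (\<lambda>x. (h x)\<^sup>2)" by simp
    moreover have "h \<in> borel_measurable P" unfolding h_def using m by simp
    ultimately show ?thesis by (simp add: L2_set_def)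
  qed
  ultimately have "AE x in P. h x = 0" by (intro L2_null)
  then show ?thesis by eventually_elim (simp add: h_def)
qed

lemma centered_adj_efs: "centered_adj P evl (efs i) = ews i *\<^sub>R \<phi> i"
  using ews_pos[of i] by (simp add: eigenfun_def)

text \<open>Links the Hilbert space element, whose pointwise values enter \<open>C\<close>, to the
  given L2 eigenfunction.\<close>

lemma centered_eigenfun: "AE x in P. centered P evl (\<phi> i) x = efs i x"
  using integral_op_efs[of i]
proof eventually_elim
  case (elim x)
  then show ?case
    using ews_pos[of i] by (simp add: eigenfun_def centered_scaleR integral_op_def)
qed

lemma inner_eigenfun: "ews i * inner f (\<phi> i) = L2_inner P (centered P evl f) (efs i)"
  using inner_centered_adj[OF efs_L2[of i], of f] by (simp add: centered_adj_efs)

lemma L2_inner_centered_eigenfun: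
  assumes "g \<in> borel_measurable P"
  shows "L2_inner P g (centered P evl (\<phi> i)) = L2_inner P g (efs i)"
    "L2_inner P (centered P evl (\<phi> i)) g = L2_inner P (efs i) g"
proof -
  have [measurable]: "efs i \<in> borel_measurable P" "g \<in> borel_measurable P"
    using efs_L2[of i] assms by (auto simp: L2_set_def)
  show "L2_inner P g (centered P evl (\<phi> i)) = L2_inner P g (efs i)"
    unfolding L2_inner_def by (rule integral_cong_AE) (use centered_eigenfun[of i] in auto)
  show "L2_inner P (centered P evl (\<phi> i)) g = L2_inner P (efs i) g"
    unfolding L2_inner_def by (rule integral_cong_AE) (use centered_eigenfun[of i] in auto)
qed

lemma covariance_eigenfun: "blinfun_apply Cov (\<phi> i) = ews i *\<^sub>R \<phi> i"
proof (rule vector_eq_ldot[THEN iffD1], rule allI)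
  fix g
  have "inner g (blinfun_apply Cov (\<phi> i)) = L2_inner P (centered P evl g) (centered P evl (\<phi> i))"
    unfolding covariance_apply by (rule inner_centered_adj[OF centered_L2])
  also have "\<dots> = L2_inner P (centered P evl g) (efs i)"
    by (rule L2_inner_centered_eigenfun) measurable
  also have "\<dots> = inner g (ews i *\<^sub>R \<phi> i)"
    by (simp add: inner_eigenfun)
  finally show "inner g (blinfun_apply Cov (\<phi> i)) = inner g (ews i *\<^sub>R \<phi> i)" .
qed

text \<open>The squared Hilbert space norm of \<open>\<phi> i\<close> is \<open>1 / ews i\<close>;
  the factor normalises it.\<close>

definition eigvec :: "nat \<Rightarrow> 'h" where
  "eigvec i = sqrt (ews i) *\<^sub>R \<phi> i"

lemma inner_eigvec: "inner (eigvec i) (eigvec j) = (if i = j then 1 else 0)"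
proof -
  have [measurable]: "efs j \<in> borel_measurable P" using efs_L2[of j] by (auto simp: L2_set_def)
  have "ews j * inner (\<phi> i) (\<phi> j) = L2_inner P (efs i) (efs j)"
    unfolding inner_eigenfun by (rule L2_inner_centered_eigenfun) measurable
  then have "inner (\<phi> i) (\<phi> j) = (if i = j then 1 / ews j else 0)"
    using ews_pos[of j] by (auto simp: efs_orthonormal field_simps split: if_splits)
  then show ?thesis using ews_pos[of i] ews_pos[of j] by (simp add: eigvec_def)
qed

lemma orthonormal_eigvec: "orthonormal (range eigvec)"
  unfolding orthonormal_def
  by (auto simp: pairwise_def orthogonal_def inner_eigvec norm_eq_sqrt_inner)

lemma inv_sqrt_reg_eigvec:
  assumes l: "0 < l"
  shows "blinfun_apply (inv_sqrt_reg Cov l) (eigvec i) = (1 / sqrt (ews i + l)) *\<^sub>R eigvec i"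
  using ews_pos[of i]
  by (intro inv_sqrt_reg_eigenvector positive_covariance l)
    (auto simp: eigvec_def blinfun.scaleR_right covariance_eigenfun)

text \<open>All spectral coefficients of the centred \<open>f\<close> vanish, so the integral
  operator annihilates it; its quadratic form there is the squared norm of the adjoint image, that
  is of \<open>Cov f\<close>. Thus the eigenvectors are complete up to the kernel of the
  covariance.\<close>

lemma covariance_orthogonal_eigvec:
  assumes "\<And>i. inner f (eigvec i) = 0"
  shows "blinfun_apply Cov f = 0"
proof -
  define g where "g = centered P evl f"
  have gL: "g \<in> L2_set P" unfolding g_def by (rule centered_L2)
  have "L2_inner P (efs i) g = 0" for i
  proof -
    have "inner f (\<phi> i) = 0" using assms[of i] ews_pos[of i] by (simp add: eigvec_def)
    then have "L2_inner P g (efs i) = 0" using inner_eigenfun[of i f] by (simp add: g_def)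
    then show ?thesis by (simp add: L2_inner_def mult.commute)
  qed
  then have "(\<lambda>n::nat. L2_norm P (integral_op P evl g)) \<longlonglongrightarrow> 0"
    using spectral_decomposition[OF gL] by simp
  then have "L2_norm P (integral_op P evl g) = 0" by (simp add: LIMSEQ_const_iff)
  then have "L2_inner P (integral_op P evl g) (integral_op P evl g) = 0" by (simp add: L2_norm_def)
  then have "AE x in P. integral_op P evl g x = 0"
    by (intro L2_null) (auto simp: integral_op_def centered_L2)
  moreover have [measurable]: "integral_op P evl g \<in> borel_measurable P" "g \<in> borel_measurable P"
    using gL by (auto simp: integral_op_def L2_set_def)
  ultimately have "L2_inner P (integral_op P evl g) g = (\<integral>x. 0 \<partial>P)"
    unfolding L2_inner_def by (intro integral_cong_AE) auto
  then have "inner (centered_adj P evl g) (centered_adj P evl g) = 0"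
    unfolding inner_centered_adj[OF gL] by (simp add: integral_op_def)
  then show ?thesis by (simp add: covariance_apply g_def)
qed

text \<open>Whitening preserves the orthogonal complement of the eigenvectors, so the coordinate
  along \<open>u\<close> has second moment zero.\<close>

lemma whitened_orthogonal_eigvec:
  assumes l: "0 < l" and u: "\<And>i. inner u (eigvec i) = 0"
  shows "AE z in P \<Otimes>\<^sub>M P. inner (whitened l z) u = 0"
proof -
  have "blinfun_apply Cov (blinfun_apply (inv_sqrt_reg Cov l) u) = 0"
    by (rule covariance_orthogonal_eigvec) (simp add: inv_sqrt_adj[OF l] inv_sqrt_reg_eigvec[OF l] u)
  then have "inner (blinfun_apply (whitened_cov l) u) u = 0" by (simp add: whitened_cov_def)
  then have "(\<integral>z. inner (whitened l z) u * inner (whitened l z) u / 2 \<partial>(P \<Otimes>\<^sub>M P)) = 0"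
    by (simp add: inner_whitened_cov[OF l])
  then have "AE z in P \<Otimes>\<^sub>M P. inner (whitened l z) u * inner (whitened l z) u / 2 = 0"
    using integrable_whitened_mult[OF l, of u u]
    by (subst (asm) integral_nonneg_eq_0_iff_AE) auto
  then show ?thesis by simp
qed

text \<open>Each direction orthogonal to the eigenvectors has its own exceptional null set. The
  countably many residuals \<open>e - p e\<close> of basis vectors determine the orthogonal
  component, so a single null set suffices.\<close>

lemma whitened_in_eigenspace:
  assumes l: "0 < l"
  shows "AE z in P \<Otimes>\<^sub>M P. whitened l z \<in> closure (span (range eigvec))"
proof -
  let ?E = "range eigvec"
  have proj: "\<exists>h. (\<forall>e\<in>?E. inner h e = inner x e) \<and> h \<in> closure (span ?E)" for x
    by (rule fourier_vector[OF orthonormal_eigvec, of "inner x" "(norm x)\<^sup>2"])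
      (use bessel_finite orthonormal_subset[OF orthonormal_eigvec] in blast, blast)
  then obtain p where p: "\<And>x e. e \<in> ?E \<Longrightarrow> inner (p x) e = inner x e" "\<And>x. p x \<in> closure (span ?E)"
    by metis
  have orth: "inner (x - p x) e = 0" if "e \<in> ?E" for x e
    using p(1)[OF that] by (simp add: inner_diff_left)
  have "AE z in P \<Otimes>\<^sub>M P. \<forall>e\<in>onb. inner (whitened l z) (e - p e) = 0"
    by (subst AE_ball_countable[OF countable_onb])
      (use whitened_orthogonal_eigvec[OF l] orth in auto)
  then show ?thesis
  proof eventually_elim
    case (elim z)
    define x where "x = whitened l z"
    have "inner (x - p x) e = 0" if e: "e \<in> onb" for e
    proof -
      have "inner (x - p x) e = inner (x - p x) (e - p e) + inner (x - p x) (p e)"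
        by (simp add: inner_diff_right)
      also have "inner (x - p x) (p e) = 0"
        by (rule orthogonal_closure_span[OF p(2) orth])
      also have "inner (x - p x) (e - p e) = inner x (e - p e) - inner (e - p e) (p x)"
        by (simp add: inner_diff_left[of x "p x"] inner_commute[of "p x"])
      also have "inner (e - p e) (p x) = 0"
        by (rule orthogonal_closure_span[OF p(2) orth])
      also have "inner x (e - p e) = 0" using elim e by (simp add: x_def)
      finally show ?thesis by simp
    qed
    then have "x - p x = 0" by (rule onb_complete)
    then show ?case using p(2)[of x] by (simp add: x_def)
  qed
qed

lemma abs_eigenfun_le:
  assumes "bdd_above (range (\<lambda>i. sup_norm (evl (\<phi> i))))"
  shows "\<bar>evl (\<phi> i) x\<bar> \<le> (SUP i. sup_norm (evl (\<phi> i)))"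
proof -
  have "\<bar>evl (\<phi> i) x\<bar> \<le> sup_norm (evl (\<phi> i))"
    unfolding sup_norm_def
    by (rule cSUP_upper) (auto intro!: bdd_aboveI[of _ "norm (\<phi> i) * sqrt \<kappa>"] evl_bound)
  also have "\<dots> \<le> (SUP i. sup_norm (evl (\<phi> i)))"
    by (rule cSUP_upper[OF UNIV_I assms])
  finally show ?thesis .
qed

text \<open>Along the i-th eigenvector the squared coordinate is \<open>ews i / (ews i + l)\<close>
  times the squared increment of \<open>\<phi> i\<close>, which is at most \<open>4 C^2\<close>. The
  factors \<open>ews i / (ews i + l)\<close> are diagonal entries of the whitened covariance and sum
  to at most \<open>N1\<close>.\<close>

lemma whitened_bound_eigenfun:
  assumes l: "0 < l" and bdd: "bdd_above (range (\<lambda>i. sup_norm (evl (\<phi> i))))"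
  shows "AE z in P \<Otimes>\<^sub>M P. (norm (whitened l z))\<^sup>2 / 2 \<le> 2 * (SUP i. sup_norm (evl (\<phi> i)))\<^sup>2 * N1 Cov l"
  using whitened_in_eigenspace[OF l]
proof eventually_elim
  case (elim z)
  define C where "C = (SUP i. sup_norm (evl (\<phi> i)))"
  have C: "\<bar>evl (\<phi> i) x\<bar> \<le> C" for i x unfolding C_def by (rule abs_eigenfun_le[OF bdd])
  have coord: "(inner (whitened l z) e)\<^sup>2 \<le> 4 * C\<^sup>2 * inner (blinfun_apply (whitened_cov l) e) e" if range: "e \<in> range eigvec" for e
  proof -
    obtain i where e: "e = eigvec i" using range by blast
    define a where "a = 1 / sqrt (ews i + l)"
    have We: "blinfun_apply (inv_sqrt_reg Cov l) e = (a * sqrt (ews i)) *\<^sub>R \<phi> i"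
      unfolding e inv_sqrt_reg_eigvec[OF l] by (simp add: a_def eigvec_def)
    have "inner (blinfun_apply (whitened_cov l) e) e =
        inner (blinfun_apply Cov (blinfun_apply (inv_sqrt_reg Cov l) e)) (blinfun_apply (inv_sqrt_reg Cov l) e)"
      by (simp add: whitened_cov_def inv_sqrt_adj[OF l])
    also have "\<dots> = a\<^sup>2 * ews i * inner (eigvec i) (eigvec i)"
      by (simp add: We eigvec_def blinfun.scaleR_right covariance_eigenfun power2_eq_square)
    also have "\<dots> = a\<^sup>2 * ews i" by (simp add: inner_eigvec)
    finally have G: "inner (blinfun_apply (whitened_cov l) e) e = a\<^sup>2 * ews i" .
    have "\<bar>evl (\<phi> i) (fst z) - evl (\<phi> i) (snd z)\<bar> \<le> 2 * C"
      using C[of i "fst z"] C[of i "snd z"] by linarith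
    then have "(evl (\<phi> i) (fst z) - evl (\<phi> i) (snd z))\<^sup>2 \<le> (2 * C)\<^sup>2"
      using power_mono[of "\<bar>evl (\<phi> i) (fst z) - evl (\<phi> i) (snd z)\<bar>" "2 * C" 2] by simp
    then have "a\<^sup>2 * ews i * (evl (\<phi> i) (fst z) - evl (\<phi> i) (snd z))\<^sup>2 \<le> a\<^sup>2 * ews i * (4 * C\<^sup>2)"
      using ews_pos[of i] by (intro mult_left_mono) (auto simp: power_mult_distrib)
    moreover have "(inner (whitened l z) e)\<^sup>2 = a\<^sup>2 * ews i * (evl (\<phi> i) (fst z) - evl (\<phi> i) (snd z))\<^sup>2"
    proof -
      have "inner (whitened l z) e = (a * sqrt (ews i)) * (evl (\<phi> i) (fst z) - evl (\<phi> i) (snd z))"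
        unfolding inner_whitened[OF l] We evl_scaleR by (simp add: right_diff_distrib)
      then show ?thesis using ews_pos[of i] by (simp add: power_mult_distrib)
    qed
    ultimately show ?thesis by (simp add: G mult_ac)
  qed
  have "((\<lambda>e. (inner (whitened l z) e)\<^sup>2) has_sum (norm (whitened l z))\<^sup>2) (range eigvec)"
    using orthogonal_closure_span[OF elim] by (rule parseval[OF orthonormal_eigvec])
  then have "(norm (whitened l z))\<^sup>2 \<le> 4 * C\<^sup>2 * N1 Cov l"
  proof (rule has_sum_le_finite_sums)
    fix F assume F: "finite F" "F \<subseteq> range eigvec"
    have "(\<Sum>e\<in>F. (inner (whitened l z) e)\<^sup>2) \<le> (\<Sum>e\<in>F. 4 * C\<^sup>2 * inner (blinfun_apply (whitened_cov l) e) e)"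
      using F by (intro sum_mono coord) auto
    also have "\<dots> = 4 * C\<^sup>2 * (\<Sum>e\<in>F. inner (blinfun_apply (whitened_cov l) e) e)"
      by (simp add: sum_distrib_left)
    \<comment> \<open>The trace runs over eigenvectors rather than \<open>onb\<close>; the
      comparison with \<open>N1\<close> goes through the basis-free integral.\<close>
    also have "\<dots> \<le> 4 * C\<^sup>2 * N1 Cov l"
      by (intro mult_left_mono order_trans[OF sum_whitened_cov_le[OF l] N1_lower[OF l]] F
          orthonormal_subset[OF orthonormal_eigvec]) auto
    finally show "(\<Sum>e\<in>F. (inner (whitened l z) e)\<^sup>2) \<le> 4 * C\<^sup>2 * N1 Cov l" .
  qed
  then show ?case by (simp add: C_def)
qed

end

theorem lemmaA6:
  fixes evl :: "'h::{real_inner,banach} \<Rightarrow> 'x::second_countable_topology \<Rightarrow> real"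
    and K :: "'x \<Rightarrow> 'x \<Rightarrow> real"
    and P\<^sub>0 :: "'x measure"
    and \<kappa> c\<^sub>1 \<delta> l :: real
    and ews :: "nat \<Rightarrow> real"
    and efs :: "nat \<Rightarrow> 'x \<Rightarrow> real"
    and s :: nat
  assumes setting: "centered_kernel_setting evl K P\<^sub>0 \<kappa> ews efs"
    and s: "s \<ge> 2"
    and c1: "c\<^sub>1 > 0"
    and delta: "\<delta> > 0"
    and lambda_pos: "l > 0"
    and lambda_le: "l \<le> norm (covariance_op P\<^sub>0 evl)"
  shows
    "(32 * c\<^sub>1 * \<kappa> / real s * ln (3 / \<delta>) \<le> l \<longrightarrow>
       measure (Pi\<^sub>M {1..s} (\<lambda>_. P\<^sub>0))
         {Y \<in> space (Pi\<^sub>M {1..s} (\<lambda>_. P\<^sub>0)).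
            N2 (empirical_covariance evl K s Y) l \<le>
              (norm (inv_sqrt_reg (empirical_covariance evl K s Y) l
                     o\<^sub>L sqrt_op (regularize (covariance_op P\<^sub>0 evl) l)))\<^sup>2 *
              (N2 (covariance_op P\<^sub>0 evl) l +
               (sqrt 2 / c\<^sub>1 + 1 / sqrt (2 * c\<^sub>1)) * sqrt (N1 (covariance_op P\<^sub>0 evl) l))}
       \<ge> 1 - 2 * \<delta>) \<and>
     (bdd_above (range (\<lambda>i. sup_norm (evl (eigenfun P\<^sub>0 evl ews efs i)))) \<longrightarrow>
       32 * c\<^sub>1 * (SUP i. sup_norm (evl (eigenfun P\<^sub>0 evl ews efs i)))\<^sup>2 * N1 (covariance_op P\<^sub>0 evl) l * ln (3 / \<delta>) \<le> real s \<longrightarrow>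
       measure (Pi\<^sub>M {1..s} (\<lambda>_. P\<^sub>0))
         {Y \<in> space (Pi\<^sub>M {1..s} (\<lambda>_. P\<^sub>0)).
            N2 (empirical_covariance evl K s Y) l \<le>
              (norm (inv_sqrt_reg (empirical_covariance evl K s Y) l
                     o\<^sub>L sqrt_op (regularize (covariance_op P\<^sub>0 evl) l)))\<^sup>2 *
              (N2 (covariance_op P\<^sub>0 evl) l +
               (sqrt 2 / c\<^sub>1 + 1 / sqrt (2 * c\<^sub>1)) * sqrt (N1 (covariance_op P\<^sub>0 evl) l))}
       \<ge> 1 - 2 * \<delta>)"
proof -
  interpret centered_kernel_setting evl K P\<^sub>0 \<kappa> ews efs by (rule setting)
  show ?thesis
  proof (intro conjI impI)
    assume h: "32 * c\<^sub>1 * \<kappa> / real s * ln (3 / \<delta>) \<le> l"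
    show "1 - 2 * \<delta> \<le> measure (Pi\<^sub>M {1..s} (\<lambda>_. P\<^sub>0))
         {Y \<in> space (Pi\<^sub>M {1..s} (\<lambda>_. P\<^sub>0)).
            N2 (empirical_covariance evl K s Y) l \<le>
              (norm (inv_sqrt_reg (empirical_covariance evl K s Y) l
                     o\<^sub>L sqrt_op (regularize (covariance_op P\<^sub>0 evl) l)))\<^sup>2 *
              (N2 (covariance_op P\<^sub>0 evl) l +
               (sqrt 2 / c\<^sub>1 + 1 / sqrt (2 * c\<^sub>1)) * sqrt (N1 (covariance_op P\<^sub>0 evl) l))}"
    proof (rule event_probability[OF _ lambda_pos s c1 delta lambda_le])
      show "AE z in P\<^sub>0 \<Otimes>\<^sub>M P\<^sub>0. (norm (whitened l z))\<^sup>2 / 2 \<le> 2 * \<kappa> / l"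
        using norm_whitened_bound[OF lambda_pos] by (intro AE_I2) (simp add: field_simps)
      show "16 * c\<^sub>1 * (2 * \<kappa> / l) * ln (3 / \<delta>) \<le> real s"
        using h s lambda_pos by (simp add: field_simps)
    qed
  next
    assume bdd: "bdd_above (range (\<lambda>i. sup_norm (evl (eigenfun P\<^sub>0 evl ews efs i))))"
      and h: "32 * c\<^sub>1 * (SUP i. sup_norm (evl (eigenfun P\<^sub>0 evl ews efs i)))\<^sup>2 * N1 (covariance_op P\<^sub>0 evl) l * ln (3 / \<delta>) \<le> real s"
    show "1 - 2 * \<delta> \<le> measure (Pi\<^sub>M {1..s} (\<lambda>_. P\<^sub>0))
         {Y \<in> space (Pi\<^sub>M {1..s} (\<lambda>_. P\<^sub>0)).
            N2 (empirical_covariance evl K s Y) l \<le>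
              (norm (inv_sqrt_reg (empirical_covariance evl K s Y) l
                     o\<^sub>L sqrt_op (regularize (covariance_op P\<^sub>0 evl) l)))\<^sup>2 *
              (N2 (covariance_op P\<^sub>0 evl) l +
               (sqrt 2 / c\<^sub>1 + 1 / sqrt (2 * c\<^sub>1)) * sqrt (N1 (covariance_op P\<^sub>0 evl) l))}"
      by (rule event_probability[OF whitened_bound_eigenfun[OF lambda_pos bdd] lambda_pos s c1 delta lambda_le])
        (use h in \<open>simp add: mult_ac\<close>)
  qed
qed

end
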